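(* Let $p\ge1$ be an integer and let $\lambda=\frac nm$ with $n,m$ relatively prime positive integers and $\lambda>\sqrt{\frac{p+2}{p}}$. There exists a constant $c_{p,\lambda}>0$ with the following property. Let $\gamma_{0\delta}=\gamma_m+\delta\varphi\,\mathbf N$ be a $\frac{2\pi}{\lambda}$-periodic perturbation of the $m$-fold circle $\gamma_m$, and suppose $|\delta|$ is small enough so that the curvature $\psi$ of $\gamma_{0\delta}$ satisfies $$\frac{\lambda}{2\pi}\int_0^{\frac{2\pi}{\lambda}}\psi(\theta)\,d\theta\ \ge\ c_{p,\lambda}\|\psi\|_2 .$$ Then, for every integer $l\ge0$, the curvature $\tilde k(\cdot,\tau)$ of the solution to the normalized $p$-curve shortening flow with initial condition $\left(\frac{p}{(p+1)T}\right)^{\frac1{p+1}}\gamma_{0\delta}$ satisfies, for all $\tau\ge0$, $$\left\|\tilde k(\cdot,\tau)-\frac{\lambda}{2\pi}\int_0^{\frac{2\pi}{\lambda}}\tilde k(\theta,\tau)\,d\theta\right\|_{C^l\left(\left[0,\frac{2\pi}{\lambda}\right]\right)}\le A_{l,p,\lambda}\exp\left(-\beta(p,\lambda)\tau\right),$$ where $$\beta(p,\lambda)=\left(\lambda^2-\frac{p+2}{p}\right)p+1=\lambda^2p-p-1,$$ and $A_{l,p,\lambda}>0$ is a constant which depends only on $l$, the initial condition, $p$ and $\lambda$. Furthermore, the deformation towards a circle is through analytic curves (for $\tau>0$).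
   Context: The $p$-curve shortening flow is $\frac{\partial x}{\partial t}=-\frac1p k^pN$ for smooth immersed closed curves in $\mathbb R^2$, with $k$ the curvature and $N$ the outward unit normal. The $m$-fold circle is $\gamma_m(\theta)=(\cos\theta,\sin\theta)$, $\theta\in[0,2\pi m]$; $\mathbf N$ is its outward unit normal; $\varphi$ is a smooth function of the normal angle $\theta$ of period $\frac{2\pi m}{n}=\frac{2\pi}{\lambda}$; $|\delta|>0$ is small enough that $\gamma_{0\delta}$ has strictly positive curvature. Curvatures are viewed as functions of the normal angle $\theta$, and are $\frac{2\pi}\lambda$-periodic. The curvature $k(\theta,t)$ of the solution of the $p$-curve shortening flow starting at $\gamma_{0\delta}$ satisfies $$k_t=k^2\left(k^{p-1}k_{\theta\theta}+(p-1)k^{p-2}k_\theta^2+\tfrac1pk^p\right),\qquad k(\cdot,0)=\psi,$$ with $\frac{2\pi}{\lambda}$-periodic boundary conditions, and blows up at a finite time $T$. The normalized flow is obtained by rescaling the curves by $\left(\frac{p}{(p+1)(T-t)}\right)^{\frac1{p+1}}$ and changing time; its curvature is $$\tilde k(\theta,\tau)=\left(\frac{p+1}{p}\right)^{\frac1{p+1}}(T-t)^{\frac1{p+1}}k(\theta,t),\qquad \tau=-\frac1{p+1}\log\left(1-\frac tT\right).$$ Fourier expansions are $f=\sum_{n\in\mathbb Z}\hat f(n)e^{i\lambda n\theta}$, and $\|f\|_2=\max\{\sup_{n\ne0}|n|^2|\mathrm{Re}\,\hat f(n)|,\sup_{n\ne0}|n|^2|\mathrm{Im}\,\hat f(n)|\}$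 (not the $L^2$ norm). $\|f\|_{C^l}=\max_{0\le j\le l}\sup_\theta|f^{(j)}(\theta)|$. *)

theory Defs
  imports "HOL-Analysis.Analysis"
begin

text \<open>The Euclidean plane is the type \<^typ>\<open>complex\<close>, so that rotation by a right angle
  is multiplication by \<^term>\<open>\<i>\<close>. A closed curve is a periodic function on the real line, and
  a time-dependent family of curves \<^term>\<open>X\<close> is applied as \<^term>\<open>X t u\<close>
  (time first, then the curve parameter).\<close>

definition smooth_fun :: "(real \<Rightarrow> 'a::real_normed_vector) \<Rightarrow> bool" where
  "smooth_fun f \<longleftrightarrow>
     (\<exists>D. D 0 = f \<and> (\<forall>j x. (D j has_vector_derivative D (Suc j) x) (at x)))"

text \<open>Joint smoothness in time and parameter, up to the boundary of the time interval
  \<^term>\<open>I\<close>: \<^term>\<open>D i j\<close> is the partial derivative of order \<^term>\<open>i\<close> in time and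
  \<^term>\<open>j\<close> in the parameter.\<close>

definition smooth_family :: "real set \<Rightarrow> (real \<Rightarrow> real \<Rightarrow> 'a::real_normed_vector) \<Rightarrow> bool" where
  "smooth_family I X \<longleftrightarrow>
     (\<exists>D. D 0 0 = X \<and>
        (\<forall>i j. continuous_on (I \<times> UNIV) (\<lambda>(t, u). D i j t u) \<and>
          (\<forall>t\<in>I. \<forall>u.
             ((\<lambda>s. D i j s u) has_vector_derivative D (Suc i) j t u) (at t within I) \<and>
             (D i j t has_vector_derivative D i (Suc j) t u) (at u))))"

definition real_analytic :: "(real \<Rightarrow> 'a::real_normed_vector) \<Rightarrow> bool" where
  "real_analytic f \<longleftrightarrow>
     (\<forall>x. \<exists>r>0. \<exists>a. \<forall>y. \<bar>y - x\<bar> < r \<longrightarrow> (\<lambda>j. (y - x) ^ j *\<^sub>R a j) sums f y)"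

text \<open>Orientation: the counterclockwise unit circle has outward normal \<^term>\<open>cis u\<close> and
  curvature 1. The numerator of the curvature is the determinant of the first two derivatives.\<close>

definition outward_normal :: "(real \<Rightarrow> complex) \<Rightarrow> real \<Rightarrow> complex" where
  "outward_normal \<gamma> u = - \<i> * sgn (vector_derivative \<gamma> (at u))"

definition curvature :: "(real \<Rightarrow> complex) \<Rightarrow> real \<Rightarrow> real" where
  "curvature \<gamma> u =
     Im (cnj (vector_derivative \<gamma> (at u)) *
         vector_derivative (\<lambda>v. vector_derivative \<gamma> (at v)) (at u))
     / norm (vector_derivative \<gamma> (at u)) ^ 3"

text \<open>A normal angle is a continuous lift of the outward normal, hence determined up to a
  constant in \<open>2\<pi>\<int>\<close>; for families the lift is continuous in both variables.\<close>

definition normal_angle :: "(real \<Rightarrow> complex) \<Rightarrow> (real \<Rightarrow> real) \<Rightarrow> bool" where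
  "normal_angle \<gamma> \<theta> \<longleftrightarrow>
     continuous_on UNIV \<theta> \<and> (\<forall>u. outward_normal \<gamma> u = cis (\<theta> u))"

definition normal_angle_family ::
    "real set \<Rightarrow> (real \<Rightarrow> real \<Rightarrow> complex) \<Rightarrow> (real \<Rightarrow> real \<Rightarrow> real) \<Rightarrow> bool" where
  "normal_angle_family I Y \<Theta> \<longleftrightarrow>
     continuous_on (I \<times> UNIV) (\<lambda>(t, u). \<Theta> t u) \<and>
     (\<forall>t\<in>I. \<forall>u. outward_normal (Y t) u = cis (\<Theta> t u))"

text \<open>Curvature as a function of the normal angle. For a closed curve of positive curvature
  and nonzero rotation index the normal angle is an increasing bijection of the real line, so
  that \<^const>\<open>inv\<close> is a genuine inverse.\<close>

definition angle_curvature ::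
    "(real \<Rightarrow> complex) \<Rightarrow> (real \<Rightarrow> real) \<Rightarrow> real \<Rightarrow> real" where
  "angle_curvature \<gamma> \<theta> x = curvature \<gamma> (inv \<theta> x)"

text \<open>The m-fold circle is \<^const>\<open>cis\<close> as a curve of period \<open>2\<pi>m\<close>; its outward unit normal
  at the parameter \<^term>\<open>u\<close> is \<^term>\<open>cis u\<close>, and \<^term>\<open>u\<close> is its normal angle.
  A perturbation with \<open>1 + \<delta> \<phi> > 0\<close> is immersed and star-shaped about the origin, so it keeps the
  rotation index m. Positive curvature alone does not exclude, for large \<^term>\<open>\<delta>\<close>,
  limacon-like curves of another rotation index.\<close>

definition perturbed_circle :: "(real \<Rightarrow> real) \<Rightarrow> real \<Rightarrow> real \<Rightarrow> complex" where
  "perturbed_circle \<phi> \<delta> u = cis u + (\<delta> * \<phi> u) *\<^sub>R cis u"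

definition pcsf_solution ::
    "nat \<Rightarrow> nat \<Rightarrow> (real \<Rightarrow> complex) \<Rightarrow> real \<Rightarrow> (real \<Rightarrow> real \<Rightarrow> complex) \<Rightarrow> bool" where
  "pcsf_solution p m \<gamma> T X \<longleftrightarrow>
     0 < T \<and> smooth_family {0..<T} X \<and> X 0 = \<gamma> \<and>
     (\<forall>t\<in>{0..<T}. \<forall>u.
        X t (u + 2 * pi * real m) = X t u \<and>
        vector_derivative (X t) (at u) \<noteq> 0 \<and>
        ((\<lambda>s. X s u) has_vector_derivative
           - (1 / real p * curvature (X t) u ^ p) *\<^sub>R outward_normal (X t) u)
          (at t within {0..<T}))"

text \<open>A solution smooth on \<open>[0,T)\<close> has bounded curvature on compact time intervals, so
  unbounded curvature means blow-up exactly at time \<^term>\<open>T\<close>.\<close>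

definition blows_up_at :: "real \<Rightarrow> (real \<Rightarrow> real \<Rightarrow> complex) \<Rightarrow> bool" where
  "blows_up_at T X \<longleftrightarrow> (\<forall>M. \<exists>t\<in>{0..<T}. \<exists>u. M < curvature (X t) u)"

text \<open>\<^term>\<open>original_time p T\<close> inverts \<open>\<tau> = - log (1 - t/T) / (p+1)\<close>.\<close>

definition original_time :: "nat \<Rightarrow> real \<Rightarrow> real \<Rightarrow> real" where
  "original_time p T \<tau> = T * (1 - exp (- (real p + 1) * \<tau>))"

definition normalized_flow ::
    "nat \<Rightarrow> real \<Rightarrow> (real \<Rightarrow> real \<Rightarrow> complex) \<Rightarrow> real \<Rightarrow> real \<Rightarrow> complex" where
  "normalized_flow p T X \<tau> u =
     (let t = original_time p T \<tau>
      in (real p / ((real p + 1) * (T - t))) powr (1 / (real p + 1)) *\<^sub>R X t u)"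

definition period_mean :: "real \<Rightarrow> (real \<Rightarrow> real) \<Rightarrow> real" where
  "period_mean lam f = lam / (2 * pi) * integral {0..2 * pi / lam} f"

definition fourier_coeff :: "real \<Rightarrow> (real \<Rightarrow> real) \<Rightarrow> int \<Rightarrow> complex" where
  "fourier_coeff lam f k =
     (lam / (2 * pi)) *\<^sub>R
       integral {0..2 * pi / lam} (\<lambda>x. complex_of_real (f x) * cis (- (lam * of_int k * x)))"

definition norm_2 :: "real \<Rightarrow> (real \<Rightarrow> real) \<Rightarrow> real" where
  "norm_2 lam f =
     max (SUP k\<in>- {0}. \<bar>real_of_int k\<bar>\<^sup>2 * \<bar>Re (fourier_coeff lam f k)\<bar>)
         (SUP k\<in>- {0}. \<bar>real_of_int k\<bar>\<^sup>2 * \<bar>Im (fourier_coeff lam f k)\<bar>)"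

definition Cl_norm :: "nat \<Rightarrow> real set \<Rightarrow> (real \<Rightarrow> real) \<Rightarrow> real" where
  "Cl_norm l S f = Max ((\<lambda>j. SUP x\<in>S. \<bar>(deriv ^^ j) f x\<bar>) ` {..l})"

definition decay_rate :: "nat \<Rightarrow> real \<Rightarrow> real" where
  "decay_rate p lam = (lam\<^sup>2 - (real p + 2) / real p) * real p + 1"

lemma decay_rate_eq:
  assumes "1 \<le> p"
  shows "decay_rate p lam = lam\<^sup>2 * real p - real p - 1"
  using assms by (simp add: decay_rate_def field_simps)

text \<open>Analyticity of a closed curve of period \<^term>\<open>P\<close> is a property of the curve, not of the
  given parametrization: a flow in the normal direction does not improve the regularity of the
  parametrization inherited from the initial curve.\<close>

definition analytic_closed_curve :: "real \<Rightarrow> (real \<Rightarrow> complex) \<Rightarrow> bool" where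
  "analytic_closed_curve P \<gamma> \<longleftrightarrow>
     (\<exists>h. smooth_fun h \<and> (\<forall>v. 0 < deriv h v) \<and> (\<forall>v. h (v + P) = h v + P) \<and>
          real_analytic (\<gamma> \<circ> h) \<and> (\<forall>v. vector_derivative (\<gamma> \<circ> h) (at v) \<noteq> 0))"

end

theory Submission
  imports Defs "HOL-Complex_Analysis.Complex_Analysis"
begin

text \<open>As a function of the normal angle, write the curvature as \<open>k = K (1 + w)\<close> with \<open>K\<close> its mean. On the
  Fourier coefficients \<open>z q\<close> of \<open>w\<close> the equation is a linear damping of rate \<open>\<lambda>\<^sup>2q\<^sup>2 - (p+1)/p\<close>, in the
  time \<open>\<sigma>\<close> with \<open>d\<sigma> = K\<^bsup>p+1\<^esup> dt\<close>, plus terms that are quadratic in \<open>w\<close>. If \<open>|z q| \<le> M / (q\<^sup>2 \<Omega> q)\<close> for a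
  submultiplicative weight \<open>\<Omega> \<ge> 1\<close>, then the coefficients of the quadratic terms are \<open>O(M\<^sup>2 / \<Omega> q)\<close>, because
  the sequences \<open>O(1/q\<^sup>2)\<close> are summable and the two derivatives in \<open>w''\<close> are exactly compensated by \<open>q\<^sup>2\<close>.
  For small \<open>M\<close> the damping wins on the boundary of this region, even while \<open>M\<close> shrinks at the rate of
  the first mode and the weight grows like \<open>exp (a |q|)\<close>; so the region is never left. With a
  polynomial weight this gives the decay of all derivatives, with an exponential weight analyticity.
  Blow-up at \<open>T\<close> forces \<open>K\<^bsup>-(p+1)\<^esup>\<close> to be comparable to \<open>T - t\<close>, which turns decay in \<open>\<sigma>\<close> into decay in \<open>\<tau>\<close>.
  The symmetry of the initial curve is inherited by the curvature because of the maximum principle.\<close>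

subsection \<open>Fourier series\<close>

text \<open>The constant in the smallness hypothesis may not depend on the order \<open>l\<close>,
  although decay is claimed for every \<open>l\<close>. The polynomial weight is therefore
  \<open>(1 + \<epsilon> * |q|) ^ l\<close>. It stays below 2 on the modes of which only the
  smallness is known, and it grows only where the smoothness of the initial curve already makes the
  modes tiny. Thus \<epsilon> depends on \<open>l\<close> and on the initial curve, but the radius
  of the trapping region does not. A second obstacle is that infinitely many modes need not have a
  first exit time. On a compact time interval, smoothness puts all high modes strictly below a
  barrier that decays only polynomially in \<open>q\<close>, so finitely many modes remain. This is
  why the exponential weight has to be truncated; the resulting bounds are uniform in the truncation
  level, and each mode is read off at a level that does not affect it. Finally, the claimed rate is
  exactly that of the first mode, with no margin. The quadratic losses are integrable in the clock,
  so a bounded factor pays for them.\<close>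

definition echar :: "real \<Rightarrow> int \<Rightarrow> real \<Rightarrow> complex" where
  "echar lam q x = cis (lam * of_int q * x)"

definition fco :: "real \<Rightarrow> (real \<Rightarrow> complex) \<Rightarrow> int \<Rightarrow> complex" where
  "fco lam F q = (lam / (2 * pi)) *\<^sub>R integral {0..2 * pi / lam} (\<lambda>x. F x * echar lam (- q) x)"

lemma echar_0 [simp]: "echar lam 0 x = 1"
  by (simp add: echar_def)

lemma echar_add: "echar lam (q + r) x = echar lam q x * echar lam r x"
  by (simp add: echar_def cis_mult algebra_simps)

lemma norm_echar [simp]: "norm (echar lam q x) = 1"
  by (simp add: echar_def)

lemma cnj_echar: "cnj (echar lam q x) = echar lam (- q) x"
  by (simp add: echar_def cis_cnj)

lemma continuous_on_echar [continuous_intros]: "continuous_on S (echar lam q)"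
  unfolding echar_def by (intro continuous_intros)

lemma cis_has_vector_derivative:
  assumes "(f has_real_derivative f') (at x within S)"
  shows "((\<lambda>x. cis (f x)) has_vector_derivative \<i> * of_real f' * cis (f x)) (at x within S)"
proof -
  have "((\<lambda>x. \<i> * complex_of_real (f x)) has_vector_derivative \<i> * of_real f') (at x within S)"
    by (rule has_vector_derivative_mult_right, rule has_vector_derivative_of_real, rule assms)
  from field_vector_diff_chain_within[OF this, of exp "exp (\<i> * complex_of_real (f x))"]
  show ?thesis
    unfolding cis_conv_exp by (auto simp: o_def intro!: DERIV_exp[THEN has_field_derivative_at_within])
qed

lemma echar_has_vector_derivative:
  "(echar lam q has_vector_derivative \<i> * of_real (lam * of_int q) * echar lam q x) (at x within S)"
  unfolding echar_def[abs_def] by (rule cis_has_vector_derivative) (auto intro!: derivative_eq_intros)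

lemma echar_period:
  assumes "lam > 0"
  shows "echar lam q (2 * pi / lam) = 1"
proof -
  have "lam * of_int q * (2 * pi / lam) = 2 * pi * of_int q"
    using assms by (simp add: field_simps)
  then show ?thesis
    unfolding echar_def by (simp add: cis_multiple_2pi)
qed

lemma fco_of_real: "fco lam (\<lambda>x. of_real (f x)) = fourier_coeff lam f"
  by (rule ext) (simp add: fco_def fourier_coeff_def echar_def)

lemma integral_echar:
  assumes "lam > 0"
  shows "integral {0..2 * pi / lam} (echar lam q) = (if q = 0 then of_real (2 * pi / lam) else 0)"
proof (cases "q = 0")
  case True
  then show ?thesis using assms
    by (simp add: echar_def[abs_def] scaleR_conv_of_real)
next
  case False
  define c where "c = \<i> * complex_of_real (lam * of_int q)"
  have c: "c \<noteq> 0" using False assms by (simp add: c_def)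
  have "((\<lambda>x. c * echar lam q x) has_integral (echar lam q (2 * pi / lam) - echar lam q 0)) {0..2 * pi / lam}"
    using assms unfolding c_def
    by (intro fundamental_theorem_of_calculus echar_has_vector_derivative) auto
  then have "((\<lambda>x. c * echar lam q x) has_integral 0) {0..2 * pi / lam}"
    using echar_period[OF assms] by (simp add: echar_def)
  then have "((\<lambda>x. inverse c * (c * echar lam q x)) has_integral inverse c * 0) {0..2 * pi / lam}"
    by (rule has_integral_mult_right)
  then have "(echar lam q has_integral 0) {0..2 * pi / lam}"
    using c by (simp add: mult.assoc[symmetric])
  then show ?thesis using False by (simp add: integral_unique)
qed

lemma norm_fco_le:
  assumes "lam > 0" "continuous_on {0..2 * pi / lam} F"
    and "\<And>x. x \<in> {0..2 * pi / lam} \<Longrightarrow> norm (F x) \<le> B"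
  shows "norm (fco lam F q) \<le> B"
proof -
  have "norm (integral {0..2 * pi / lam} (\<lambda>x. F x * echar lam (- q) x)) \<le> B * (2 * pi / lam - 0)"
    using assms by (intro integral_bound) (auto intro!: continuous_intros simp: norm_mult)
  then show ?thesis
    using assms(1) by (simp add: fco_def field_simps)
qed

lemma fco_add:
  assumes "continuous_on {0..2 * pi / lam} F" "continuous_on {0..2 * pi / lam} G"
  shows "fco lam (\<lambda>x. F x + G x) q = fco lam F q + fco lam G q"
proof -
  have "integral {0..2 * pi / lam} (\<lambda>x. F x * echar lam (- q) x + G x * echar lam (- q) x) =
     integral {0..2 * pi / lam} (\<lambda>x. F x * echar lam (- q) x) + integral {0..2 * pi / lam} (\<lambda>x. G x * echar lam (- q) x)"
    using assms by (intro integral_add integrable_continuous_real continuous_intros)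
  then show ?thesis by (simp add: fco_def algebra_simps)
qed

lemma fco_cmult: "fco lam (\<lambda>x. c * F x) q = c * fco lam F q"
  by (simp add: fco_def mult.assoc)

text \<open>Integration by parts over one period; the boundary terms cancel because \<open>F\<close>
  and the character both take equal values at the two ends.\<close>

lemma fco_deriv:
  assumes lam: "lam > 0"
    and der: "\<And>x. (F has_vector_derivative F' x) (at x)"
    and cont: "continuous_on UNIV F'"
    and per: "F (2 * pi / lam) = F 0"
  shows "fco lam F' q = \<i> * of_real (lam * of_int q) * fco lam F q"
proof -
  let ?L = "2 * pi / lam"
  define c where "c = \<i> * complex_of_real (lam * of_int q)"
  have contF: "continuous_on S F" for S
    using der by (meson continuous_on_eq_continuous_within continuous_at_imp_continuous_on has_vector_derivative_continuous)
  have contF': "continuous_on S F'" for S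
    using cont continuous_on_subset by blast
  have "((\<lambda>x. F x * (\<i> * of_real (lam * of_int (-q)) * echar lam (-q) x) + F' x * echar lam (-q) x) has_integral
      (F ?L * echar lam (-q) ?L - F 0 * echar lam (-q) 0)) {0..?L}"
    using lam by (intro fundamental_theorem_of_calculus has_vector_derivative_mult echar_has_vector_derivative
        der[THEN has_vector_derivative_at_within]) auto
  then have 1: "((\<lambda>x. F' x * echar lam (-q) x - c * (F x * echar lam (-q) x)) has_integral 0) {0..?L}"
    using echar_period[OF lam, of "-q"] per by (simp add: c_def echar_def algebra_simps)
  have 2: "((\<lambda>x. c * (F x * echar lam (-q) x)) has_integral c * integral {0..?L} (\<lambda>x. F x * echar lam (-q) x)) {0..?L}"
    by (intro has_integral_mult_right integrable_integral integrable_continuous_real continuous_intros contF)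
  have "((\<lambda>x. F' x * echar lam (-q) x) has_integral c * integral {0..?L} (\<lambda>x. F x * echar lam (-q) x)) {0..?L}"
    using has_integral_add[OF 1 2] by simp
  then show ?thesis
    by (simp add: fco_def c_def integral_unique)
qed

subsection \<open>Completeness of the trigonometric system\<close>

text \<open>The class of multipliers preserving the vanishing of all Fourier coefficients is closed under
  products by its very form; hence it contains all polynomials in the coordinates of the circle.\<close>

definition annihilator_mult :: "real \<Rightarrow> (real \<Rightarrow> complex) \<Rightarrow> bool" where
  "annihilator_mult lam f \<longleftrightarrow> continuous_on UNIV f \<and>
     (\<forall>H. continuous_on UNIV H \<longrightarrow> (\<forall>q. fco lam H q = 0) \<longrightarrow> (\<forall>q. fco lam (\<lambda>x. H x * f x) q = 0))"

lemma annihilator_mult_echar: "annihilator_mult lam (\<lambda>x. c * echar lam r x)"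
proof -
  have "fco lam (\<lambda>x. H x * (c * echar lam r x)) q = c * fco lam H (q - r)" for H q
    using echar_add[of lam r "-q"] by (simp add: fco_def algebra_simps)
  then show ?thesis unfolding annihilator_mult_def by (auto intro!: continuous_intros)
qed

lemma annihilator_mult_add:
  assumes "annihilator_mult lam f" "annihilator_mult lam g"
  shows "annihilator_mult lam (\<lambda>x. f x + g x)"
  unfolding annihilator_mult_def
proof (intro conjI allI impI)
  show "continuous_on UNIV (\<lambda>x. f x + g x)"
    using assms by (auto simp: annihilator_mult_def intro!: continuous_intros)
next
  fix H q assume H: "continuous_on UNIV H" "\<forall>q. fco lam H q = 0"
  have "fco lam (\<lambda>x. H x * f x + H x * g x) q = fco lam (\<lambda>x. H x * f x) q + fco lam (\<lambda>x. H x * g x) q"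
    using assms H by (intro fco_add continuous_intros) (auto simp: annihilator_mult_def intro: continuous_on_subset)
  then show "fco lam (\<lambda>x. H x * (f x + g x)) q = 0"
    using assms H by (simp add: annihilator_mult_def algebra_simps)
qed

lemma annihilator_mult_mult:
  assumes "annihilator_mult lam f" "annihilator_mult lam g"
  shows "annihilator_mult lam (\<lambda>x. f x * g x)"
  unfolding annihilator_mult_def
proof (intro conjI allI impI)
  show "continuous_on UNIV (\<lambda>x. f x * g x)"
    using assms by (auto simp: annihilator_mult_def intro!: continuous_intros)
next
  fix H q assume H: "continuous_on UNIV H" "\<forall>q. fco lam H q = 0"
  then have "\<forall>q. fco lam (\<lambda>x. H x * f x) q = 0" "continuous_on UNIV (\<lambda>x. H x * f x)"
    using assms by (auto simp: annihilator_mult_def intro!: continuous_intros)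
  then show "fco lam (\<lambda>x. H x * (f x * g x)) q = 0"
    using assms unfolding annihilator_mult_def by (simp add: mult.assoc[symmetric])
qed

text \<open>A real linear form on the plane is a combination of the coordinate and its conjugate,
  and on the circle these are the characters of index 1 and -1. Sums and products follow from the
  closure properties.\<close>

lemma annihilator_mult_polynomial:
  fixes r :: "complex \<Rightarrow> real"
  assumes "real_polynomial_function r"
  shows "annihilator_mult lam (\<lambda>x. of_real (r (echar lam 1 x)))"
  using assms
proof induction
  case (linear f)
  interpret bounded_linear f by fact
  have e: "complex_of_real (f z) = ((of_real (f 1) - \<i> * of_real (f \<i>)) / 2) * z + ((of_real (f 1) + \<i> * of_real (f \<i>)) / 2) * cnj z" for z
  proof -
    have "f z = f (Re z *\<^sub>R 1 + Im z *\<^sub>R \<i>)"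
      by (rule arg_cong[where f=f]) (simp add: complex_eq_iff)
    also have "\<dots> = Re z * f 1 + Im z * f \<i>"
      by (simp only: add scaleR real_scaleR_def)
    finally have "f z = Re z * f 1 + Im z * f \<i>" .
    then show ?thesis by (simp add: complex_eq_iff field_simps)
  qed
  have eq: "(\<lambda>x. complex_of_real (f (echar lam 1 x))) = (\<lambda>x. ((of_real (f 1) - \<i> * of_real (f \<i>)) / 2) * echar lam 1 x + ((of_real (f 1) + \<i> * of_real (f \<i>)) / 2) * echar lam (-1) x)"
    by (rule ext, rule e[of "echar lam 1 x" for x, unfolded cnj_echar])
  show ?case unfolding eq
    by (rule annihilator_mult_add[OF annihilator_mult_echar annihilator_mult_echar])
next
  case (const c)
  show ?case using annihilator_mult_echar[of lam "of_real c" 0] by simp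
next
  case (add f g)
  then show ?case by (simp add: annihilator_mult_add)
next
  case (mult f g)
  then show ?case by (simp add: annihilator_mult_mult)
qed

lemma periodic_int:
  fixes H :: "real \<Rightarrow> 'a"
  assumes "\<And>x. H (x + L) = H x"
  shows "H (x + of_int q * L) = H x"
proof -
  have 1: "H (x + of_nat n * L) = H x" for x n
  proof (induction n)
    case (Suc n)
    have "H (x + of_nat (Suc n) * L) = H (x + of_nat n * L + L)" by (simp add: algebra_simps)
    then show ?case using assms Suc by simp
  qed simp
  show ?thesis
  proof (cases "q \<ge> 0")
    case True
    then show ?thesis using 1[of x "nat q"] by simp
  next
    case False
    then have "of_nat (nat (-q)) = - real_of_int q" by simp
    then show ?thesis using 1[of "x + of_int q * L" "nat (-q)"] by (simp add: algebra_simps)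
  qed
qed

lemma periodic_representative:
  fixes H :: "real \<Rightarrow> 'a"
  assumes per: "\<And>x. H (x + L) = H x" and L: "0 < L"
  obtains y where "y \<in> {0..L}" "H y = H x"
proof -
  let ?q = "- \<lfloor>x / L\<rfloor>"
  have "of_int \<lfloor>x / L\<rfloor> \<le> x / L" "x / L \<le> of_int \<lfloor>x / L\<rfloor> + 1" by linarith+
  then have "of_int \<lfloor>x / L\<rfloor> * L \<le> x" "x \<le> (of_int \<lfloor>x / L\<rfloor> + 1) * L"
    using L by (simp_all only: pos_le_divide_eq pos_divide_le_eq)
  then have "x + of_int ?q * L \<in> {0..L}" by (simp add: algebra_simps)
  then show thesis using that periodic_int[of H L, OF per] by blast
qed

text \<open>A periodic function descends to the circle through \<open>Arg\<close>, whose jump must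
  not destroy continuity. By \<open>key\<close>, every angle of a point gives the same value, so the
  branch may be changed locally.\<close>

lemma circle_function:
  assumes lam: "lam > 0" and cont: "continuous_on UNIV H" and per: "\<And>x. H (x + 2 * pi / lam) = H x"
  obtains h :: "complex \<Rightarrow> complex" where "continuous_on (sphere 0 1) h" "\<And>x. h (echar lam 1 x) = H x"
proof -
  define h where "h z = H (Arg z / lam)" for z
  have key: "h z = H (y / lam)" if "cis y = z" for y z
  proof -
    have "cis y = cis (Arg z)" using that cis_Arg[of z] by (auto simp: sgn_div_norm)
    then have "exp (\<i> * of_real y) = exp (\<i> * of_real (Arg z))" by (simp add: cis_conv_exp)
    then obtain n where "\<i> * of_real y = \<i> * of_real (Arg z) + of_int (2 * n) * of_real pi * \<i>"
      by (auto simp: exp_eq)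
    then have "\<i> * complex_of_real y = \<i> * complex_of_real (Arg z + of_int (2 * n) * pi)"
      by (simp add: algebra_simps)
    then have "complex_of_real y = complex_of_real (Arg z + of_int (2 * n) * pi)"
      by (simp only: mult_cancel_left) simp
    then have "y = Arg z + of_int (2 * n) * pi" by (simp only: of_real_eq_iff)
    then have "y / lam = Arg z / lam + of_int n * (2 * pi / lam)" using lam by (simp add: field_simps)
    then show ?thesis using periodic_int[of H "2 * pi / lam", OF per] by (simp add: h_def)
  qed
  have "continuous (at z within sphere 0 1) h" if z: "norm z = 1" for z
  proof -
    have z0: "z \<noteq> 0" using z by auto
    \<comment> \<open>The branch of the angle centred at \<open>z\<close>: \<open>w / z\<close> is
      near 1, where \<open>Ln\<close> is continuous.\<close>
    define g where "g w = H ((Arg z + Im (Ln (w / z))) / lam)" for w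
    have "isCont (\<lambda>w. (Arg z + Im (Ln (w / z))) / lam) z"
      using z0 lam by (auto intro!: continuous_intros)
    then have "isCont g z" unfolding g_def
      using cont by (intro continuous_within_compose3[where g=H and f="\<lambda>w. (Arg z + Im (Ln (w / z))) / lam"])
        (auto simp: continuous_on_eq_continuous_at)
    then have "(g \<longlongrightarrow> g z) (at z within sphere 0 1)"
      by (simp add: continuous_at_imp_continuous_at_within continuous_within[symmetric])
    moreover have hg: "h w = g w" if w: "norm w = 1" for w
    proof -
      have "w / z \<noteq> 0" using w z by auto
      then have "exp (of_real (ln (norm (w / z))) + \<i> * of_real (Im (Ln (w / z)))) = w / z"
        by (metis Re_Ln complex_eq exp_Ln of_real_eq_iff)
      then have "cis (Im (Ln (w / z))) = w / z" using w z by (simp add: norm_divide cis_conv_exp)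
      moreover have "cis (Arg z) = z" using cis_Arg[OF z0] z by (simp add: sgn_div_norm)
      ultimately have "cis (Arg z + Im (Ln (w / z))) = w" using z0 by (simp add: cis_mult[symmetric])
      then show ?thesis using key[of "Arg z + Im (Ln (w / z))" w] by (simp add: g_def)
    qed
    ultimately have "(h \<longlongrightarrow> h z) (at z within sphere 0 1)"
      using z by (subst (asm) hg[OF z, symmetric])
        (erule Lim_transform_eventually, auto simp: eventually_at_filter hg)
    then show ?thesis by (simp add: continuous_within)
  qed
  then have "continuous_on (sphere 0 1) h"
    by (simp add: continuous_on_eq_continuous_within)
  moreover have "h (echar lam 1 x) = H x" for x
    using key[of "lam * x" "echar lam 1 x"] lam by (simp add: echar_def)
  ultimately show thesis using that by blast
qed

text \<open>By Stone-Weierstrass some polynomial \<open>g\<close> on the circle is close to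
  \<open>cnj H\<close>. The mean of \<open>H * g\<close> vanishes, so the mean of the squared
  modulus of \<open>H\<close> equals that of \<open>H * (cnj H - g)\<close> and is arbitrarily
  small. Continuity then forces \<open>H = 0\<close>, first on one period.\<close>

lemma fco_complete:
  assumes lam: "lam > 0" and cont: "continuous_on UNIV H" and per: "\<And>x. H (x + 2 * pi / lam) = H x"
    and zero: "\<And>q. fco lam H q = 0"
  shows "H x = 0"
proof -
  let ?L = "2 * pi / lam"
  have contH: "continuous_on S H" for S using cont continuous_on_subset by blast
  obtain h where h: "continuous_on (sphere 0 1) h" "\<And>x. h (echar lam 1 x) = H x"
    using circle_function[OF lam cont per] by metis
  have "norm (fco lam (\<lambda>x. H x * cnj (H x)) 0) \<le> e" if e: "e > 0" for e
  proof -
    obtain B where B: "\<And>x. x \<in> {0..?L} \<Longrightarrow> norm (H x) \<le> B" "B > 0"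
      using compact_imp_bounded[OF compact_continuous_image[OF contH[of "{0..?L}"] compact_Icc]]
      unfolding bounded_pos by (metis imageI)
    obtain g where g: "polynomial_function g" "\<And>z. z \<in> sphere 0 1 \<Longrightarrow> norm (cnj (h z) - g z) < e / B"
      using Stone_Weierstrass_polynomial_function[of "sphere 0 1" "\<lambda>z. cnj (h z)" "e / B"] h(1) e B(2)
      by (auto intro!: continuous_intros)
    have gg: "annihilator_mult lam (\<lambda>x. of_real (Re (g (echar lam 1 x))) + \<i> * of_real (Im (g (echar lam 1 x))))"
    proof -
      have r: "real_polynomial_function (\<lambda>z. Re (g z))" "real_polynomial_function (\<lambda>z. Im (g z))"
        using g(1) bounded_linear_Re bounded_linear_Im by (auto simp: polynomial_function_def o_def)
      have i: "annihilator_mult lam (\<lambda>x. \<i>)" using annihilator_mult_echar[of lam \<i> 0] by simp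
      show ?thesis
        by (rule annihilator_mult_add[OF annihilator_mult_polynomial[OF r(1)]
              annihilator_mult_mult[OF i annihilator_mult_polynomial[OF r(2)]]])
    qed
    have gg2: "(\<lambda>x. of_real (Re (g (echar lam 1 x))) + \<i> * of_real (Im (g (echar lam 1 x)))) = (\<lambda>x. g (echar lam 1 x))"
      by (rule ext) (simp add: complex_eq_iff)
    have ann: "annihilator_mult lam (\<lambda>x. g (echar lam 1 x))" using gg unfolding gg2 .
    define D where "D x = cnj (H x) - g (echar lam 1 x)" for x
    have contg: "continuous_on S (\<lambda>x. g (echar lam 1 x))" for S
      using ann continuous_on_subset unfolding annihilator_mult_def by blast
    have contD: "continuous_on S D" for S
      unfolding D_def by (intro continuous_intros contH contg)
    have "fco lam (\<lambda>x. H x * cnj (H x)) 0 = fco lam (\<lambda>x. H x * g (echar lam 1 x) + H x * D x) 0"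
      unfolding D_def by (simp only: ring_distribs) simp
    also have "\<dots> = fco lam (\<lambda>x. H x * g (echar lam 1 x)) 0 + fco lam (\<lambda>x. H x * D x) 0"
      by (intro fco_add continuous_on_mult contH contD contg)
    also have "\<dots> = fco lam (\<lambda>x. H x * D x) 0"
      using ann cont zero by (simp add: annihilator_mult_def)
    finally have eq: "fco lam (\<lambda>x. H x * cnj (H x)) 0 = fco lam (\<lambda>x. H x * D x) 0" .
    have "norm (fco lam (\<lambda>x. H x * D x) 0) \<le> e"
    proof (rule norm_fco_le[OF lam])
      show "continuous_on {0..?L} (\<lambda>x. H x * D x)" by (intro continuous_on_mult contH contD)
      fix x assume "x \<in> {0..?L}"
      then have "norm (H x * D x) \<le> B * (e / B)"
        unfolding norm_mult using B(1) g(2)[of "echar lam 1 x"] h(2)[of x] B(2) e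
        by (intro mult_mono) (auto simp: D_def less_imp_le)
      then show "norm (H x * D x) \<le> e" using B(2) by simp
    qed
    with eq show ?thesis by simp
  qed
  then have "fco lam (\<lambda>x. H x * cnj (H x)) 0 = 0"
    by (metis dense_ge norm_le_zero_iff)
  then have I: "integral {0..?L} (\<lambda>x. H x * cnj (H x)) = 0"
    using lam by (simp add: fco_def)
  have contN: "continuous_on {a..b} (\<lambda>x. (norm (H x))\<^sup>2)" for a b
    by (intro continuous_intros contH)
  from I have "integral {0..?L} (\<lambda>x. complex_of_real ((norm (H x))\<^sup>2)) = 0"
    by (simp add: complex_norm_square del: of_real_power)
  then have "complex_of_real (integral {0..?L} (\<lambda>x. (norm (H x))\<^sup>2)) = 0"
    using integral_linear[OF integrable_continuous_real[OF contN[of 0 ?L]] bounded_linear_of_real[where 'a=complex]]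
    by (simp add: o_def)
  then have I0: "integral {0..?L} (\<lambda>x. (norm (H x))\<^sup>2) = 0" by simp
  have z: "H x = 0" if "x \<in> {0..?L}" for x
  proof -
    have "(norm (H x))\<^sup>2 = 0"
      using integral_eq_0_iff[OF contN[of 0 ?L]] I0 that lam by auto
    then show ?thesis by simp
  qed
  have "0 < ?L" using lam by simp
  then obtain y where "y \<in> {0..?L}" "H y = H x"
    using periodic_representative[of H ?L x, OF per] by blast
  with z show ?thesis by metis
qed

subsection \<open>Absolutely convergent Fourier series\<close>

text \<open>Absolute summability is built in: it makes the convergence uniform and turns products of
  functions into convolutions of coefficients.\<close>

definition fourier_rep :: "real \<Rightarrow> (int \<Rightarrow> complex) \<Rightarrow> (real \<Rightarrow> complex) \<Rightarrow> bool" where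
  "fourier_rep lam f F \<longleftrightarrow> (\<lambda>q. norm (f q)) summable_on UNIV \<and>
     (\<forall>x. ((\<lambda>q. f q * echar lam q x) has_sum F x) UNIV)"

lemma fourier_rep_summable: "fourier_rep lam f F \<Longrightarrow> (\<lambda>q. norm (f q)) summable_on UNIV"
  by (simp add: fourier_rep_def)

lemma fourier_rep_has_sum: "fourier_rep lam f F \<Longrightarrow> ((\<lambda>q. f q * echar lam q x) has_sum F x) UNIV"
  by (simp add: fourier_rep_def)

lemma fourier_rep_exists:
  assumes "(\<lambda>q. norm (f q)) summable_on UNIV"
  shows "fourier_rep lam f (\<lambda>x. \<Sum>\<^sub>\<infinity>q. f q * echar lam q x)"
  unfolding fourier_rep_def
proof (intro conjI allI assms has_sum_infsum)
  show "(\<lambda>q. f q * echar lam q x) summable_on UNIV" for x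
    by (rule abs_summable_summable) (simp add: norm_mult assms)
qed

lemma fourier_rep_uniform_limit:
  assumes "fourier_rep lam f F"
  shows "uniform_limit S (\<lambda>X x. \<Sum>q\<in>X. f q * echar lam q x) F (finite_subsets_at_top UNIV)"
  by (rule Weierstrass_m_test_general'[where M="\<lambda>q. norm (f q)"])
     (use assms in \<open>auto simp: fourier_rep_def norm_mult\<close>)

lemma fourier_rep_continuous:
  assumes "fourier_rep lam f F"
  shows "continuous_on S F"
  by (rule uniform_limit_theorem[OF _ fourier_rep_uniform_limit[OF assms]])
     (auto intro!: always_eventually continuous_intros)

text \<open>Uniform convergence allows integration term by term, and orthogonality leaves the single
  term \<open>r\<close>. In particular the coefficients in \<open>fourier_rep\<close> are
  unique.\<close>

lemma fourier_rep_fco: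
  assumes lam: "lam > 0" and rep: "fourier_rep lam f F"
  shows "fco lam F r = f r"
proof -
  let ?L = "2 * pi / lam"
  have "uniform_limit {0..?L} (\<lambda>X x. (\<Sum>q\<in>X. f q * echar lam q x) * echar lam (- r) x)
      (\<lambda>x. F x * echar lam (- r) x) (finite_subsets_at_top UNIV)"
    by (rule uniform_lim_mult[OF fourier_rep_uniform_limit[OF rep] uniform_limit_const])
       (auto intro!: compact_imp_bounded compact_continuous_image fourier_rep_continuous[OF rep] continuous_intros)
  then obtain I J where I: "\<And>X. ((\<lambda>x. (\<Sum>q\<in>X. f q * echar lam q x) * echar lam (- r) x) has_integral I X) {0..?L}"
    and J: "((\<lambda>x. F x * echar lam (- r) x) has_integral J) {0..?L}"
    and lim: "(I \<longlongrightarrow> J) (finite_subsets_at_top UNIV)"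
    by (rule uniform_limit_integral) (auto intro!: continuous_intros)
  have IX: "I X = (\<Sum>q\<in>X. if q = r then of_real ?L * f q else 0)" if "finite X" for X
  proof -
    have "((\<lambda>x. f q * echar lam (q - r) x) has_integral f q * (if q = r then of_real ?L else 0)) {0..?L}" for q
      using integral_echar[OF lam, of "q - r"] integrable_continuous_real[OF continuous_on_echar[of "{0..?L}" lam "q - r"]]
      by (intro has_integral_mult_right) (auto simp: has_integral_iff)
    then have "((\<lambda>x. \<Sum>q\<in>X. f q * echar lam (q - r) x) has_integral (\<Sum>q\<in>X. f q * (if q = r then of_real ?L else 0))) {0..?L}"
      using that by (intro has_integral_sum) auto
    moreover have "(\<lambda>x. \<Sum>q\<in>X. f q * echar lam (q - r) x) = (\<lambda>x. (\<Sum>q\<in>X. f q * echar lam q x) * echar lam (- r) x)"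
      by (rule ext) (use echar_add[of lam _ "-r"] in \<open>simp add: sum_distrib_right mult.assoc\<close>)
    ultimately have "((\<lambda>x. (\<Sum>q\<in>X. f q * echar lam q x) * echar lam (- r) x) has_integral (\<Sum>q\<in>X. f q * (if q = r then of_real ?L else 0))) {0..?L}"
      by (simp only:)
    from has_integral_unique[OF I[of X] this]
    have "I X = (\<Sum>q\<in>X. f q * (if q = r then of_real ?L else 0))" .
    also have "\<dots> = (\<Sum>q\<in>X. if q = r then of_real ?L * f q else 0)"
      by (rule sum.cong) auto
    finally show ?thesis .
  qed
  have "\<forall>\<^sub>F X in finite_subsets_at_top UNIV. finite X \<and> r \<in> X"
    unfolding eventually_finite_subsets_at_top by (intro exI[of _ "{r}"]) auto
  then have "\<forall>\<^sub>F X in finite_subsets_at_top UNIV. I X = of_real ?L * f r"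
    by eventually_elim (simp add: IX)
  then have "(I \<longlongrightarrow> of_real ?L * f r) (finite_subsets_at_top UNIV)"
    by (rule tendsto_eventually)
  then have "J = of_real ?L * f r"
    using lim tendsto_unique by (metis finite_subsets_at_top_neq_bot)
  then have "integral {0..?L} (\<lambda>x. F x * echar lam (- r) x) = of_real ?L * f r"
    using J by (simp add: integral_unique)
  then show ?thesis using lam by (simp add: fco_def scaleR_conv_of_real)
qed

lemma echar_periodic:
  assumes "lam > 0"
  shows "echar lam q (x + 2 * pi / lam) = echar lam q x"
proof -
  have "echar lam q (x + 2 * pi / lam) = echar lam q x * echar lam q (2 * pi / lam)"
    by (simp add: echar_def cis_mult algebra_simps add_divide_distrib)
  then show ?thesis using echar_period[OF assms] by simp
qed

text \<open>The series converges to some \<open>G\<close> with the coefficients of \<open>F\<close>;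
  the difference of \<open>F\<close> and \<open>G\<close> has only vanishing coefficients and is
  zero by completeness.\<close>

lemma fourier_rep_fco_self:
  assumes lam: "lam > 0" and cont: "continuous_on UNIV F" and per: "\<And>x. F (x + 2 * pi / lam) = F x"
    and sum: "(\<lambda>q. norm (fco lam F q)) summable_on UNIV"
  shows "fourier_rep lam (fco lam F) F"
proof -
  define G where "G x = (\<Sum>\<^sub>\<infinity>q. fco lam F q * echar lam q x)" for x
  have G: "fourier_rep lam (fco lam F) G"
    using fourier_rep_exists[OF sum] by (simp add: G_def[abs_def])
  have contG: "continuous_on S G" and contF: "continuous_on S F" for S
    using fourier_rep_continuous[OF G] cont continuous_on_subset by blast+
  have "F x + (-1) * G x = 0" for x
  proof (rule fco_complete[OF lam])
    show "continuous_on UNIV (\<lambda>x. F x + (-1) * G x)" by (intro continuous_intros contG contF)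
    show "F (x + 2 * pi / lam) + (-1) * G (x + 2 * pi / lam) = F x + (-1) * G x" for x
      by (simp only: G_def echar_periodic[OF lam] per)
    show "fco lam (\<lambda>x. F x + (-1) * G x) q = 0" for q
    proof -
      have "fco lam (\<lambda>x. F x + (-1) * G x) q = fco lam F q + fco lam (\<lambda>x. (-1) * G x) q"
        by (intro fco_add continuous_on_mult continuous_on_const contG contF)
      then show ?thesis unfolding fco_cmult fourier_rep_fco[OF lam G] by simp
    qed
  qed
  then have "F = G" by (auto simp: fun_eq_iff)
  with G show ?thesis by simp
qed

section \<open>Summability over the integers\<close>

lemma summable_on_int_even:
  fixes h :: "nat \<Rightarrow> real"
  assumes "h summable_on UNIV"
  shows "(\<lambda>q::int. h (nat \<bar>q\<bar>)) summable_on UNIV"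
proof -
  have "(\<lambda>q::int. h (nat \<bar>q\<bar>)) summable_on range int"
    by (subst summable_on_reindex) (use assms in \<open>auto simp: o_def inj_on_def\<close>)
  moreover have "(\<lambda>q::int. h (nat \<bar>q\<bar>)) summable_on range (\<lambda>n. - int n)"
    by (subst summable_on_reindex) (use assms in \<open>auto simp: o_def inj_on_def\<close>)
  ultimately have "(\<lambda>q::int. h (nat \<bar>q\<bar>)) summable_on (range int \<union> range (\<lambda>n. - int n))"
    by (rule summable_on_union)
  moreover have "x \<in> range int \<union> range (\<lambda>n. - int n)" for x
    by (cases x rule: int_cases2) auto
  then have "range int \<union> range (\<lambda>n. - int n) = UNIV" by blast
  ultimately show ?thesis by simp
qed

lemma summable_inverse_square_int: "(\<lambda>q::int. 1 / (real_of_int q)\<^sup>2) summable_on UNIV"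
proof -
  have "(\<lambda>n::nat. 1 / (real n)\<^sup>2) summable_on UNIV"
    using inverse_power_summable[of 2, where 'a=real]
    by (intro summable_nonneg_imp_summable_on) (auto simp: field_simps)
  from summable_on_int_even[OF this] show ?thesis by simp
qed

text \<open>The term at 0 is \<open>1 / 0 = 0\<close>, so this is twice the value of the Riemann
  zeta function at 2.\<close>

definition zeta2 :: real where "zeta2 = (\<Sum>\<^sub>\<infinity>q::int. 1 / (real_of_int q)\<^sup>2)"

lemma zeta2_has_sum: "((\<lambda>q::int. 1 / (real_of_int q)\<^sup>2) has_sum zeta2) UNIV"
  unfolding zeta2_def by (rule has_sum_infsum[OF summable_inverse_square_int])

lemma zeta2_pos: "zeta2 > 0"
proof -
  have "(\<Sum>q\<in>{1::int}. 1 / (real_of_int q)\<^sup>2) \<le> zeta2"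
    by (rule finite_sum_le_has_sum[OF zeta2_has_sum]) auto
  then show ?thesis by simp
qed

text \<open>Two integrations by parts give coefficients of order \<open>1 / q\<^sup>2\<close>, which
  are summable.\<close>

lemma fourier_rep_C2:
  assumes lam: "lam > 0"
    and d1: "\<And>x. (F has_vector_derivative F1 x) (at x)"
    and d2: "\<And>x. (F1 has_vector_derivative F2 x) (at x)"
    and cont: "continuous_on UNIV F2"
    and per: "\<And>x. F (x + 2 * pi / lam) = F x" "\<And>x. F1 (x + 2 * pi / lam) = F1 x"
  shows "fourier_rep lam (fco lam F) F"
proof (rule fourier_rep_fco_self[where F=F and lam=lam])
  show "lam > 0" "\<And>x. F (x + 2 * pi / lam) = F x" by (fact lam per)+
  show contF: "continuous_on UNIV F"
    using d1 by (meson continuous_at_imp_continuous_on has_vector_derivative_continuous)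
  have contF1: "continuous_on UNIV F1"
    using d2 by (meson continuous_at_imp_continuous_on has_vector_derivative_continuous)
  obtain B where B: "\<And>x. x \<in> {0..2 * pi / lam} \<Longrightarrow> norm (F2 x) \<le> B"
    using compact_imp_bounded[OF compact_continuous_image[OF continuous_on_subset[OF cont] compact_Icc]]
    unfolding bounded_iff by (metis imageI subset_UNIV)
  have e: "fco lam F2 q = (\<i> * of_real (lam * of_int q))\<^sup>2 * fco lam F q" for q
    using fco_deriv[OF lam d1 contF1, of q] fco_deriv[OF lam d2 cont, of q] per(1)[of 0] per(2)[of 0]
    by (simp add: power2_eq_square)
  have "norm (fco lam F q) \<le> (B / lam\<^sup>2) * (1 / (real_of_int q)\<^sup>2)" if "q \<noteq> 0" for q
  proof -
    have "norm (fco lam F2 q) \<le> B"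
      by (rule norm_fco_le[OF lam continuous_on_subset[OF cont]]) (use B in auto)
    then have "(lam * of_int q)\<^sup>2 * norm (fco lam F q) \<le> B"
      unfolding e by (simp add: norm_mult norm_power power_mult_distrib)
    then show ?thesis using lam that by (simp add: field_simps)
  qed
  then have 1: "(\<lambda>q. norm (fco lam F q)) summable_on (UNIV - {0})"
    by (intro summable_on_comparison_test[OF summable_on_cmult_right[OF
          summable_on_subset_banach[OF summable_inverse_square_int], where c="B / lam\<^sup>2"]]) auto
  show "(\<lambda>q. norm (fco lam F q)) summable_on UNIV"
    using summable_on_union[OF 1 summable_on_finite[of "{0}"]] by (simp add: insert_absorb)
qed

lemma fourier_rep_add:
  assumes "fourier_rep lam f F" "fourier_rep lam g G"
  shows "fourier_rep lam (\<lambda>q. f q + g q) (\<lambda>x. F x + G x)"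
  unfolding fourier_rep_def
proof (intro conjI allI)
  show "(\<lambda>q. norm (f q + g q)) summable_on UNIV"
    by (rule summable_on_comparison_test[OF summable_on_add[OF assms[THEN fourier_rep_summable]]])
       (auto intro: norm_triangle_ineq)
  show "((\<lambda>q. (f q + g q) * echar lam q x) has_sum F x + G x) UNIV" for x
    using has_sum_add[OF assms[THEN fourier_rep_has_sum, of x]] by (simp add: algebra_simps)
qed

lemma fourier_rep_cmult:
  assumes "fourier_rep lam f F"
  shows "fourier_rep lam (\<lambda>q. c * f q) (\<lambda>x. c * F x)"
  using assms unfolding fourier_rep_def
  by (auto simp: norm_mult mult.assoc intro!: summable_on_cmult_right has_sum_cmult_right)

lemma fourier_rep_const: "fourier_rep lam (\<lambda>q. if q = 0 then c else 0) (\<lambda>x. c)"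
  unfolding fourier_rep_def
proof (intro conjI allI)
  show "(\<lambda>q::int. norm (if q = 0 then c else 0)) summable_on UNIV"
    by (rule finite_nonzero_values_imp_summable_on) (rule finite_subset[of _ "{0}"], auto)
  show "((\<lambda>q. (if q = 0 then c else 0) * echar lam q x) has_sum c) UNIV" for x
    by (rule has_sum_finite_neutralI[of "{0}"]) auto
qed

section \<open>Products of series as convolutions\<close>

definition convol :: "(int \<Rightarrow> 'a) \<Rightarrow> (int \<Rightarrow> 'a) \<Rightarrow> int \<Rightarrow> 'a::{topological_space, semiring_0, t2_space}" where
  "convol f g n = (\<Sum>\<^sub>\<infinity>r. f r * g (n - r))"

text \<open>The double series is summed in two ways: by rows it gives \<open>A * B\<close>, and
  after the reindexing of \<open>(n, r)\<close> to \<open>(r, n - r)\<close> it gives the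
  convolution. Non-negative terms make it summable over all pairs.\<close>

lemma convol_nonneg_has_sum:
  fixes f g :: "int \<Rightarrow> real"
  assumes "(f has_sum A) UNIV" "(g has_sum B) UNIV" "\<And>q. f q \<ge> 0" "\<And>q. g q \<ge> 0"
  shows "\<And>n. (\<lambda>r. f r * g (n - r)) summable_on UNIV" "(convol f g has_sum A * B) UNIV"
    "(\<lambda>(r, s). f r * g s) summable_on UNIV \<times> UNIV"
proof -
  have s: "f summable_on UNIV" "g summable_on UNIV"
    using has_sum_imp_summable[OF assms(1)] has_sum_imp_summable[OF assms(2)] by auto
  show sp: "(\<lambda>(r,s). f r * g s) summable_on UNIV \<times> UNIV"
  proof (rule summable_on_SigmaI)
    show "((\<lambda>y. case (r, y) of (r, s) \<Rightarrow> f r * g s) has_sum f r * B) UNIV" for r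
      using assms by (auto intro: has_sum_cmult_right)
    show "(\<lambda>r. f r * B) summable_on UNIV" using s by (auto intro: summable_on_cmult_left)
  qed (use assms in auto)
  have "((\<lambda>(r,s). f r * g s) has_sum A * B) (UNIV \<times> UNIV)"
  proof (rule has_sum_SigmaI)
    show "((\<lambda>y. case (r, y) of (r, s) \<Rightarrow> f r * g s) has_sum f r * B) UNIV" for r
      using assms by (auto intro: has_sum_cmult_right)
    show "((\<lambda>r. f r * B) has_sum A * B) UNIV" using assms by (auto intro: has_sum_cmult_left)
  qed (rule sp)
  moreover have "bij (\<lambda>(n, r). (r, n - r :: int))"
    by (rule bij_betw_byWitness[where f'="\<lambda>(r,s). (r + s, r)"]) auto
  ultimately have h: "((\<lambda>(n,r). f r * g (n - r)) has_sum A * B) (UNIV \<times> UNIV)"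
    using has_sum_reindex_bij_betw[of "\<lambda>(n, r). (r, n - r :: int)" UNIV UNIV "\<lambda>(r,s). f r * g s" "A * B"]
    by (simp add: case_prod_unfold)
  show s2: "(\<lambda>r. f r * g (n - r)) summable_on UNIV" for n
    using summable_on_SigmaD1[OF has_sum_imp_summable[OF h]] by auto
  have "((\<lambda>n. \<Sum>\<^sub>\<infinity>r. f r * g (n - r)) has_sum A * B) UNIV"
    by (rule has_sum_SigmaD[OF h]) (use s2 in auto)
  then show "(convol f g has_sum A * B) UNIV" by (simp add: convol_def[abs_def])
qed

text \<open>The Cauchy product at a fixed \<open>x\<close>: the characters are absorbed into
  \<open>ff\<close> and \<open>gg\<close>, and along \<open>r + s = n\<close> they multiply to
  \<open>echar lam n x\<close>.\<close>

lemma fourier_rep_mult: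
  assumes "fourier_rep lam f F" "fourier_rep lam g G"
  shows "fourier_rep lam (convol f g) (\<lambda>x. F x * G x)"
    and "\<And>n. norm (convol f g n) \<le> convol (\<lambda>q. norm (f q)) (\<lambda>q. norm (g q)) n"
proof -
  note sf = fourier_rep_summable[OF assms(1)] note sg = fourier_rep_summable[OF assms(2)]
  note c = convol_nonneg_has_sum[OF has_sum_infsum[OF sf] has_sum_infsum[OF sg]]
  have sm: "(\<lambda>r. norm (f r * g (n - r))) summable_on UNIV" for n
    using c(1) by (simp add: norm_mult)
  show bd: "norm (convol f g n) \<le> convol (\<lambda>q. norm (f q)) (\<lambda>q. norm (g q)) n" for n
    unfolding convol_def using norm_infsum_bound[OF sm[of n]] by (simp add: norm_mult)
  have "((\<lambda>n. (convol f g n) * echar lam n x) has_sum F x * G x) UNIV" for x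
  proof -
    define ff where "ff q = f q * echar lam q x" for q
    define gg where "gg q = g q * echar lam q x" for q
    have ff: "(ff has_sum F x) UNIV" "(\<lambda>q. norm (ff q)) summable_on UNIV"
      using fourier_rep_has_sum[OF assms(1)] sf by (simp_all add: ff_def[abs_def] norm_mult)
    have gg: "(gg has_sum G x) UNIV" "(\<lambda>q. norm (gg q)) summable_on UNIV"
      using fourier_rep_has_sum[OF assms(2)] sg by (simp_all add: gg_def[abs_def] norm_mult)
    have "(\<lambda>(r,s). ff r * gg s) summable_on UNIV \<times> UNIV"
      by (rule abs_summable_summable)
         (use convol_nonneg_has_sum(3)[OF has_sum_infsum[OF ff(2)] has_sum_infsum[OF gg(2)]] in
           \<open>simp add: case_prod_unfold norm_mult\<close>)
    then have "((\<lambda>(r,s). ff r * gg s) has_sum F x * G x) (UNIV \<times> UNIV)"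
      by (intro has_sum_SigmaI[where g="\<lambda>r. ff r * G x"])
         (use ff gg in \<open>auto intro: has_sum_cmult_left has_sum_cmult_right\<close>)
    moreover have "bij (\<lambda>(n, r). (r, n - r :: int))"
      by (rule bij_betw_byWitness[where f'="\<lambda>(r,s). (r + s, r)"]) auto
    ultimately have h: "((\<lambda>(n,r). ff r * gg (n - r)) has_sum F x * G x) (UNIV \<times> UNIV)"
      using has_sum_reindex_bij_betw[of "\<lambda>(n, r). (r, n - r :: int)" UNIV UNIV "\<lambda>(r,s). ff r * gg s" "F x * G x"]
      by (simp add: case_prod_unfold)
    have eq: "ff r * gg (n - r) = f r * g (n - r) * echar lam n x" for n r
      using echar_add[of lam r "n - r" x] by (simp add: ff_def gg_def)
    have "((\<lambda>r. ff r * gg (n - r)) has_sum convol f g n * echar lam n x) UNIV" for n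
      unfolding eq convol_def by (rule has_sum_cmult_left[OF has_sum_infsum[OF abs_summable_summable[OF sm]]])
    then show ?thesis
      by (intro has_sum_SigmaD[OF h]) auto
  qed
  moreover have "(\<lambda>n. norm (convol f g n)) summable_on UNIV"
    by (rule summable_on_comparison_test[OF has_sum_imp_summable[OF c(2)]]) (use bd in auto)
  ultimately show "fourier_rep lam (convol f g) (\<lambda>x. F x * G x)" by (simp add: fourier_rep_def)
qed

subsection \<open>Weighted norms\<close>

text \<open>With a submultiplicative weight, the functions with weighted summable coefficients form
  a Banach algebra (a Beurling algebra). All nonlinear estimates take place there.\<close>

locale fourier_weight =
  fixes lam :: real and Om :: "int \<Rightarrow> real"
  assumes lam_pos: "lam > 0"
    and Om_ge_1: "\<And>q. 1 \<le> Om q"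
    and Om_0: "Om 0 = 1"
    and Om_submult: "\<And>q r. Om (q + r) \<le> Om q * Om r"
begin

text \<open>The norms are encoded as predicates with a bound, so finiteness never has to be
  discussed apart from the estimate. \<open>l1_le\<close> is the algebra norm, \<open>sup_le\<close>
  a weaker norm for functions with coefficients that are bounded after weighting.\<close>

definition l1_le :: "real \<Rightarrow> (real \<Rightarrow> complex) \<Rightarrow> bool" where
  "l1_le C F \<longleftrightarrow> (\<exists>f S. fourier_rep lam f F \<and> ((\<lambda>q. Om q * norm (f q)) has_sum S) UNIV \<and> S \<le> C)"

definition sup_le :: "real \<Rightarrow> (real \<Rightarrow> complex) \<Rightarrow> bool" where
  "sup_le C F \<longleftrightarrow> (\<exists>f. fourier_rep lam f F \<and> (\<forall>q. Om q * norm (f q) \<le> C))"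

text \<open>At \<open>q = 0\<close> the bound is \<open>C / 0 = 0\<close>, so functions in the next class have mean zero.\<close>

definition sup1_le :: "real \<Rightarrow> (real \<Rightarrow> complex) \<Rightarrow> bool" where
  "sup1_le C F \<longleftrightarrow> (\<exists>f. fourier_rep lam f F \<and> (\<forall>q. Om q * norm (f q) \<le> C / \<bar>of_int q\<bar>))"

lemma Om_pos: "0 < Om q"
  using Om_ge_1[of q] by simp

lemma Om_split: "Om n \<le> Om r * Om (n - r)"
  using Om_submult[of r "n - r"] by simp

lemma sup_le_fco: "sup_le C F \<Longrightarrow> Om q * norm (fco lam F q) \<le> C"
  unfolding sup_le_def using fourier_rep_fco[OF lam_pos] by metis

lemma l1_imp_sup:
  assumes "l1_le C F"
  shows "sup_le C F"
proof -
  obtain f S where f: "fourier_rep lam f F" "((\<lambda>q. Om q * norm (f q)) has_sum S) UNIV" "S \<le> C"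
    using assms unfolding l1_le_def by blast
  have "Om q * norm (f q) \<le> C" for q
    using finite_sum_le_has_sum[OF f(2), of "{q}"] f(3) Om_pos by (auto simp: less_imp_le)
  with f(1) show ?thesis unfolding sup_le_def by blast
qed

lemma l1_le_nonneg: "l1_le C F \<Longrightarrow> 0 \<le> C"
  unfolding l1_le_def
  by (meson Om_pos has_sum_nonneg less_imp_le mult_nonneg_nonneg norm_ge_zero order_trans)

lemma sup_le_nonneg: "sup_le C F \<Longrightarrow> 0 \<le> C"
  unfolding sup_le_def by (meson Om_pos less_imp_le mult_nonneg_nonneg norm_ge_zero order_trans)

lemma l1_le_const: "l1_le (norm c) (\<lambda>x. c)"
  unfolding l1_le_def
proof (intro exI conjI)
  show "fourier_rep lam (\<lambda>q. if q = 0 then c else 0) (\<lambda>x. c)" by (rule fourier_rep_const)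
  show "((\<lambda>q. Om q * norm (if q = 0 then c else 0)) has_sum norm c) UNIV"
    by (rule has_sum_finite_neutralI[of "{0}"]) (auto simp: Om_0)
qed simp

lemma l1_le_add:
  assumes "l1_le A F" "l1_le B G"
  shows "l1_le (A + B) (\<lambda>x. F x + G x)"
proof -
  obtain f S where f: "fourier_rep lam f F" "((\<lambda>q. Om q * norm (f q)) has_sum S) UNIV" "S \<le> A"
    using assms unfolding l1_le_def by blast
  obtain g T where g: "fourier_rep lam g G" "((\<lambda>q. Om q * norm (g q)) has_sum T) UNIV" "T \<le> B"
    using assms unfolding l1_le_def by blast
  have le: "Om q * norm (f q + g q) \<le> Om q * norm (f q) + Om q * norm (g q)" for q
    using Om_pos[of q] norm_triangle_ineq[of "f q" "g q"]
    by (simp add: distrib_left[symmetric])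
  have h: "((\<lambda>q. Om q * norm (f q) + Om q * norm (g q)) has_sum S + T) UNIV"
    by (rule has_sum_add[OF f(2) g(2)])
  have s: "(\<lambda>q. Om q * norm (f q + g q)) summable_on UNIV"
    by (rule summable_on_comparison_test[OF has_sum_imp_summable[OF h]]) (use le Om_pos in \<open>auto simp: less_imp_le\<close>)
  have "infsum (\<lambda>q. Om q * norm (f q + g q)) UNIV \<le> S + T"
    by (rule has_sum_mono[OF has_sum_infsum[OF s] h]) (use le in auto)
  with fourier_rep_add[OF f(1) g(1)] has_sum_infsum[OF s] f(3) g(3) show ?thesis
    unfolding l1_le_def by (meson add_mono order_trans)
qed

lemma sup_le_add:
  assumes "sup_le A F" "sup_le B G"
  shows "sup_le (A + B) (\<lambda>x. F x + G x)"
proof -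
  obtain f where f: "fourier_rep lam f F" "\<And>q. Om q * norm (f q) \<le> A"
    using assms unfolding sup_le_def by blast
  obtain g where g: "fourier_rep lam g G" "\<And>q. Om q * norm (g q) \<le> B"
    using assms unfolding sup_le_def by blast
  have "Om q * norm (f q + g q) \<le> A + B" for q
  proof -
    have "Om q * norm (f q + g q) \<le> Om q * norm (f q) + Om q * norm (g q)"
      using Om_pos[of q] norm_triangle_ineq[of "f q" "g q"] by (simp add: distrib_left[symmetric])
    then show ?thesis using f(2)[of q] g(2)[of q] by linarith
  qed
  with fourier_rep_add[OF f(1) g(1)] show ?thesis unfolding sup_le_def by blast
qed

text \<open>Submultiplicativity splits the weight at \<open>n\<close> over the two indices
  \<open>r\<close> and \<open>n - r\<close>, so the weighted coefficients of a product are dominated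
  by the convolution of the weighted coefficients.\<close>

lemma convol_weight:
  assumes "fourier_rep lam f F" "fourier_rep lam g G"
    and sm: "(\<lambda>r. (Om r * norm (f r)) * (Om (n - r) * norm (g (n - r)))) summable_on UNIV"
  shows "Om n * norm (convol f g n) \<le> convol (\<lambda>q. Om q * norm (f q)) (\<lambda>q. Om q * norm (g q)) n"
proof -
  have le: "Om n * (norm (f r) * norm (g (n - r))) \<le> (Om r * norm (f r)) * (Om (n - r) * norm (g (n - r)))" for r
    using mult_right_mono[OF Om_split[of n r], of "norm (f r) * norm (g (n - r))"] by (simp add: algebra_simps)
  have s: "(\<lambda>r. norm (f r) * norm (g (n - r))) summable_on UNIV"
    using convol_nonneg_has_sum(1)[OF has_sum_infsum[OF fourier_rep_summable[OF assms(1)]] has_sum_infsum[OF fourier_rep_summable[OF assms(2)]]]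
    by simp
  have "Om n * norm (convol f g n) \<le> Om n * convol (\<lambda>q. norm (f q)) (\<lambda>q. norm (g q)) n"
    using fourier_rep_mult(2)[OF assms(1,2)] Om_pos by (simp add: mult_left_mono less_imp_le)
  also have "\<dots> = (\<Sum>\<^sub>\<infinity>r. Om n * (norm (f r) * norm (g (n - r))))"
    unfolding convol_def by (rule infsum_cmult_right'[symmetric])
  also have "\<dots> \<le> (\<Sum>\<^sub>\<infinity>r. (Om r * norm (f r)) * (Om (n - r) * norm (g (n - r))))"
    by (rule infsum_mono[OF summable_on_cmult_right[OF s] sm]) (use le in auto)
  finally show ?thesis by (simp add: convol_def)
qed

lemma l1_le_mult:
  assumes "l1_le A F" "l1_le B G"
  shows "l1_le (A * B) (\<lambda>x. F x * G x)"
proof -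
  obtain f S where f: "fourier_rep lam f F" "((\<lambda>q. Om q * norm (f q)) has_sum S) UNIV" "S \<le> A"
    using assms unfolding l1_le_def by blast
  obtain g T where g: "fourier_rep lam g G" "((\<lambda>q. Om q * norm (g q)) has_sum T) UNIV" "T \<le> B"
    using assms unfolding l1_le_def by blast
  have c: "\<And>n. (\<lambda>r. (Om r * norm (f r)) * (Om (n - r) * norm (g (n - r)))) summable_on UNIV"
    "(convol (\<lambda>q. Om q * norm (f q)) (\<lambda>q. Om q * norm (g q)) has_sum S * T) UNIV"
    using convol_nonneg_has_sum[OF f(2) g(2)] Om_pos by (auto simp: less_imp_le)
  have le: "Om n * norm (convol f g n) \<le> convol (\<lambda>q. Om q * norm (f q)) (\<lambda>q. Om q * norm (g q)) n" for n
    by (rule convol_weight[OF f(1) g(1) c(1)])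
  have s: "(\<lambda>n. Om n * norm (convol f g n)) summable_on UNIV"
    by (rule summable_on_comparison_test[OF has_sum_imp_summable[OF c(2)]]) (use le Om_pos in \<open>auto simp: less_imp_le\<close>)
  have "infsum (\<lambda>n. Om n * norm (convol f g n)) UNIV \<le> S * T"
    by (rule has_sum_mono[OF has_sum_infsum[OF s] c(2)]) (use le in auto)
  also have "S * T \<le> A * B"
    using f(3) g(3) has_sum_nonneg[OF g(2)] l1_le_nonneg[OF assms(1)] Om_pos
    by (intro mult_mono) (auto simp: less_imp_le)
  finally show ?thesis
    using fourier_rep_mult(1)[OF f(1) g(1)] has_sum_infsum[OF s] unfolding l1_le_def by blast
qed

text \<open>The functions bounded in the weaker norm form a module over the algebra: one summable
  factor suffices in a convolution.\<close>

lemma l1_sup_mult: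
  assumes "l1_le A F" "sup_le B G"
  shows "sup_le (A * B) (\<lambda>x. F x * G x)"
proof -
  obtain f S where f: "fourier_rep lam f F" "((\<lambda>q. Om q * norm (f q)) has_sum S) UNIV" "S \<le> A"
    using assms unfolding l1_le_def by blast
  obtain g where g: "fourier_rep lam g G" "\<And>q. Om q * norm (g q) \<le> B"
    using assms unfolding sup_le_def by blast
  have h: "((\<lambda>r. (Om r * norm (f r)) * B) has_sum S * B) UNIV"
    by (rule has_sum_cmult_left[OF f(2)])
  have le: "(Om r * norm (f r)) * (Om (n - r) * norm (g (n - r))) \<le> (Om r * norm (f r)) * B" for n r
    using g(2) Om_pos by (intro mult_left_mono) (auto simp: less_imp_le)
  have s: "(\<lambda>r. (Om r * norm (f r)) * (Om (n - r) * norm (g (n - r)))) summable_on UNIV" for n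
    by (rule summable_on_comparison_test[OF has_sum_imp_summable[OF h]]) (use le Om_pos in \<open>auto simp: less_imp_le\<close>)
  have "Om n * norm (convol f g n) \<le> A * B" for n
  proof -
    have "Om n * norm (convol f g n) \<le> S * B"
      using convol_weight[OF f(1) g(1) s, of n] has_sum_mono[OF has_sum_infsum[OF s[of n]] h le]
      unfolding convol_def by linarith
    also have "\<dots> \<le> A * B" using f(3) sup_le_nonneg[OF assms(2)] by (intro mult_right_mono) auto
    finally show ?thesis .
  qed
  with fourier_rep_mult(1)[OF f(1) g(1)] show ?thesis unfolding sup_le_def by blast
qed

text \<open>Needed for the square of the first derivative, whose coefficients
  \<open>O(1 / |q|)\<close> alone are not summable. The inequality
  \<open>2 * a * b \<le> a\<^sup>2 + b\<^sup>2\<close> bounds the convolution by two inverse square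
  series, one of them shifted. At \<open>r = 0\<close> and \<open>r = n\<close> the bounds are 0 by
  \<open>1 / 0 = 0\<close>.\<close>

lemma sup1_mult:
  assumes "sup1_le A F" "sup1_le B G" "0 \<le> A" "0 \<le> B"
  shows "sup_le (A * B * zeta2) (\<lambda>x. F x * G x)"
proof -
  obtain f where f: "fourier_rep lam f F" "\<And>q. Om q * norm (f q) \<le> A / \<bar>of_int q\<bar>"
    using assms unfolding sup1_le_def by blast
  obtain g where g: "fourier_rep lam g G" "\<And>q. Om q * norm (g q) \<le> B / \<bar>of_int q\<bar>"
    using assms unfolding sup1_le_def by blast
  define h where "h n r = (A * B / 2) * (1 / (real_of_int r)\<^sup>2 + 1 / (real_of_int (n - r))\<^sup>2)" for n r
  have hsum: "(h n has_sum A * B * zeta2) UNIV" for n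
  proof -
    have "((\<lambda>r. 1 / (real_of_int (n - r))\<^sup>2) has_sum zeta2) UNIV"
      using has_sum_reindex_bij_betw[of "\<lambda>r. n - r" UNIV UNIV "\<lambda>q. 1 / (real_of_int q)\<^sup>2" zeta2] zeta2_has_sum
        bij_betw_byWitness[of UNIV "\<lambda>r. n - r" "\<lambda>r. n - r" UNIV] by simp
    from has_sum_cmult_right[OF has_sum_add[OF zeta2_has_sum this], of "A * B / 2"]
    show ?thesis by (simp add: h_def[abs_def] mult.assoc)
  qed
  have le: "(Om r * norm (f r)) * (Om (n - r) * norm (g (n - r))) \<le> h n r" for n r
  proof -
    have "(Om r * norm (f r)) * (Om (n - r) * norm (g (n - r))) \<le> (A / \<bar>of_int r\<bar>) * (B / \<bar>of_int (n - r)\<bar>)"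
      using f(2)[of r] g(2)[of "n - r"] Om_pos assms by (intro mult_mono) (auto simp: less_imp_le)
    also have "\<dots> = A * B * ((1 / \<bar>of_int r\<bar>) * (1 / \<bar>of_int (n - r)\<bar>))" by simp
    also have "\<dots> \<le> A * B * (((1 / \<bar>of_int r\<bar>)\<^sup>2 + (1 / \<bar>of_int (n - r)\<bar>)\<^sup>2) / 2)"
    proof (rule mult_left_mono)
      show "(1 / \<bar>of_int r\<bar>) * (1 / \<bar>of_int (n - r)\<bar>) \<le> ((1 / \<bar>of_int r\<bar>)\<^sup>2 + (1 / \<bar>of_int (n - r)\<bar>)\<^sup>2) / (2::real)"
        using sum_squares_bound[of "1 / \<bar>of_int r\<bar>" "1 / \<bar>of_int (n - r)\<bar> :: real"] by simp
    qed (use assms in auto)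
    also have "\<dots> = h n r" by (simp add: h_def power_divide)
    finally show ?thesis .
  qed
  have s: "(\<lambda>r. (Om r * norm (f r)) * (Om (n - r) * norm (g (n - r)))) summable_on UNIV" for n
    by (rule summable_on_comparison_test[OF has_sum_imp_summable[OF hsum[of n]]]) (use le Om_pos in \<open>auto simp: less_imp_le\<close>)
  have "Om n * norm (convol f g n) \<le> A * B * zeta2" for n
    using convol_weight[OF f(1) g(1) s, of n] has_sum_mono[OF has_sum_infsum[OF s[of n]] hsum le]
    unfolding convol_def by linarith
  with fourier_rep_mult(1)[OF f(1) g(1)] show ?thesis unfolding sup_le_def by blast
qed

end

subsection \<open>The quadratic part of the curvature equation\<close>

context fourier_weight
begin

text \<open>This bound and the next two come from one principle: the polynomials in \<open>w\<close>
  have non-negative coefficients, so in a Banach algebra they are bounded by the same polynomial at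
  \<open>A\<close>. The recursions in \<open>j\<close> multiply the previous remainder by
  \<open>w\<close>.\<close>

lemma l1_le_power:
  assumes "l1_le A w"
  shows "l1_le ((1 + A) ^ j) (\<lambda>x. (1 + w x) ^ j)"
proof (induction j)
  case 0
  show ?case using l1_le_const[of 1] by simp
next
  case (Suc j)
  have "l1_le (1 + A) (\<lambda>x. 1 + w x)"
    using l1_le_add[OF l1_le_const[of 1] assms] by simp
  from l1_le_mult[OF this Suc] show ?case by simp
qed

lemma l1_le_power_minus_1:
  assumes "l1_le A w"
  shows "l1_le ((1 + A) ^ j - 1) (\<lambda>x. (1 + w x) ^ j - 1)"
proof (induction j)
  case 0
  show ?case using l1_le_const[of 0] by simp
next
  case (Suc j)
  from l1_le_add[OF l1_le_mult[OF assms l1_le_power[OF assms, of j]] Suc]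
  show ?case by (simp add: algebra_simps)
qed

lemma l1_le_power_minus_linear:
  assumes "l1_le A w"
  shows "l1_le ((1 + A) ^ j - 1 - of_nat j * A) (\<lambda>x. (1 + w x) ^ j - 1 - of_nat j * w x)"
proof (induction j)
  case 0
  show ?case using l1_le_const[of 0] by simp
next
  case (Suc j)
  from l1_le_add[OF l1_le_mult[OF assms l1_le_power_minus_1[OF assms, of j]] Suc]
  show ?case by (simp add: algebra_simps)
qed

end

text \<open>What is left of the right-hand side for \<open>k = K * (1 + w)\<close>, divided by
  \<open>K ^ (p + 2)\<close>, once the constant \<open>1 / p\<close> and the linear terms
  \<open>w2\<close> and \<open>(p + 2) / p * w\<close> are removed. Each summand vanishes to second
  order in \<open>w\<close> and its derivatives.\<close>

definition nonlin :: "nat \<Rightarrow> (real \<Rightarrow> complex) \<Rightarrow> (real \<Rightarrow> complex) \<Rightarrow> (real \<Rightarrow> complex) \<Rightarrow> real \<Rightarrow> complex" where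
  "nonlin p w w1 w2 x = ((1 + w x) ^ (p + 1) - 1) * w2 x + of_nat (p - 1) * ((1 + w x) ^ p * (w1 x * w1 x))
     + of_real (1 / real p) * ((1 + w x) ^ (p + 2) - 1 - of_nat (p + 2) * w x)"

text \<open>\<open>nonlin\<close> evaluated on bounds: \<open>M * zeta2\<close> for
  \<open>w\<close>, \<open>lam\<^sup>2 * M\<close> for \<open>w2\<close>, and
  \<open>(lam * M)\<^sup>2 * zeta2\<close> for the square of \<open>w1\<close>.\<close>

definition nlbound :: "nat \<Rightarrow> real \<Rightarrow> real \<Rightarrow> real" where
  "nlbound p lam M = ((1 + M * zeta2) ^ (p + 1) - 1) * (lam\<^sup>2 * M)
     + real (p - 1) * ((1 + M * zeta2) ^ p * ((lam * M) * (lam * M) * zeta2))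
     + (1 / real p) * ((1 + M * zeta2) ^ (p + 2) - 1 - real (p + 2) * (M * zeta2))"

text \<open>\<open>w\<close> lies in the algebra, \<open>w2\<close> only in the weak class and
  \<open>w1\<close> in between. Every summand of \<open>nonlin\<close> contains either one factor
  \<open>w2\<close> or the pair \<open>w1 * w1\<close>, otherwise only elements of the algebra, so
  the product rules suffice.\<close>

lemma (in fourier_weight) sup_le_nonlin:
  assumes w: "fourier_rep lam z w"
    and w1: "fourier_rep lam (\<lambda>q. \<i> * of_real (lam * of_int q) * z q) w1"
    and w2: "fourier_rep lam (\<lambda>q. (\<i> * of_real (lam * of_int q))\<^sup>2 * z q) w2"
    and z: "\<And>q. Om q * norm (z q) \<le> M / (of_int q)\<^sup>2" and M: "0 \<le> M"
  shows "sup_le (nlbound p lam M) (nonlin p w w1 w2)"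
proof -
  have W: "l1_le (M * zeta2) w"
  proof -
    have h: "((\<lambda>q. M * (1 / (real_of_int q)\<^sup>2)) has_sum M * zeta2) UNIV"
      by (rule has_sum_cmult_right[OF zeta2_has_sum])
    have s: "(\<lambda>q. Om q * norm (z q)) summable_on UNIV"
      by (rule summable_on_comparison_test[OF has_sum_imp_summable[OF h]]) (use z Om_pos in \<open>auto simp: less_imp_le\<close>)
    have "infsum (\<lambda>q. Om q * norm (z q)) UNIV \<le> M * zeta2"
      by (rule has_sum_mono[OF has_sum_infsum[OF s] h]) (use z in auto)
    with w has_sum_infsum[OF s] show ?thesis unfolding l1_le_def by blast
  qed
  have W1: "sup1_le (lam * M) w1"
    unfolding sup1_le_def
  proof (intro exI conjI allI, rule w1)
    fix q :: int
    have "Om q * norm (\<i> * of_real (lam * of_int q) * z q) = lam * \<bar>of_int q\<bar> * (Om q * norm (z q))"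
      using lam_pos by (simp add: norm_mult)
    also have "\<dots> \<le> lam * \<bar>of_int q\<bar> * (M / (of_int q)\<^sup>2)"
      using z lam_pos by (intro mult_left_mono) auto
    also have "\<dots> = lam * M / \<bar>of_int q\<bar>"
    proof -
      have "lam * a * (M / a\<^sup>2) = lam * M / a" for a :: real
        by (simp add: power2_eq_square)
      from this[of "\<bar>of_int q\<bar>"] show ?thesis by simp
    qed
    finally show "Om q * norm (\<i> * of_real (lam * of_int q) * z q) \<le> lam * M / \<bar>of_int q\<bar>" .
  qed
  have W2: "sup_le (lam\<^sup>2 * M) w2"
    unfolding sup_le_def
  proof (intro exI conjI allI, rule w2)
    fix q :: int
    have "Om q * norm ((\<i> * of_real (lam * of_int q))\<^sup>2 * z q) = lam\<^sup>2 * (of_int q)\<^sup>2 * (Om q * norm (z q))"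
      by (simp add: norm_mult norm_power power_mult_distrib)
    also have "\<dots> \<le> lam\<^sup>2 * (of_int q)\<^sup>2 * (M / (of_int q)\<^sup>2)"
      using z by (intro mult_left_mono) auto
    also have "\<dots> \<le> lam\<^sup>2 * M"
      using M by (cases "q = 0") simp_all
    finally show "Om q * norm ((\<i> * of_real (lam * of_int q))\<^sup>2 * z q) \<le> lam\<^sup>2 * M" .
  qed
  have 1: "sup_le (((1 + M * zeta2) ^ (p + 1) - 1) * (lam\<^sup>2 * M)) (\<lambda>x. ((1 + w x) ^ (p + 1) - 1) * w2 x)"
    by (rule l1_sup_mult[OF l1_le_power_minus_1[OF W] W2])
  have 2: "sup_le (real (p - 1) * ((1 + M * zeta2) ^ p * ((lam * M) * (lam * M) * zeta2)))
     (\<lambda>x. of_nat (p - 1) * ((1 + w x) ^ p * (w1 x * w1 x)))"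
    using l1_sup_mult[OF l1_le_const[of "of_nat (p - 1)"] l1_sup_mult[OF l1_le_power[OF W] sup1_mult[OF W1 W1]]] M lam_pos
    by simp
  have "norm (complex_of_real (1 / real p)) = 1 / real p" by (simp add: norm_divide)
  then have 3: "sup_le ((1 / real p) * ((1 + M * zeta2) ^ (p + 2) - 1 - real (p + 2) * (M * zeta2)))
     (\<lambda>x. of_real (1 / real p) * ((1 + w x) ^ (p + 2) - 1 - of_nat (p + 2) * w x))"
    using l1_imp_sup[OF l1_le_mult[OF l1_le_const[of "of_real (1 / real p)"] l1_le_power_minus_linear[OF W, of "p + 2"]]]
    by (simp only:)
  show ?thesis
    unfolding nlbound_def nonlin_def[abs_def]
    by (rule sup_le_add[OF sup_le_add[OF 1 2] 3])
qed

text \<open>As a polynomial in \<open>M\<close> the left side has non-negative coefficients and no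
  constant term, so for \<open>M \<le> 1\<close> it is at most \<open>M\<close> times its value at
  1. The next lemma removes the linear term as well and gains \<open>M\<^sup>2\<close>.\<close>

lemma power_minus_1_le:
  fixes M c :: real
  assumes "0 \<le> M" "M \<le> 1" "0 \<le> c"
  shows "(1 + M * c) ^ j - 1 \<le> M * ((1 + c) ^ j - 1)"
proof (induction j)
  case (Suc j)
  have "(1 + M * c) ^ j \<le> (1 + c) ^ j"
    using assms by (intro power_mono) (auto simp: mult_left_le_one_le)
  then have "M * c * (1 + M * c) ^ j \<le> M * c * (1 + c) ^ j"
    using assms by (intro mult_left_mono) auto
  with Suc show ?case by (simp add: algebra_simps)
qed simp

lemma power_minus_linear_le:
  fixes M c :: real
  assumes "0 \<le> M" "M \<le> 1" "0 \<le> c"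
  shows "(1 + M * c) ^ j - 1 - real j * (M * c) \<le> M\<^sup>2 * ((1 + c) ^ j - 1 - real j * c)"
proof (induction j)
  case (Suc j)
  have "M * c * ((1 + M * c) ^ j - 1) \<le> M * c * (M * ((1 + c) ^ j - 1))"
    using power_minus_1_le[OF assms, of j] assms by (intro mult_left_mono) auto
  with Suc show ?case by (simp add: algebra_simps power2_eq_square)
qed simp

text \<open>Each of the three summands contains a factor \<open>M\<^sup>2\<close>; what remains is
  bounded by its value at \<open>M = 1\<close>. The constant depends on \<open>p\<close> and
  \<open>lam\<close> alone.\<close>

lemma nlbound_quadratic:
  assumes "lam > 0" "p \<ge> 1"
  obtains C where "C \<ge> 1" "\<And>M. 0 \<le> M \<Longrightarrow> M \<le> 1 \<Longrightarrow> nlbound p lam M \<le> C * M\<^sup>2"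
proof -
  define c where "c = zeta2"
  have c: "c > 0" using zeta2_pos by (simp add: c_def)
  define C1 where "C1 = ((1 + c) ^ (p + 1) - 1) * lam\<^sup>2"
  define C2 where "C2 = real (p - 1) * ((1 + c) ^ p * (lam * lam * c))"
  define C3 where "C3 = (1 / real p) * ((1 + c) ^ (p + 2) - 1 - real (p + 2) * c)"
  show thesis
  proof (rule that[of "max 1 (C1 + C2 + C3)"])
    fix M :: real assume M: "0 \<le> M" "M \<le> 1"
    have "((1 + M * c) ^ (p + 1) - 1) * (lam\<^sup>2 * M) \<le> (M * ((1 + c) ^ (p + 1) - 1)) * (lam\<^sup>2 * M)"
      using power_minus_1_le[OF M, of c "p + 1"] c M by (intro mult_right_mono) auto
    then have 1: "((1 + M * c) ^ (p + 1) - 1) * (lam\<^sup>2 * M) \<le> C1 * M\<^sup>2"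
      by (simp add: C1_def power2_eq_square algebra_simps)
    have "(1 + M * c) ^ p \<le> (1 + c) ^ p"
      using M c by (intro power_mono) (auto simp: mult_left_le_one_le)
    then have "real (p - 1) * ((1 + M * c) ^ p * ((lam * M) * (lam * M) * c)) \<le> real (p - 1) * ((1 + c) ^ p * ((lam * M) * (lam * M) * c))"
      using M c assms by (intro mult_left_mono mult_right_mono) auto
    then have 2: "real (p - 1) * ((1 + M * c) ^ p * ((lam * M) * (lam * M) * c)) \<le> C2 * M\<^sup>2"
      by (simp add: C2_def power2_eq_square mult_ac)
    have 3: "(1 / real p) * ((1 + M * c) ^ (p + 2) - 1 - real (p + 2) * (M * c)) \<le> C3 * M\<^sup>2"
    proof -
      have "(1 / real p) * ((1 + M * c) ^ (p + 2) - 1 - real (p + 2) * (M * c)) \<le> (1 / real p) * (M\<^sup>2 * ((1 + c) ^ (p + 2) - 1 - real (p + 2) * c))"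
        using power_minus_linear_le[OF M, of c "p + 2"] c by (intro mult_left_mono) auto
      then show ?thesis by (simp add: C3_def mult_ac)
    qed
    have "nlbound p lam M \<le> (C1 + C2 + C3) * M\<^sup>2"
      using 1 2 3 unfolding nlbound_def c_def[symmetric] distrib_right by linarith
    also have "\<dots> \<le> max 1 (C1 + C2 + C3) * M\<^sup>2" by (intro mult_right_mono) auto
    finally show "nlbound p lam M \<le> max 1 (C1 + C2 + C3) * M\<^sup>2" .
  qed simp
qed

subsection \<open>The curvature equation on Fourier modes\<close>

text \<open>The analytic core, free of curves: \<open>kk j\<close> is the \<open>j\<close>-th angle
  derivative of the curvature, and \<open>dt\<close> is the curvature equation multiplied out. The
  time derivative is one-sided at 0.\<close>

locale curvature_flow =
  fixes p :: nat and lam T :: real and kk :: "nat \<Rightarrow> real \<Rightarrow> real \<Rightarrow> real"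
  assumes p1: "1 \<le> p" and lam: "0 < lam" and T: "0 < T"
    and cont: "\<And>j. continuous_on ({0..<T} \<times> UNIV) (\<lambda>(t, x). kk j t x)"
    and dx: "\<And>j t x. t \<in> {0..<T} \<Longrightarrow> (kk j t has_real_derivative kk (Suc j) t x) (at x)"
    and per0: "\<And>t x. t \<in> {0..<T} \<Longrightarrow> kk 0 t (x + 2 * pi / lam) = kk 0 t x"
    and pos: "\<And>t x. t \<in> {0..<T} \<Longrightarrow> 0 < kk 0 t x"
    and dt: "\<And>t x. t \<in> {0..<T} \<Longrightarrow> ((\<lambda>s. kk 0 s x) has_real_derivative
        kk 0 t x ^ (p + 1) * kk 2 t x + real (p - 1) * (kk 0 t x ^ p * (kk 1 t x)\<^sup>2) + kk 0 t x ^ (p + 2) / real p)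
        (at t within {0..<T})"
begin

abbreviation "L \<equiv> 2 * pi / lam"

lemma L_pos: "0 < L" using lam by simp

definition kt :: "real \<Rightarrow> real \<Rightarrow> real" where
  "kt t x = kk 0 t x ^ (p + 1) * kk 2 t x + real (p - 1) * (kk 0 t x ^ p * (kk 1 t x)\<^sup>2) + kk 0 t x ^ (p + 2) / real p"

definition y :: "real \<Rightarrow> int \<Rightarrow> complex" where
  "y t q = fco lam (\<lambda>x. of_real (kk 0 t x)) q"

definition K :: "real \<Rightarrow> real" where "K t = Re (y t 0)"

definition z :: "real \<Rightarrow> int \<Rightarrow> complex" where
  "z t q = (if q = 0 then 0 else y t q / of_real (K t))"

text \<open>The \<open>j\<close>-th angle derivative of \<open>k / K - 1\<close>, complex-valued so
  that \<open>fourier_rep\<close> applies; the constant 1 survives only for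
  \<open>j = 0\<close>.\<close>

definition w :: "nat \<Rightarrow> real \<Rightarrow> real \<Rightarrow> complex" where
  "w j t x = of_real (kk j t x / K t - (if j = 0 then 1 else 0))"

definition R :: "real \<Rightarrow> int \<Rightarrow> complex" where
  "R t q = fco lam (nonlin p (w 0 t) (w 1 t) (w 2 t)) q"

lemma per: "t \<in> {0..<T} \<Longrightarrow> kk j t (x + L) = kk j t x"
proof (induction j arbitrary: x)
  case 0
  then show ?case using per0 by simp
next
  case (Suc j)
  have "((\<lambda>x. kk j t (x + L)) has_real_derivative kk (Suc j) t (x + L)) (at x)"
    by (subst DERIV_shift[symmetric]) (use dx[OF Suc.prems] in simp)
  moreover have "(\<lambda>x. kk j t (x + L)) = kk j t" using Suc by (simp add: fun_eq_iff)
  ultimately show ?case using dx[OF Suc.prems] DERIV_unique by metis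
qed

lemma cont_x: "t \<in> {0..<T} \<Longrightarrow> continuous_on S (kk j t)"
  by (meson dx DERIV_isCont continuous_at_imp_continuous_on)

lemma dxc: "t \<in> {0..<T} \<Longrightarrow> ((\<lambda>x. complex_of_real (kk j t x)) has_vector_derivative of_real (kk (Suc j) t x)) (at x)"
  using dx by (rule has_vector_derivative_of_real)

lemma fco_kk:
  assumes "t \<in> {0..<T}"
  shows "fco lam (\<lambda>x. of_real (kk j t x)) q = (\<i> * of_real (lam * of_int q)) ^ j * y t q"
proof (induction j)
  case (Suc j)
  have "fco lam (\<lambda>x. of_real (kk (Suc j) t x)) q = \<i> * of_real (lam * of_int q) * fco lam (\<lambda>x. of_real (kk j t x)) q"
    by (rule fco_deriv[OF lam dxc[OF assms]])
       (use per[OF assms, of j 0] cont_x[OF assms] in \<open>auto intro!: continuous_intros\<close>)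
  then show ?case using Suc by simp
qed (simp add: y_def)

lemma rep_kk:
  assumes "t \<in> {0..<T}"
  shows "fourier_rep lam (\<lambda>q. (\<i> * of_real (lam * of_int q)) ^ j * y t q) (\<lambda>x. of_real (kk j t x))"
proof -
  have "fourier_rep lam (fco lam (\<lambda>x. of_real (kk j t x))) (\<lambda>x. of_real (kk j t x))"
    by (rule fourier_rep_C2[OF lam dxc[OF assms] dxc[OF assms]])
       (use per[OF assms] cont_x[OF assms] in \<open>auto intro!: continuous_intros\<close>)
  then show ?thesis by (simp only: fco_kk[OF assms, abs_def])
qed

lemma y_0: "y t 0 = of_real (period_mean lam (kk 0 t))" if "t \<in> {0..<T}"
proof -
  have "integral {0..L} (\<lambda>x. complex_of_real (kk 0 t x)) = of_real (integral {0..L} (kk 0 t))"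
    using integral_linear[OF integrable_continuous_real[OF cont_x[OF that, of "{0..L}" 0]] bounded_linear_of_real[where 'a=complex]]
    by (simp add: o_def)
  then show ?thesis by (simp add: y_def fco_def period_mean_def scaleR_conv_of_real)
qed

lemma y_0_K: "t \<in> {0..<T} \<Longrightarrow> y t 0 = of_real (K t)"
  by (simp add: y_0 K_def)

lemma K_pos:
  assumes "t \<in> {0..<T}"
  shows "0 < K t"
proof -
  obtain m where m: "m \<in> {0..L}" "\<And>x. x \<in> {0..L} \<Longrightarrow> kk 0 t m \<le> kk 0 t x"
    using continuous_attains_inf[OF compact_Icc _ cont_x[OF assms, of "{0..L}" 0]] L_pos by auto
  have "integral {0..L} (\<lambda>x. kk 0 t m) \<le> integral {0..L} (kk 0 t)"
    using m by (intro integral_le integrable_continuous_real cont_x[OF assms]) auto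
  moreover have "integral {0..L} (\<lambda>x. kk 0 t m) = L * kk 0 t m"
    using L_pos by (subst integral_const_real) auto
  moreover have "0 < L * kk 0 t m" using L_pos pos[OF assms] by (rule mult_pos_pos)
  ultimately have "0 < integral {0..L} (kk 0 t)" by linarith
  then show ?thesis using lam y_0[OF assms] by (simp add: K_def period_mean_def)
qed

lemma rep_w:
  assumes t: "t \<in> {0..<T}"
  shows "fourier_rep lam (\<lambda>q. (\<i> * of_real (lam * of_int q)) ^ j * z t q) (w j t)"
proof -
  have K0: "K t \<noteq> 0" using K_pos[OF t] by simp
  define c where "c = complex_of_real (1 / K t)"
  define d where "d = (if j = 0 then - 1 else 0 :: complex)"
  have "fourier_rep lam (\<lambda>q. c * ((\<i> * of_real (lam * of_int q)) ^ j * y t q) + (if q = 0 then d else 0))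
     (\<lambda>x. c * of_real (kk j t x) + d)"
    by (rule fourier_rep_add[OF fourier_rep_cmult[OF rep_kk[OF t]] fourier_rep_const])
  moreover have "(\<lambda>q. c * ((\<i> * of_real (lam * of_int q)) ^ j * y t q) + (if q = 0 then d else 0)) =
     (\<lambda>q. (\<i> * of_real (lam * of_int q)) ^ j * z t q)"
    using K0 y_0_K[OF t] by (auto simp: fun_eq_iff c_def d_def z_def)
  moreover have "(\<lambda>x. c * of_real (kk j t x) + d) = w j t"
    by (auto simp: fun_eq_iff c_def d_def w_def)
  ultimately show ?thesis by simp
qed

lemma continuous_on_w: "t \<in> {0..<T} \<Longrightarrow> continuous_on S (w j t)"
  using fourier_rep_continuous[OF rep_w] .

lemma continuous_on_nonlin: "t \<in> {0..<T} \<Longrightarrow> continuous_on S (nonlin p (w 0 t) (w 1 t) (w 2 t))"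
  unfolding nonlin_def[abs_def] by (intro continuous_intros continuous_on_w)

text \<open>The right-hand side is homogeneous of degree \<open>p + 2\<close> in the curvature and
  its derivatives, so \<open>K ^ (p + 2)\<close> factors out and the rest is expanded around the
  value 1.\<close>

lemma kt_expand:
  assumes t: "t \<in> {0..<T}"
  shows "complex_of_real (kt t x) = of_real (K t ^ (p + 2)) *
     (w 2 t x + (of_real (1 / real p) + (of_real ((p + 2) / real p) * w 0 t x + nonlin p (w 0 t) (w 1 t) (w 2 t) x)))"
proof -
  have K0: "K t \<noteq> 0" using K_pos[OF t] by simp
  define a where "a = kk 0 t x / K t"
  define b where "b = kk 1 t x / K t"
  define c where "c = kk 2 t x / K t"
  have e: "kk 0 t x = K t * a" "kk 1 t x = K t * b" "kk 2 t x = K t * c"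
    using K0 by (simp_all add: a_def b_def c_def)
  have ww: "w 0 t x = of_real (a - 1)" "w 1 t x = of_real b" "w 2 t x = of_real c"
    by (simp_all add: w_def a_def b_def c_def)
  have "kt t x = K t ^ (p + 2) * (a ^ (p + 1) * c + real (p - 1) * (a ^ p * b\<^sup>2) + a ^ (p + 2) / real p)"
    unfolding kt_def e by (simp add: power_mult_distrib algebra_simps power2_eq_square)
  also have "\<dots> = K t ^ (p + 2) * (c + (1 / real p + (((p + 2) / real p) * (a - 1) +
      ((a ^ (p + 1) - 1) * c + real (p - 1) * (a ^ p * (b * b)) + (1 / real p) * (a ^ (p + 2) - 1 - real (p + 2) * (a - 1))))))"
    by (rule arg_cong[where f="\<lambda>u. K t ^ (p + 2) * u"]) (use p1 in \<open>simp add: field_simps power2_eq_square\<close>)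
  finally have "complex_of_real (kt t x) = of_real (K t ^ (p + 2) * (c + (1 / real p + (((p + 2) / real p) * (a - 1) +
      ((a ^ (p + 1) - 1) * c + real (p - 1) * (a ^ p * (b * b)) + (1 / real p) * (a ^ (p + 2) - 1 - real (p + 2) * (a - 1)))))))"
    by (rule arg_cong)
  also have "\<dots> = of_real (K t ^ (p + 2)) *
     (w 2 t x + (of_real (1 / real p) + (of_real ((p + 2) / real p) * w 0 t x + nonlin p (w 0 t) (w 1 t) (w 2 t) x)))"
    unfolding nonlin_def ww by simp
  finally show ?thesis .
qed

lemma fco_kt:
  assumes t: "t \<in> {0..<T}"
  shows "fco lam (\<lambda>x. of_real (kt t x)) q = of_real (K t ^ (p + 2)) *
     ((\<i> * of_real (lam * of_int q))\<^sup>2 * z t q + ((if q = 0 then of_real (1 / real p) else 0) +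
       (of_real ((p + 2) / real p) * z t q + R t q)))"
proof -
  note cs = continuous_on_w[OF t] continuous_on_nonlin[OF t]
  have rw: "fco lam (w j t) q = (\<i> * of_real (lam * of_int q)) ^ j * z t q" for j
    by (rule fourier_rep_fco[OF lam rep_w[OF t]])
  have rc: "fco lam (\<lambda>x. c) q = (if q = 0 then c else 0)" for c
    by (rule fourier_rep_fco[OF lam fourier_rep_const])
  have "fco lam (\<lambda>x. of_real (kt t x)) q = of_real (K t ^ (p + 2)) * fco lam (\<lambda>x.
     (w 2 t x + (of_real (1 / real p) + (of_real ((p + 2) / real p) * w 0 t x + nonlin p (w 0 t) (w 1 t) (w 2 t) x)))) q"
    unfolding kt_expand[OF t] by (rule fco_cmult)
  also have "fco lam (\<lambda>x.
     (w 2 t x + (of_real (1 / real p) + (of_real ((p + 2) / real p) * w 0 t x + nonlin p (w 0 t) (w 1 t) (w 2 t) x)))) q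
     = fco lam (w 2 t) q + fco lam (\<lambda>x. (of_real (1 / real p) + (of_real ((p + 2) / real p) * w 0 t x + nonlin p (w 0 t) (w 1 t) (w 2 t) x))) q"
    by (intro fco_add cs continuous_on_add continuous_on_mult continuous_on_const)
  also have "fco lam (\<lambda>x. (of_real (1 / real p) + (of_real ((p + 2) / real p) * w 0 t x + nonlin p (w 0 t) (w 1 t) (w 2 t) x))) q =
     fco lam (\<lambda>x. of_real (1 / real p)) q + fco lam (\<lambda>x. (of_real ((p + 2) / real p) * w 0 t x + nonlin p (w 0 t) (w 1 t) (w 2 t) x)) q"
    by (intro fco_add cs continuous_on_add continuous_on_mult continuous_on_const)
  also have "fco lam (\<lambda>x. (of_real ((p + 2) / real p) * w 0 t x + nonlin p (w 0 t) (w 1 t) (w 2 t) x)) q =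
     fco lam (\<lambda>x. of_real ((p + 2) / real p) * w 0 t x) q + fco lam (nonlin p (w 0 t) (w 1 t) (w 2 t)) q"
    by (intro fco_add cs continuous_on_add continuous_on_mult continuous_on_const)
  finally show ?thesis
    unfolding fco_cmult rw rc R_def by simp
qed

text \<open>Differentiation under the integral sign, justified by the joint continuity of the
  right-hand side.\<close>

lemma y_has_derivative:
  assumes t: "t \<in> {0..<T}"
  shows "((\<lambda>s. y s q) has_vector_derivative fco lam (\<lambda>x. of_real (kt t x)) q) (at t within {0..<T})"
proof -
  have "((\<lambda>s. integral (cbox 0 L) (\<lambda>x. complex_of_real (kk 0 s x) * echar lam (- q) x)) has_vector_derivative
     integral (cbox 0 L) (\<lambda>x. complex_of_real (kt t x) * echar lam (- q) x)) (at t within {0..<T})"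
  proof (rule leibniz_rule_vector_derivative)
    show "((\<lambda>s. complex_of_real (kk 0 s x) * echar lam (- q) x) has_vector_derivative
        complex_of_real (kt s x) * echar lam (- q) x) (at s within {0..<T})" if "s \<in> {0..<T}" for s x
      by (rule has_vector_derivative_mult_left[OF has_vector_derivative_of_real]) (use dt[OF that] in \<open>simp add: kt_def\<close>)
    show "(\<lambda>x. complex_of_real (kk 0 s x) * echar lam (- q) x) integrable_on cbox 0 L" if "s \<in> {0..<T}" for s
      by (intro integrable_continuous continuous_intros cont_x[OF that])
    have c: "continuous_on ({0..<T} \<times> S) (\<lambda>u. kk j (fst u) (snd u))" for j S
      by (rule continuous_on_subset[OF cont[of j, unfolded case_prod_unfold]]) auto
    have "continuous_on ({0..<T} \<times> cbox 0 L) (\<lambda>u. complex_of_real (kt (fst u) (snd u)) * echar lam (- q) (snd u))"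
      unfolding kt_def divide_inverse
      by (intro continuous_intros c continuous_on_compose2[OF continuous_on_echar[of UNIV]]) auto
    then show "continuous_on ({0..<T} \<times> cbox 0 L) (\<lambda>(s, x). complex_of_real (kt s x) * echar lam (- q) x)"
      by (simp add: case_prod_unfold)
  qed (use t in auto)
  then show ?thesis
    unfolding y_def fco_def by (auto intro!: has_vector_derivative_scaleR[THEN has_vector_derivative_eq_rhs] derivative_eq_intros)
qed

lemma Re_R_0: "R t 0 = of_real (Re (R t 0))" if t: "t \<in> {0..<T}"
proof -
  have "cnj (nonlin p (w 0 t) (w 1 t) (w 2 t) x) = nonlin p (w 0 t) (w 1 t) (w 2 t) x" for x
    by (simp add: nonlin_def w_def)
  then have "cnj (R t 0) = R t 0"
    using integral_cnj[of "{0..L}" "nonlin p (w 0 t) (w 1 t) (w 2 t)"]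
    by (simp add: R_def fco_def)
  then show ?thesis by (simp add: complex_eq_iff)
qed

text \<open>In the zero mode all linear terms drop out because \<open>z t 0 = 0\<close>; only the
  constant and the quadratic part remain.\<close>

lemma K_has_derivative:
  assumes t: "t \<in> {0..<T}"
  shows "(K has_real_derivative K t ^ (p + 2) * (1 / real p + Re (R t 0))) (at t within {0..<T})"
proof -
  have "fco lam (\<lambda>x. of_real (kt t x)) 0 = of_real (K t ^ (p + 2)) * (of_real (1 / real p) + R t 0)"
    unfolding fco_kt[OF t] by (simp add: z_def)
  then have "Re (fco lam (\<lambda>x. of_real (kt t x)) 0) = K t ^ (p + 2) * (1 / real p + Re (R t 0))"
    by simp
  then show ?thesis
    using bounded_linear.has_vector_derivative[OF bounded_linear_Re y_has_derivative[OF t, of 0]]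
    by (simp add: K_def[abs_def] has_real_derivative_iff_has_vector_derivative)
qed

text \<open>Quotient rule for \<open>y / K\<close>. The growth of the mean lowers the linear rate
  from \<open>(p + 2) / p\<close> to \<open>(p + 1) / p\<close> and contributes the term with
  \<open>R t 0\<close>.\<close>

lemma z_has_derivative:
  assumes t: "t \<in> {0..<T}" and q: "q \<noteq> 0"
  shows "((\<lambda>s. z s q) has_vector_derivative of_real (K t ^ (p + 1)) *
     (of_real (- (lam\<^sup>2 * (of_int q)\<^sup>2) + (p + 1) / real p) * z t q + R t q - z t q * R t 0)) (at t within {0..<T})"
proof -
  have K0: "K t \<noteq> 0" using K_pos[OF t] by simp
  have "((\<lambda>s. inverse (K s)) has_real_derivative - (K t ^ (p + 2) * (1 / real p + Re (R t 0)) * inverse ((K t)\<^sup>2)))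
      (at t within {0..<T})"
    using DERIV_inverse_fun[OF K_has_derivative[OF t] K0] by (simp add: power2_eq_square)
  moreover have "K t ^ (p + 2) * (1 / real p + Re (R t 0)) * inverse ((K t)\<^sup>2) = K t ^ p * (1 / real p + Re (R t 0))"
    using K0 by (simp add: power_add power2_eq_square field_simps)
  ultimately have "((\<lambda>s. inverse (K s)) has_real_derivative - (K t ^ p * (1 / real p + Re (R t 0))))
      (at t within {0..<T})"
    by (simp only:)
  from has_vector_derivative_mult[OF has_vector_derivative_of_real[OF this, where 'a=complex] y_has_derivative[OF t, of q]]
  have "((\<lambda>s. of_real (inverse (K s)) * y s q) has_vector_derivative
      of_real (inverse (K t)) * fco lam (\<lambda>x. of_real (kt t x)) q + of_real (- (K t ^ p * (1 / real p + Re (R t 0)))) * y t q)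
      (at t within {0..<T})" .
  moreover have "y t q = of_real (K t) * z t q" using q K0 by (simp add: z_def)
  moreover have "(\<lambda>s. of_real (inverse (K s)) * y s q) = (\<lambda>s. z s q)"
    using q by (simp add: fun_eq_iff z_def field_simps)
  moreover have "of_real (inverse (K t)) * (of_real (K t ^ (p + 2)) *
     ((\<i> * of_real (lam * of_int q))\<^sup>2 * z t q + (0 + (of_real ((p + 2) / real p) * z t q + R t q)))) +
      of_real (- (K t ^ p * (1 / real p + Re (R t 0)))) * (of_real (K t) * z t q) =
      of_real (K t ^ (p + 1)) *
     (of_real (- (lam\<^sup>2 * (of_int q)\<^sup>2) + (p + 1) / real p) * z t q + R t q - z t q * of_real (Re (R t 0)))"
    using K0 p1 by (simp add: field_simps power2_eq_square)
  ultimately show ?thesis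
    using fco_kt[OF t, of q] q Re_R_0[OF t] by simp
qed

end

subsection \<open>The trapping region\<close>

text \<open>For finitely many functions the set of times at which some function is non-negative is
  compact and has a least element. The intermediate value theorem excludes a positive value
  there.\<close>

lemma first_exit_finite:
  fixes f :: "'i \<Rightarrow> real \<Rightarrow> real"
  assumes fin: "finite Q" and cont: "\<And>i. i \<in> Q \<Longrightarrow> continuous_on {0..b} (f i)"
    and start: "\<And>i. i \<in> Q \<Longrightarrow> f i 0 < 0"
    and bad: "i0 \<in> Q" "t0 \<in> {0..b}" "0 \<le> f i0 t0"
  obtains t i where "0 < t" "t \<le> b" "i \<in> Q" "f i t = 0" "\<And>j s. j \<in> Q \<Longrightarrow> 0 \<le> s \<Longrightarrow> s < t \<Longrightarrow> f j s < 0"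
    "\<And>j. j \<in> Q \<Longrightarrow> f j t \<le> 0"
proof -
  define S where "S = (\<Union>i\<in>Q. {t \<in> {0..b}. 0 \<le> f i t})"
  have "compact {t \<in> {0..b}. 0 \<le> f i t}" if "i \<in> Q" for i
  proof -
    have "closed {t \<in> {0..b}. 0 \<le> f i t}"
      using continuous_closed_preimage[OF cont[OF that], of "{0..}"] by (simp add: vimage_def Int_def)
    moreover have "bounded {t \<in> {0..b}. 0 \<le> f i t}"
      by (rule bounded_subset[of "{0..b}"]) auto
    ultimately show ?thesis by (simp add: compact_eq_bounded_closed)
  qed
  then have "compact S" unfolding S_def using fin by (intro compact_UN) auto
  moreover have "S \<noteq> {}" using bad by (auto simp: S_def)
  ultimately obtain t where t: "t \<in> S" "\<And>s. s \<in> S \<Longrightarrow> t \<le> s"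
    using compact_attains_inf by metis
  from t(1) obtain i where i: "i \<in> Q" "t \<in> {0..b}" "0 \<le> f i t" by (auto simp: S_def)
  have t0: "0 < t" using i start[OF i(1)] by (cases "t = 0") auto
  have before: "f j s < 0" if "j \<in> Q" "0 \<le> s" "s < t" for j s
  proof (rule ccontr)
    assume "\<not> f j s < 0"
    then have "0 \<le> f j s" by simp
    then have "s \<in> S" using that i by (auto simp: S_def intro!: bexI[of _ j])
    with t(2)[of s] that show False by simp
  qed
  have at: "f j t \<le> 0" if "j \<in> Q" for j
  proof (rule ccontr)
    assume "\<not> f j t \<le> 0"
    then have "\<exists>s. 0 \<le> s \<and> s \<le> t \<and> f j s = 0"
      using before[OF that, of 0] t0 i(2)
      by (intro IVT') (auto intro: continuous_on_subset[OF cont[OF that]])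
    then obtain s where s: "0 \<le> s" "s \<le> t" "f j s = 0" by blast
    then have "s < t" using \<open>\<not> f j t \<le> 0\<close> by (cases "s = t") auto
    with before[OF that s(1)] s(3) show False by simp
  qed
  show thesis
    by (rule that[OF t0 _ i(1) _ before at]) (use i at[OF i(1)] in auto)
qed

text \<open>The 12 is 3 times 4: the 3 absorbs \<open>exp 1\<close> in \<open>MM_le\<close>, and the
  4 leaves \<open>C * MM t\<close> below a quarter of \<open>xx t / p\<close>, the extra rate
  granted by the barrier. The last factor exceeds 1 and makes the inequality strict.\<close>

definition trap_radius :: "nat \<Rightarrow> real \<Rightarrow> real \<Rightarrow> real" where
  "trap_radius p lam C = 1 / (12 * real p * C * (decay_rate p lam + 4))"

lemma integral_has_derivative_Ico:
  fixes k :: "real \<Rightarrow> real"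
  assumes "continuous_on {0..<T} k" and t: "t \<in> {0..<T}"
  shows "((\<lambda>s. integral {0..s} k) has_real_derivative k t) (at t within {0..<T})"
proof -
  define b where "b = (t + T) / 2"
  have b: "t < b" "b < T" using t by (auto simp: b_def)
  have "((\<lambda>s. integral {0..s} k) has_real_derivative k t) (at t within {0..b})"
    by (rule integral_has_real_derivative) (use t b in \<open>auto intro!: continuous_on_subset[OF assms(1)]\<close>)
  moreover have "at t within {0..b} = at t within {0..<T}"
    by (rule at_within_nhd[of _ "{..<b}"]) (use b in auto)
  ultimately show ?thesis by simp
qed

text \<open>The clock of the barrier is \<open>sg\<close>, with \<open>sg' = K\<^bsup>p+1\<^esup>\<close>: in this time the linearized flow at the
  circle is autonomous and mode \<open>q\<close> decays at the rate \<open>\<lambda>\<^sup>2q\<^sup>2 - (p+1)/p\<close>, which is \<open>\<beta>/p\<close> for \<open>|q| = 1\<close>.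
  The bounded factor \<open>exp (1 - xx)\<close> leaves room for the quadratic terms without losing the rate.
  The analytic weight \<open>exp (a |q|)\<close> is truncated at \<open>|q| = N\<close>, since finiteness of the untruncated
  sums is not known beforehand; the truncation keeps it submultiplicative.\<close>

locale curvature_trap = curvature_flow +
  fixes C :: real and G :: "int \<Rightarrow> real" and N c :: real and r :: nat
  assumes beta1: "1 \<le> decay_rate p lam"
    and C1: "1 \<le> C" and C_bound: "\<And>M. 0 \<le> M \<Longrightarrow> M \<le> 1 \<Longrightarrow> nlbound p lam M \<le> C * M\<^sup>2"
    and G_ge_1: "\<And>q. 1 \<le> G q" and G_0: "G 0 = 1" and G_submult: "\<And>q s. G (q + s) \<le> G q * G s"
    and G_growth: "\<And>q. G q \<le> c * (1 + \<bar>of_int q\<bar>) ^ r"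
    and N_nonneg: "0 \<le> N"
    and init: "\<And>q. q \<noteq> 0 \<Longrightarrow> (of_int q)\<^sup>2 * G q * norm (z 0 q) < trap_radius p lam C"
begin

abbreviation "\<beta> \<equiv> decay_rate p lam"
abbreviation "M0 \<equiv> trap_radius p lam C"

definition sg :: "real \<Rightarrow> real" where "sg t = integral {0..t} (\<lambda>s. K s ^ (p + 1))"
text \<open>For a round circle \<open>K\<close> grows like \<open>exp (sg / p)\<close>, so
  \<open>xx t\<close> models the ratio \<open>K 0 / K t\<close>. It runs down from 1 and measures
  how far the flow has progressed.\<close>

definition xx :: "real \<Rightarrow> real" where "xx t = exp (- (sg t / real p))"
definition mu :: "int \<Rightarrow> real" where "mu q = min \<bar>of_int q\<bar> N"
text \<open>Its slope in the clock \<open>sg\<close> is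
  \<open>- \<beta> / p + xx / p - xx * mu / (2 * p)\<close>: the exact rate, an integrable bonus,
  and the cost of the growing exponential weight.\<close>

definition ee :: "real \<Rightarrow> int \<Rightarrow> real" where
  "ee t q = - (\<beta> / real p) * sg t + (1 - xx t) - (1 - xx t) * mu q / 2"
definition bar :: "real \<Rightarrow> int \<Rightarrow> real" where
  "bar t q = M0 / ((of_int q)\<^sup>2 * G q) * exp (ee t q)"
text \<open>\<open>MM\<close> and \<open>Om\<close> split the barrier into a size and a weight: by
  \<open>bar_MM\<close>, being trapped is the hypothesis of \<open>sup_le_nonlin\<close> with
  \<open>M = MM t\<close> and the weight \<open>Om t\<close>.\<close>

definition MM :: "real \<Rightarrow> real" where "MM t = M0 * exp (- (\<beta> / real p) * sg t + (1 - xx t))"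
definition Om :: "real \<Rightarrow> int \<Rightarrow> real" where "Om t q = G q * exp ((1 - xx t) * mu q / 2)"

lemma p0: "0 < real p" using p1 by simp

lemma M0_pos: "0 < M0"
  using p0 C1 beta1 by (simp add: trap_radius_def)

lemma CM0: "C * M0 = 1 / (12 * real p * (\<beta> + 4))"
  using C1 p0 beta1 by (simp add: trap_radius_def)

lemma G_pos: "0 < G q" using G_ge_1[of q] by simp

lemma K_cont: "continuous_on {0..<T} K"
  using K_has_derivative by (meson DERIV_continuous continuous_on_eq_continuous_within)

lemma sg_has_derivative:
  assumes t: "t \<in> {0..<T}"
  shows "(sg has_real_derivative K t ^ (p + 1)) (at t within {0..<T})"
  unfolding sg_def[abs_def] by (rule integral_has_derivative_Ico[OF _ t]) (intro continuous_intros K_cont)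

lemma sg_cont: "continuous_on {0..<T} sg"
  using sg_has_derivative by (meson DERIV_continuous continuous_on_eq_continuous_within)

lemma sg_0: "sg 0 = 0" by (simp add: sg_def)

lemma sg_nonneg: "t \<in> {0..<T} \<Longrightarrow> 0 \<le> sg t"
  unfolding sg_def
proof (rule integral_nonneg)
  show "(\<lambda>s. K s ^ (p + 1)) integrable_on {0..t}" if "t \<in> {0..<T}"
    using that by (intro integrable_continuous_real continuous_intros continuous_on_subset[OF K_cont]) auto
  show "0 \<le> K s ^ (p + 1)" if "t \<in> {0..<T}" "s \<in> {0..t}" for s
    using that by (intro zero_le_power less_imp_le[OF K_pos]) auto
qed

lemma xx_bounds: "t \<in> {0..<T} \<Longrightarrow> 0 < xx t \<and> xx t \<le> 1"
  using sg_nonneg p0 by (simp add: xx_def)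

lemma mu_bounds: "0 \<le> mu q" "mu q \<le> \<bar>of_int q\<bar>" "mu q \<le> N"
  using N_nonneg by (auto simp: mu_def)

lemma mu_subadd: "mu (q + s) \<le> mu q + mu s"
  using N_nonneg unfolding mu_def by (auto simp: min_def)

lemma Om_weight:
  assumes t: "t \<in> {0..<T}"
  shows "fourier_weight lam (Om t)"
proof
  show "lam > 0" by (rule lam)
  have a: "0 \<le> (1 - xx t) / 2" using xx_bounds[OF t] by simp
  show "1 \<le> Om t q" for q
    using mult_mono[of 1 "G q" 1 "exp ((1 - xx t) * mu q / 2)"] G_ge_1[of q] mu_bounds(1)[of q] a
    by (simp add: Om_def)
  show "Om t 0 = 1" using N_nonneg by (simp add: Om_def G_0 mu_def)
  show "Om t (q + s) \<le> Om t q * Om t s" for q s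
  proof -
    have "(1 - xx t) / 2 * mu (q + s) \<le> (1 - xx t) / 2 * (mu q + mu s)"
      using mu_subadd a by (rule mult_left_mono)
    then have "exp ((1 - xx t) * mu (q + s) / 2) \<le> exp ((1 - xx t) * mu q / 2 + (1 - xx t) * mu s / 2)"
      by (simp only: exp_le_cancel_iff distrib_left times_divide_eq_left)
    then have "G (q + s) * exp ((1 - xx t) * mu (q + s) / 2) \<le> (G q * G s) * exp ((1 - xx t) * mu q / 2 + (1 - xx t) * mu s / 2)"
      using G_submult G_pos by (intro mult_mono) (auto intro: less_imp_le mult_nonneg_nonneg)
    then show ?thesis by (simp add: Om_def exp_add mult_ac)
  qed
qed

lemma bar_MM: "bar t q = MM t / ((of_int q)\<^sup>2 * Om t q)"
  by (simp add: bar_def MM_def Om_def ee_def exp_diff)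

lemma bar_pos: "q \<noteq> 0 \<Longrightarrow> 0 < bar t q"
  using M0_pos G_pos[of q] by (simp add: bar_def)

lemma MM_le:
  assumes t: "t \<in> {0..<T}"
  shows "0 < MM t" "MM t \<le> 3 * M0 * xx t" "MM t \<le> 1"
proof -
  have x: "0 < xx t" "xx t \<le> 1" using xx_bounds[OF t] by auto
  show "0 < MM t" using M0_pos by (simp add: MM_def)
  have "exp (1 - xx t) \<le> 3"
    using order_trans[of "exp (1 - xx t)" "exp 1" 3] x exp_le by simp
  \<comment> \<open>This uses \<open>\<beta> \<ge> 1\<close>: the modes decay at least as fast as
    \<open>xx\<close>, so the quadratic terms are controlled by the bonus rate.\<close>
  moreover have "exp (- (\<beta> / real p) * sg t) \<le> xx t"
  proof -
    have "1 / real p * sg t \<le> \<beta> / real p * sg t"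
      using beta1 p0 sg_nonneg[OF t] by (intro mult_right_mono divide_right_mono) auto
    then show ?thesis by (simp add: xx_def)
  qed
  ultimately have "exp (- (\<beta> / real p) * sg t) * exp (1 - xx t) \<le> xx t * 3"
    using x by (intro mult_mono) auto
  then have "M0 * (exp (- (\<beta> / real p) * sg t) * exp (1 - xx t)) \<le> M0 * (xx t * 3)"
    using M0_pos by (intro mult_left_mono) auto
  then show 1: "MM t \<le> 3 * M0 * xx t" by (simp add: MM_def exp_add[symmetric] mult_ac)
  have "12 * real p * C * (\<beta> + 4) \<ge> 12 * 1 * 1 * (1 + 4)"
    using p1 C1 beta1 by (intro mult_mono) auto
  then have "3 * M0 \<le> 1" by (simp add: trap_radius_def field_simps)
  then have "3 * M0 * xx t \<le> 1 * 1" using x M0_pos by (intro mult_mono) auto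
  with 1 show "MM t \<le> 1" by simp
qed

lemma CMM_le:
  assumes t: "t \<in> {0..<T}"
  shows "C * MM t \<le> xx t / (4 * real p * (\<beta> + 4))" "C * (MM t)\<^sup>2 \<le> C * MM t" "C * MM t \<le> xx t / (4 * real p)"
proof -
  have x: "0 < xx t" "xx t \<le> 1" using xx_bounds[OF t] by auto
  have "C * MM t \<le> C * (3 * M0 * xx t)"
    using MM_le[OF t] C1 by (intro mult_left_mono) auto
  also have "\<dots> = 3 * (C * M0) * xx t" by simp
  also have "\<dots> = xx t / (4 * real p * (\<beta> + 4))"
  proof -
    have "3 * (1 / (12 * a)) * x = x / (4 * a)" for a x :: real by simp
    from this[of "real p * (\<beta> + 4)" "xx t"] show ?thesis unfolding CM0 by (simp only: mult.assoc)
  qed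
  finally show 1: "C * MM t \<le> xx t / (4 * real p * (\<beta> + 4))" .
  have "4 * real p * 1 \<le> 4 * real p * (\<beta> + 4)" using p0 beta1 by (intro mult_left_mono) auto
  then have "xx t / (4 * real p * (\<beta> + 4)) \<le> xx t / (4 * real p)"
    using x p0 by (intro divide_left_mono) auto
  with 1 show "C * MM t \<le> xx t / (4 * real p)" by simp
  show "C * (MM t)\<^sup>2 \<le> C * MM t"
    using MM_le[OF t] C1 by (auto simp: power2_eq_square mult_left_le)
qed

definition trapped :: "real \<Rightarrow> bool" where
  "trapped t \<longleftrightarrow> (\<forall>q. q \<noteq> 0 \<longrightarrow> norm (z t q) \<le> bar t q)"

lemma trapped_R:
  assumes t: "t \<in> {0..<T}" and tr: "trapped t"
  shows "Om t q * norm (R t q) \<le> C * (MM t)\<^sup>2"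
proof -
  interpret fw: fourier_weight lam "Om t" by (rule Om_weight[OF t])
  have "fw.sup_le (nlbound p lam (MM t)) (nonlin p (w 0 t) (w 1 t) (w 2 t))"
  proof (rule fw.sup_le_nonlin)
    show "fourier_rep lam (z t) (w 0 t)" using rep_w[OF t, of 0] by simp
    show "fourier_rep lam (\<lambda>q. \<i> * of_real (lam * of_int q) * z t q) (w 1 t)"
      using rep_w[OF t, of 1] by simp
    show "fourier_rep lam (\<lambda>q. (\<i> * of_real (lam * of_int q))\<^sup>2 * z t q) (w 2 t)"
      by (rule rep_w[OF t])
    show "0 \<le> MM t" using MM_le(1)[OF t] by simp
    show "Om t q * norm (z t q) \<le> MM t / (of_int q)\<^sup>2" for q
    proof (cases "q = 0")
      case False
      then have "Om t q * norm (z t q) \<le> Om t q * bar t q"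
        using tr fw.Om_pos[of q] by (intro mult_left_mono) (auto simp: trapped_def)
      also have "\<dots> = MM t / (of_int q)\<^sup>2" using fw.Om_pos[of q] by (simp add: bar_MM)
      finally show ?thesis .
    qed (simp add: z_def)
  qed
  from fw.sup_le_fco[OF this, of q]
  have "Om t q * norm (R t q) \<le> nlbound p lam (MM t)" by (simp add: R_def)
  also have "\<dots> \<le> C * (MM t)\<^sup>2" using C_bound MM_le[OF t] by simp
  finally show ?thesis .
qed

lemma trapped_R_0:
  assumes t: "t \<in> {0..<T}" and tr: "trapped t"
  shows "norm (R t 0) \<le> C * (MM t)\<^sup>2" "norm (R t 0) \<le> xx t / (4 * real p)"
proof -
  interpret fw: fourier_weight lam "Om t" by (rule Om_weight[OF t])
  show "norm (R t 0) \<le> C * (MM t)\<^sup>2" using trapped_R[OF assms, of 0] fw.Om_0 by simp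
  with CMM_le[OF t] show "norm (R t 0) \<le> xx t / (4 * real p)" by linarith
qed

text \<open>Squares are compared because the modulus of a mode need not be differentiable at a
  zero.\<close>

lemma bar_sq_has_derivative:
  assumes t: "t \<in> {0..<T}"
  shows "((\<lambda>s. (bar s q)\<^sup>2) has_real_derivative
     2 * (bar t q)\<^sup>2 * (K t ^ (p + 1) * (- (\<beta> / real p) + xx t / real p - xx t * mu q / (2 * real p)))) (at t within {0..<T})"
proof -
  have x: "(xx has_real_derivative - (K t ^ (p + 1) / real p * xx t)) (at t within {0..<T})"
    unfolding xx_def[abs_def] using p0
    by (auto intro!: derivative_eq_intros sg_has_derivative[OF t] simp: field_simps)
  have "((\<lambda>s. ee s q) has_real_derivative
     (K t ^ (p + 1) * (- (\<beta> / real p) + xx t / real p - xx t * mu q / (2 * real p)))) (at t within {0..<T})"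
    unfolding ee_def[abs_def] using p0
    by (auto intro!: derivative_eq_intros sg_has_derivative[OF t] x simp: field_simps)
  then have "((\<lambda>s. (a * exp (ee s q))\<^sup>2) has_real_derivative
     2 * (a * exp (ee t q))\<^sup>2 * (K t ^ (p + 1) * (- (\<beta> / real p) + xx t / real p - xx t * mu q / (2 * real p)))) (at t within {0..<T})" for a
    by (auto intro!: derivative_eq_intros simp: power2_eq_square mult_ac)
  then show ?thesis
    unfolding bar_def[abs_def] .
qed

text \<open>On the boundary of the region the dissipation \<open>\<lambda>\<^sup>2q\<^sup>2\<close> strictly beats the quadratic terms together
  with the shrinking of the barrier.\<close>

lemma exit_impossible:
  assumes t: "t \<in> {0..<T}" and tr: "trapped t" and q: "q \<noteq> 0" and touch: "norm (z t q) = bar t q"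
  defines "F \<equiv> of_real (K t ^ (p + 1)) *
     (of_real (- (lam\<^sup>2 * (of_int q)\<^sup>2) + (p + 1) / real p) * z t q + R t q - z t q * R t 0)"
  shows "2 * Re (cnj (z t q) * F) <
    2 * (bar t q)\<^sup>2 * (K t ^ (p + 1) * (- (\<beta> / real p) + xx t / real p - xx t * mu q / (2 * real p)))"
proof -
  interpret fw: fourier_weight lam "Om t" by (rule Om_weight[OF t])
  define B where "B = bar t q"
  define Q where "Q = (real_of_int q)\<^sup>2"
  have B: "0 < B" using bar_pos[OF q] by (simp add: B_def)
  have "1 \<le> \<bar>real_of_int q\<bar>" using q by auto
  from power_mono[OF this, of 2] have Q1: "1 \<le> Q" by (simp add: Q_def)
  have muQ: "mu q \<le> Q"
  proof -
    have "\<bar>real_of_int q\<bar> * 1 \<le> \<bar>real_of_int q\<bar> * \<bar>real_of_int q\<bar>"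
      using q by (intro mult_left_mono) auto
    then show ?thesis using mu_bounds(2)[of q] by (simp add: Q_def power2_eq_square)
  qed
  have x: "0 < xx t" "xx t \<le> 1" using xx_bounds[OF t] by auto
  have zz: "cnj (z t q) * z t q = of_real (B\<^sup>2)"
    using touch by (simp add: B_def complex_norm_square[symmetric] mult.commute flip: of_real_power)
  define D where "D = - (lam\<^sup>2 * Q) + (p + 1) / real p"
  have "cnj (z t q) * F = of_real (K t ^ (p + 1)) *
      (of_real D * (cnj (z t q) * z t q) + cnj (z t q) * R t q - (cnj (z t q) * z t q) * R t 0)"
    by (simp add: F_def D_def Q_def algebra_simps)
  then have e: "Re (cnj (z t q) * F) = K t ^ (p + 1) * (D * B\<^sup>2 + Re (cnj (z t q) * R t q) - B\<^sup>2 * Re (R t 0))"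
    unfolding zz by (simp add: Re_complex_of_real flip: of_real_power of_real_mult)
  have "Re (cnj (z t q) * R t q) \<le> B * norm (R t q)"
    using complex_Re_le_cmod[of "cnj (z t q) * R t q"] touch by (simp add: norm_mult B_def)
  also have "\<dots> \<le> B * (C * MM t * Q * B)"
  proof (rule mult_left_mono)
    have "norm (R t q) \<le> C * (MM t)\<^sup>2 / Om t q"
      using trapped_R[OF t tr, of q] fw.Om_pos[of q] by (simp add: field_simps)
    \<comment> \<open>One of the two factors \<open>MM t\<close>, divided by \<open>Om t q\<close>,
      equals \<open>Q * B\<close>. The quadratic term thus becomes comparable to the dissipation,
      which also carries the factor \<open>Q\<close>.\<close>
    also have "\<dots> = C * MM t * Q * B"
      using q fw.Om_pos[of q] by (simp add: B_def bar_MM Q_def power2_eq_square)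
    finally show "norm (R t q) \<le> C * MM t * Q * B" .
  qed (use B in simp)
  finally have 1: "Re (cnj (z t q) * R t q) \<le> B\<^sup>2 * (C * MM t * Q)" by (simp add: power2_eq_square mult_ac)
  have "- Re (R t 0) \<le> norm (R t 0)" using abs_Re_le_cmod[of "R t 0"] by simp
  also have "\<dots> \<le> C * MM t" using trapped_R_0(1)[OF t tr] CMM_le(2)[OF t] by simp
  also have "\<dots> \<le> C * MM t * Q" using Q1 C1 MM_le(1)[OF t] mult_left_mono[of 1 Q "C * MM t"] by simp
  finally have 2: "B\<^sup>2 * (- Re (R t 0)) \<le> B\<^sup>2 * (C * MM t * Q)" by (intro mult_left_mono) auto
  \<comment> \<open>The balance of rates. The spare dissipation \<open>lam\<^sup>2 * (Q - 1)\<close>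
    vanishes for the first modes. The nonlinear terms cost strictly less than, and the weight at
    most, \<open>xx * Q / (2 * p)\<close>. Their sum stays below \<open>xx * Q / p\<close>, which is
    the bonus \<open>xx / p\<close> plus \<open>xx / p * (Q - 1)\<close>, and the latter is at most
    the spare dissipation.\<close>
  have main: "D + 2 * (C * MM t * Q) < - (\<beta> / real p) + xx t / real p - xx t * mu q / (2 * real p)"
  proof -
    have "C * MM t * Q \<le> xx t / (4 * real p * (\<beta> + 4)) * Q"
      using CMM_le(1)[OF t] Q1 by (intro mult_right_mono) auto
    also have "xx t / (4 * real p * (\<beta> + 4)) < xx t / (4 * real p * 1)"
      using x p0 beta1 by (intro divide_strict_left_mono mult_strict_left_mono) auto
    finally have "C * MM t * Q < xx t / (4 * real p) * Q" using Q1 by (simp add: mult_strict_right_mono)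
    then have a: "2 * (C * MM t * Q) < xx t * Q / (2 * real p)" by (simp add: field_simps)
    have b: "xx t * mu q / (2 * real p) \<le> xx t * Q / (2 * real p)"
      using muQ x p0 by (intro divide_right_mono mult_left_mono) auto
    have "\<beta> / real p = lam\<^sup>2 - (p + 1) / real p"
      using p0 by (simp add: decay_rate_eq[OF p1] field_simps)
    then have c: "- (\<beta> / real p) - D = lam\<^sup>2 * (Q - 1)" by (simp add: D_def algebra_simps)
    have "1 / real p \<le> lam\<^sup>2" using beta1 p0 by (simp add: decay_rate_eq[OF p1] field_simps)
    moreover have "xx t / real p \<le> 1 / real p" using x p0 by (simp add: divide_right_mono)
    ultimately have "xx t / real p * (Q - 1) \<le> lam\<^sup>2 * (Q - 1)"
      using Q1 by (intro mult_right_mono) auto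
    moreover have "xx t / real p * (Q - 1) = xx t * Q / real p - xx t / real p"
      by (simp add: right_diff_distrib)
    moreover have "xx t * Q / real p = 2 * (xx t * Q / (2 * real p))" by simp
    ultimately show ?thesis using a b c by linarith
  qed
  have "D * B\<^sup>2 + Re (cnj (z t q) * R t q) - B\<^sup>2 * Re (R t 0) \<le> B\<^sup>2 * (D + 2 * (C * MM t * Q))"
    using 1 2 by (simp add: algebra_simps)
  also have "\<dots> < B\<^sup>2 * (- (\<beta> / real p) + xx t / real p - xx t * mu q / (2 * real p))"
    using main B by (intro mult_strict_left_mono) auto
  finally have "K t ^ (p + 1) * (D * B\<^sup>2 + Re (cnj (z t q) * R t q) - B\<^sup>2 * Re (R t 0)) <
      K t ^ (p + 1) * (B\<^sup>2 * (- (\<beta> / real p) + xx t / real p - xx t * mu q / (2 * real p)))"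
    using K_pos[OF t] by (intro mult_strict_left_mono) auto
  then show ?thesis unfolding e B_def by (simp add: mult_ac)
qed

text \<open>On \<open>{0..b}\<close> the derivative of order \<open>r + 3\<close> is bounded, so the
  modes are \<open>O(1 / |q| ^ (r + 3))\<close>, while the barrier is at least of order
  \<open>1 / |q| ^ (r + 2)\<close>. The spare power of \<open>|q|\<close> decides, uniformly in
  time.\<close>

lemma high_modes:
  assumes b: "b \<in> {0..<T}"
  obtains Q where "\<And>t q. t \<in> {0..b} \<Longrightarrow> Q < \<bar>real_of_int q\<bar> \<Longrightarrow> norm (z t q) < bar t q"
proof -
  have sub: "{0..b} \<subseteq> {0..<T}" using b by auto
  have "compact ((\<lambda>(t, x). kk (r + 3) t x) ` ({0..b} \<times> {0..L}))"
    by (intro compact_continuous_image continuous_on_subset[OF cont] compact_Times) (use sub in auto)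
  from compact_imp_bounded[OF this] obtain B where B0: "B > 0"
    "\<forall>u \<in> (\<lambda>(t, x). kk (r + 3) t x) ` ({0..b} \<times> {0..L}). norm u \<le> B"
    unfolding bounded_pos by blast
  have B: "B > 0" "\<And>t x. t \<in> {0..b} \<Longrightarrow> x \<in> {0..L} \<Longrightarrow> \<bar>kk (r + 3) t x\<bar> \<le> B"
    using B0 by auto
  have ne: "{0..b} \<noteq> {}" using b by auto
  obtain t1 where t1: "t1 \<in> {0..b}" "\<And>t. t \<in> {0..b} \<Longrightarrow> K t1 \<le> K t"
    using continuous_attains_inf[OF compact_Icc ne continuous_on_subset[OF K_cont sub]] by auto
  obtain t2 where t2: "t2 \<in> {0..b}" "\<And>t. t \<in> {0..b} \<Longrightarrow> sg t \<le> sg t2"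
    using continuous_attains_sup[OF compact_Icc ne continuous_on_subset[OF sg_cont sub]] by auto
  have K1: "0 < K t1" using K_pos t1 sub by auto
  have c0: "0 < c" using G_growth[of 0] G_ge_1[of 0] by simp
  \<comment> \<open>A lower bound for \<open>M0 * exp (ee t q)\<close> over all times up to
    \<open>b\<close> and all modes; the term \<open>N / 2\<close> is where the truncation of
    \<open>mu\<close> is essential.\<close>
  define e0 where "e0 = M0 * exp (- (\<beta> / real p) * sg t2 - N / 2)"
  have e0: "0 < e0" using M0_pos by (simp add: e0_def)
  define D where "D = c * 2 ^ r * B / (K t1 * lam ^ (r + 3))"
  show thesis
  proof (rule that)
    fix t q assume t: "t \<in> {0..b}" and q: "max 1 (D / e0) < \<bar>real_of_int q\<bar>"
    have tT: "t \<in> {0..<T}" using t sub by auto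
    define a where "a = \<bar>real_of_int q\<bar>"
    have a: "1 < a" "D < e0 * a" "q \<noteq> 0" using q e0 by (auto simp: a_def field_simps)
    have "norm (fco lam (\<lambda>x. complex_of_real (kk (r + 3) t x)) q) \<le> B"
      by (rule norm_fco_le[OF lam]) (use B(2)[OF t] cont_x[OF tT] in \<open>auto intro!: continuous_intros\<close>)
    then have "(lam * a) ^ (r + 3) * norm (y t q) \<le> B"
      unfolding fco_kk[OF tT] using lam by (simp add: norm_mult norm_power a_def abs_mult)
    then have le: "norm (y t q) \<le> B / (lam * a) ^ (r + 3)"
      using lam a by (simp add: field_simps)
    have "norm (z t q) \<le> B / (lam * a) ^ (r + 3) / K t1"
    proof -
      have "norm (z t q) = norm (y t q) / K t" using a K_pos[OF tT] by (simp add: z_def norm_divide)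
      also have "\<dots> \<le> B / (lam * a) ^ (r + 3) / K t1"
        by (rule frac_le) (use le t1(2)[OF t] K1 B(1) lam a in auto)
      finally show ?thesis .
    qed
    then have "a\<^sup>2 * G q * norm (z t q) \<le> a\<^sup>2 * (c * (2 * a) ^ r) * (B / (lam * a) ^ (r + 3) / K t1)"
    proof (intro mult_mono)
      have "G q \<le> c * (1 + a) ^ r" using G_growth by (simp add: a_def)
      also have "\<dots> \<le> c * (2 * a) ^ r" using a c0 by (intro mult_left_mono power_mono) auto
      finally show "G q \<le> c * (2 * a) ^ r" .
    qed (use a c0 G_pos[of q] in \<open>auto simp: less_imp_le\<close>)
    also have "\<dots> = D / a"
      using a lam K1 by (simp add: D_def power_mult_distrib power_add field_simps eval_nat_numeral)
    also have "\<dots> < e0" using a by (simp add: field_simps)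
    finally have "a\<^sup>2 * G q * norm (z t q) < e0" .
    then have "norm (z t q) < e0 / (a\<^sup>2 * G q)" using a G_pos[of q] by (simp add: field_simps)
    also have "\<dots> \<le> bar t q"
    proof -
      have x: "0 < xx t" "xx t \<le> 1" using xx_bounds[OF tT] by auto
      have "(1 - xx t) * mu q \<le> 1 * N" using x mu_bounds by (intro mult_mono) auto
      moreover have "\<beta> / real p * sg t \<le> \<beta> / real p * sg t2"
        using t2(2)[OF t] beta1 p0 by (intro mult_left_mono) auto
      ultimately have "- (\<beta> / real p) * sg t2 - N / 2 \<le> ee t q" using x by (simp add: ee_def)
      then have "e0 \<le> M0 * exp (ee t q)" using M0_pos by (simp add: e0_def)
      then show ?thesis using a G_pos[of q] by (simp add: bar_def a_def divide_right_mono)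
    qed
    finally show "norm (z t q) < bar t q" .
  qed
qed

lemma z_cont: "q \<noteq> 0 \<Longrightarrow> continuous_on {0..<T} (\<lambda>t. z t q)"
  using z_has_derivative by (meson has_vector_derivative_continuous continuous_on_eq_continuous_within)

text \<open>At a first contact all modes, high and low, still satisfy the closed bounds, so
  \<open>exit_impossible\<close> applies to the touching mode.\<close>

theorem trapping:
  assumes t: "t \<in> {0..<T}"
  shows "trapped t"
proof (rule ccontr)
  assume "\<not> trapped t"
  then obtain q0 where q0: "q0 \<noteq> 0" "bar t q0 < norm (z t q0)" by (auto simp: trapped_def)
  obtain Q where Q: "\<And>s q. s \<in> {0..t} \<Longrightarrow> Q < \<bar>real_of_int q\<bar> \<Longrightarrow> norm (z s q) < bar s q"
    using high_modes[OF t] by metis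
  define QQ where "QQ = {q :: int. q \<noteq> 0 \<and> \<bar>real_of_int q\<bar> \<le> Q}"
  have fin: "finite QQ"
  proof (rule finite_subset)
    show "QQ \<subseteq> {- \<lceil>Q\<rceil>..\<lceil>Q\<rceil>}" by (auto simp: QQ_def abs_le_iff) linarith+
  qed simp
  define f where "f q s = (norm (z s q))\<^sup>2 - (bar s q)\<^sup>2" for q s
  have sub: "{0..t} \<subseteq> {0..<T}" using t by auto
  have bc: "continuous_on {0..<T} (\<lambda>s. (bar s q)\<^sup>2)" for q
    using bar_sq_has_derivative by (meson DERIV_continuous continuous_on_eq_continuous_within)
  have lt: "f q s < 0 \<longleftrightarrow> norm (z s q) < bar s q" if "q \<noteq> 0" for q s
    using bar_pos[OF that, of s] by (simp add: f_def abs_less_iff power_mono_iff less_le_not_le)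
  have le: "f q s \<le> 0 \<longleftrightarrow> norm (z s q) \<le> bar s q" if "q \<noteq> 0" for q s
    using bar_pos[OF that, of s] by (simp add: f_def power_mono_iff)
  have q0Q: "q0 \<in> QQ" using q0 Q[of t q0] t by (force simp: QQ_def)
  obtain s q where s: "0 < s" "s \<le> t" and q: "q \<in> QQ" "f q s = 0"
    and before: "\<And>j u. j \<in> QQ \<Longrightarrow> 0 \<le> u \<Longrightarrow> u < s \<Longrightarrow> f j u < 0"
    and at: "\<And>j. j \<in> QQ \<Longrightarrow> f j s \<le> 0"
  proof (rule first_exit_finite[OF fin, of t f q0 t])
    show "continuous_on {0..t} (f q)" if "q \<in> QQ" for q
      unfolding f_def using that
      by (intro continuous_on_diff[OF continuous_on_power[OF continuous_on_norm[OF continuous_on_subset[OF z_cont sub]]]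
            continuous_on_subset[OF bc sub]]) (simp add: QQ_def)
    show "f q 0 < 0" if "q \<in> QQ" for q
    proof -
      have qn: "q \<noteq> 0" using that by (simp add: QQ_def)
      have "ee 0 q = 0" by (simp add: ee_def sg_0 xx_def)
      then have "norm (z 0 q) < bar 0 q" using init[OF qn] G_pos[of q] qn by (simp add: bar_def field_simps)
      then show ?thesis using lt[OF qn] by simp
    qed
    show "0 \<le> f q0 t" using le[OF q0(1), of t] q0(2) by linarith
  qed (use q0Q t in auto)
  have sT: "s \<in> {0..<T}" using s t by auto
  have qn: "q \<noteq> 0" using q by (simp add: QQ_def)
  have tr: "trapped s"
    unfolding trapped_def
  proof (intro allI impI)
    fix j :: int assume j: "j \<noteq> 0"
    show "norm (z s j) \<le> bar s j"
    proof (cases "j \<in> QQ")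
      case True
      then show ?thesis using at[OF True] le[OF j, of s] by simp
    next
      case False
      then show ?thesis using Q[of s j] s j by (auto simp: QQ_def)
    qed
  qed
  have touch: "norm (z s q) = bar s q"
    using q(2) bar_pos[OF qn, of s] by (simp add: f_def power2_eq_iff_nonneg)
  define F where "F = of_real (K s ^ (p + 1)) *
     (of_real (- (lam\<^sup>2 * (of_int q)\<^sup>2) + (p + 1) / real p) * z s q + R s q - z s q * R s 0)"
  define d where "d = 2 * Re (cnj (z s q) * F) -
     2 * (bar s q)\<^sup>2 * (K s ^ (p + 1) * (- (\<beta> / real p) + xx s / real p - xx s * mu q / (2 * real p)))"
  have "d < 0" using exit_impossible[OF sT tr qn touch] by (simp add: d_def F_def)
  have zd: "((\<lambda>u. z u q) has_vector_derivative F) (at s within {0..<T})"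
    using z_has_derivative[OF sT qn] by (simp only: F_def)
  have "((\<lambda>u. (Re (z u q))\<^sup>2 + (Im (z u q))\<^sup>2) has_real_derivative 2 * Re (z s q) * Re F + 2 * Im (z s q) * Im F) (at s within {0..<T})"
  proof -
    have "((\<lambda>u. (a u)\<^sup>2 + (b u)\<^sup>2) has_real_derivative 2 * a s * a' + 2 * b s * b') S"
      if "(a has_real_derivative a') S" "(b has_real_derivative b') S" "S = at s within {0..<T}" for a b a' b' S
      using that by (auto intro!: derivative_eq_intros)
    from this[OF _ _ refl] show ?thesis
      using bounded_linear.has_vector_derivative[OF bounded_linear_Re zd] bounded_linear.has_vector_derivative[OF bounded_linear_Im zd]
      by (simp add: has_real_derivative_iff_has_vector_derivative)
  qed
  then have "((\<lambda>u. (norm (z u q))\<^sup>2) has_real_derivative 2 * Re (cnj (z s q) * F)) (at s within {0..<T})"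
    by (simp add: cmod_power2 algebra_simps)
  then have "(f q has_real_derivative d) (at s within {0..<T})"
    unfolding f_def[abs_def] d_def by (intro DERIV_diff bar_sq_has_derivative[OF sT])
  \<comment> \<open>A negative derivative at the contact, where \<open>f q s = 0\<close>, makes
    \<open>f q\<close> positive shortly before, against the choice of \<open>s\<close>.\<close>
  from has_real_derivative_neg_dec_left[OF this \<open>d < 0\<close>]
  obtain h where h: "h > 0" "\<And>u. 0 < u \<Longrightarrow> s - u \<in> {0..<T} \<Longrightarrow> u < h \<Longrightarrow> f q s < f q (s - u)" by blast
  define u where "u = min (h / 2) (s / 2)"
  have "0 < u" "u < h" "u < s" using h(1) s(1) by (auto simp: u_def)
  then have "f q s < f q (s - u)" using sT by (intro h(2)) auto
  moreover have "f q (s - u) < 0" using \<open>0 < u\<close> \<open>u < s\<close> by (intro before[OF q(1)]) auto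
  ultimately show False using q(2) by simp
qed

end

section \<open>One-variable calculus for the maximum principle\<close>

lemma deriv_nonneg_at_left_max:
  fixes f :: "real \<Rightarrow> real"
  assumes "(f has_real_derivative d) (at t within {0..<T})" "0 < t" "t < T"
    and "\<And>s. 0 \<le> s \<Longrightarrow> s < t \<Longrightarrow> f s \<le> f t"
  shows "0 \<le> d"
proof (rule ccontr)
  assume "\<not> 0 \<le> d"
  then obtain h where h: "h > 0" "\<And>u. 0 < u \<Longrightarrow> t - u \<in> {0..<T} \<Longrightarrow> u < h \<Longrightarrow> f t < f (t - u)"
    using has_real_derivative_neg_dec_left[OF assms(1)] by force
  define u where "u = min (h / 2) (t / 2)"
  have u: "0 < u" "u < h" "u < t" using h(1) assms by (auto simp: u_def)
  then have "f t < f (t - u)" using assms by (intro h(2)) auto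
  with assms(4)[of "t - u"] u show False by simp
qed

lemma second_deriv_nonpos_at_max:
  fixes f :: "real \<Rightarrow> real"
  assumes d1: "\<And>x. (f has_real_derivative f1 x) (at x)" and d2: "(f1 has_real_derivative d) (at a)"
    and max: "\<And>x. f x \<le> f a"
  shows "f1 a = 0" "d \<le> 0"
proof -
  show z: "f1 a = 0"
    by (rule DERIV_local_max[OF d1[of a], of 1]) (use max in auto)
  show "d \<le> 0"
  proof (rule ccontr)
    assume "\<not> d \<le> 0"
    then obtain h where h: "h > 0" "\<And>u. 0 < u \<Longrightarrow> u < h \<Longrightarrow> f1 a < f1 (a + u)"
      using DERIV_pos_inc_right[OF d2] by force
    obtain \<xi> where \<xi>: "a < \<xi>" "\<xi> < a + h / 2" "f (a + h / 2) - f a = (a + h / 2 - a) * f1 \<xi>"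
      using MVT2[of a "a + h / 2" f f1] d1 h(1) by auto
    have "0 < f1 \<xi>" using h(2)[of "\<xi> - a"] \<xi> z h(1) by auto
    then have "0 < (a + h / 2 - a) * f1 \<xi>" using h(1) by simp
    with \<xi>(3) max[of "a + h / 2"] show False by simp
  qed
qed

lemma nonincreasing_from_deriv:
  fixes f :: "real \<Rightarrow> real"
  assumes "\<And>t. t \<in> {0..<T} \<Longrightarrow> (f has_real_derivative f' t) (at t within {0..<T})"
    and "\<And>t. t \<in> {0..<T} \<Longrightarrow> f' t \<le> 0" and "0 \<le> a" "a \<le> b" "b < T"
  shows "f b \<le> f a"
proof -
  have "(f has_derivative (*) (f' t)) (at t within {a..b})" if "a \<le> t" "t \<le> b" for t
    using has_field_derivative_subset[OF assms(1), of t "{a..b}"] that assms(3-5)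
    by (simp add: has_field_derivative_def subset_iff)
  from mvt_very_simple[OF assms(4) this] obtain x where "x \<in> {a..b}" "f b - f a = f' x * (b - a)" by auto
  moreover have "f' x * (b - a) \<le> 0"
    using assms calculation(1) by (intro mult_nonpos_nonneg) auto
  ultimately show ?thesis by simp
qed

lemma power_diff_le:
  fixes a b B :: real
  assumes "0 \<le> b" "b \<le> a" "a \<le> B" "1 \<le> B"
  shows "a ^ j - b ^ j \<le> real j * B ^ j * (a - b)"
proof (induction j)
  case (Suc j)
  have "a * (a ^ j - b ^ j) \<le> B * (real j * B ^ j * (a - b))"
    using assms Suc by (intro mult_mono) (auto intro!: power_mono)
  moreover have "(a - b) * b ^ j \<le> (a - b) * B ^ Suc j"
  proof (rule mult_left_mono)
    have "b ^ j \<le> B ^ j" using assms by (intro power_mono) auto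
    also have "\<dots> \<le> B ^ Suc j" using assms by (intro power_increasing) auto
    finally show "b ^ j \<le> B ^ Suc j" .
  qed (use assms in simp)
  ultimately show ?case by (simp add: algebra_simps)
qed simp

subsection \<open>Propagation of a symmetry of the initial curvature\<close>

text \<open>The shifted curvature solves the same equation with the same initial values. The
  comparison only yields that a shift by \<open>l\<close> does not increase the value, but
  \<open>n\<close> shifts make up the full period \<open>P\<close>, so equality holds
  throughout.\<close>

lemma curvature_symmetry:
  fixes kk :: "nat \<Rightarrow> real \<Rightarrow> real \<Rightarrow> real" and P l :: real
  assumes cont: "\<And>j. continuous_on ({0..<T} \<times> UNIV) (\<lambda>(t, x). kk j t x)"
    and dx: "\<And>j t x. t \<in> {0..<T} \<Longrightarrow> (kk j t has_real_derivative kk (Suc j) t x) (at x)"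
    and per: "\<And>t x. t \<in> {0..<T} \<Longrightarrow> kk 0 t (x + P) = kk 0 t x"
    and pos: "\<And>t x. t \<in> {0..<T} \<Longrightarrow> 0 < kk 0 t x"
    and dt: "\<And>t x. t \<in> {0..<T} \<Longrightarrow> ((\<lambda>s. kk 0 s x) has_real_derivative
        kk 0 t x ^ (p + 1) * kk 2 t x + real (p - 1) * (kk 0 t x ^ p * (kk 1 t x)\<^sup>2) + kk 0 t x ^ (p + 2) / real p)
        (at t within {0..<T})"
    and init: "\<And>x. kk 0 0 (x + l) = kk 0 0 x"
    and n: "0 < n" "real n * l = P" and l: "0 < l" and p: "1 \<le> p" and t: "t \<in> {0..<T}"
  shows "kk 0 t (x + l) = kk 0 t x"
proof -
  have P: "0 < P" using n l by (metis mult_pos_pos of_nat_0_less_iff)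
  have le: "kk 0 b (a + l) \<le> kk 0 b a" if b: "b \<in> {0..<T}" for a b
  proof (rule ccontr)
    assume neg: "\<not> kk 0 b (a + l) \<le> kk 0 b a"
    have sub: "{0..b} \<subseteq> {0..<T}" using b by auto
    have "\<exists>B. \<forall>t x. t \<in> {0..b} \<longrightarrow> x \<in> {0..P + l} \<longrightarrow> \<bar>kk j t x\<bar> \<le> B" for j
    proof -
      have "compact ((\<lambda>(t, x). kk j t x) ` ({0..b} \<times> {0..P + l}))"
        by (intro compact_continuous_image continuous_on_subset[OF cont] compact_Times) (use sub in auto)
      from compact_imp_bounded[OF this] obtain B where
        "\<forall>u \<in> (\<lambda>(t, x). kk j t x) ` ({0..b} \<times> {0..P + l}). norm u \<le> B"
        unfolding bounded_iff by blast
      then show ?thesis by (intro exI[of _ B]) auto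
    qed
    then obtain Bf where Bf: "\<And>j t x. t \<in> {0..b} \<Longrightarrow> x \<in> {0..P + l} \<Longrightarrow> \<bar>kk j t x\<bar> \<le> Bf j" by metis
    define B where "B = max 1 (max (Bf 0) (max (Bf 1) (Bf 2)))"
    have B: "1 \<le> B" "\<And>t x. t \<in> {0..b} \<Longrightarrow> x \<in> {0..P + l} \<Longrightarrow> \<bar>kk 0 t x\<bar> \<le> B \<and> \<bar>kk 1 t x\<bar> \<le> B \<and> \<bar>kk 2 t x\<bar> \<le> B"
      using Bf unfolding B_def by (auto simp: le_max_iff_disj)
    \<comment> \<open>A Lipschitz constant of the right-hand side in the undifferentiated curvature,
      with both derivatives frozen.\<close>
    define C where "C = real (p + 1) * B ^ (p + 1) * B + real (p - 1) * (real p * B ^ p * B\<^sup>2) + real (p + 2) * B ^ (p + 2) / real p"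
    define W where "W t x = kk 0 t (x + l) - kk 0 t x" for t x
    \<comment> \<open>The exponent exceeds the Lipschitz constant by 1. At a positive maximum the
      first derivatives agree and the second derivatives have a favourable sign, so the damped
      difference would strictly decrease in time.\<close>
    define h where "h t x = exp (- ((C + 1) * t)) * W t x" for t x
    have Wper: "W t (x + P) = W t x" if "t \<in> {0..<T}" for t x
      using per[OF that, of "x + l"] per[OF that, of x] by (simp add: W_def algebra_simps)
    have red: "\<exists>y \<in> {0..P}. W t y = W t x" if "t \<in> {0..<T}" for t x
      using periodic_representative[of "W t" P x, OF Wper[OF that] P] by blast
    have contW: "continuous_on ({0..b} \<times> {0..P}) (\<lambda>(t, x). h t x)"
    proof -
      have c: "continuous_on ({0..b} \<times> {0..P}) (\<lambda>u. kk 0 (fst u) (g u))" if "continuous_on ({0..b} \<times> {0..P}) g" for g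
      proof -
        have "continuous_on ({0..b} \<times> {0..P}) (\<lambda>u. (\<lambda>v. kk 0 (fst v) (snd v)) (fst u, g u))"
          by (rule continuous_on_compose2[OF cont[of 0, unfolded case_prod_unfold]])
             (use that sub in \<open>auto intro!: continuous_intros\<close>)
        then show ?thesis by simp
      qed
      show ?thesis
        unfolding h_def W_def case_prod_unfold by (intro continuous_intros c)
    qed
    obtain ts xs where ts: "ts \<in> {0..b}" "xs \<in> {0..P}" and
      max: "\<And>t x. t \<in> {0..b} \<Longrightarrow> x \<in> {0..P} \<Longrightarrow> h t x \<le> h ts xs"
      using continuous_attains_sup[OF compact_Times[OF compact_Icc[of 0 b] compact_Icc[of 0 P]] _ contW] b P by force
    have tsT: "ts \<in> {0..<T}" using ts sub by auto
    have hpos: "0 < h ts xs"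
    proof -
      obtain y where y: "y \<in> {0..P}" "W b y = W b a" using red[OF b] by blast
      have "0 < h b y" using neg y by (simp add: h_def W_def)
      also have "\<dots> \<le> h ts xs" using y b by (intro max) auto
      finally show ?thesis .
    qed
    then have Wpos: "0 < W ts xs" by (simp add: h_def zero_less_mult_iff)
    have ts0: "0 < ts"
    proof (rule ccontr)
      assume "\<not> 0 < ts"
      then have "ts = 0" using ts by simp
      with Wpos init show False by (simp add: W_def)
    qed
    have Wmax: "W ts x \<le> W ts xs" for x
    proof -
      obtain y where y: "y \<in> {0..P}" "W ts y = W ts x" using red[OF tsT] by blast
      then show ?thesis using max[OF ts(1) y(1)] by (simp add: h_def)
    qed
    have shift: "((\<lambda>x. kk j ts (x + l)) has_real_derivative kk (Suc j) ts (x + l)) (at x)" for j x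
      using dx[OF tsT, of j "x + l"] by (subst (asm) DERIV_shift)
    have W1: "(W ts has_real_derivative kk 1 ts (x + l) - kk 1 ts x) (at x)" for x
      unfolding W_def[abs_def] using DERIV_diff[OF shift[of 0] dx[OF tsT, of 0]] by simp
    have W2: "((\<lambda>x. kk 1 ts (x + l) - kk 1 ts x) has_real_derivative kk 2 ts (xs + l) - kk 2 ts xs) (at xs)"
      using DERIV_diff[OF shift[of 1] dx[OF tsT, of 1]] by (simp add: numeral_2_eq_2)
    note mx = second_deriv_nonpos_at_max[OF W1 W2 Wmax]
    define k1 where "k1 = kk 0 ts (xs + l)"
    define k2 where "k2 = kk 0 ts xs"
    define P1 where "P1 = kk 1 ts xs"
    define Q1 where "Q1 = kk 2 ts (xs + l)"
    define Q2 where "Q2 = kk 2 ts xs"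
    have in1: "xs \<in> {0..P + l}" "xs + l \<in> {0..P + l}" using ts l by auto
    have bd: "0 < k2" "k2 < k1" "k1 \<le> B" "\<bar>P1\<bar> \<le> B" "\<bar>Q2\<bar> \<le> B" "Q1 \<le> Q2" "kk 1 ts (xs + l) = P1"
      using pos[OF tsT, of xs] Wpos B(2)[OF ts(1) in1(1)] B(2)[OF ts(1) in1(2)] mx
      by (auto simp: k1_def k2_def P1_def Q1_def Q2_def W_def)
    have lip: "k1 ^ j - k2 ^ j \<le> real j * B ^ j * (k1 - k2)" "0 \<le> k1 ^ j - k2 ^ j" for j
      using power_diff_le[of k2 k1 B j] bd B(1) by (auto intro!: power_mono)
    define Wt where "Wt = (k1 ^ (p + 1) * Q1 + real (p - 1) * (k1 ^ p * P1\<^sup>2) + k1 ^ (p + 2) / real p)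
       - (k2 ^ (p + 1) * Q2 + real (p - 1) * (k2 ^ p * P1\<^sup>2) + k2 ^ (p + 2) / real p)"
    have "((\<lambda>s. W s xs) has_real_derivative Wt) (at ts within {0..<T})"
      using DERIV_diff[OF dt[OF tsT, of "xs + l"] dt[OF tsT, of xs]] bd(7)
      by (simp add: W_def Wt_def k1_def k2_def P1_def Q1_def Q2_def)
    then have "((\<lambda>s. h s xs) has_real_derivative exp (- ((C + 1) * ts)) * (Wt - (C + 1) * W ts xs)) (at ts within {0..<T})"
      unfolding h_def by (auto intro!: derivative_eq_intros simp: algebra_simps)
    then have "0 \<le> exp (- ((C + 1) * ts)) * (Wt - (C + 1) * W ts xs)"
      by (rule deriv_nonneg_at_left_max) (use ts0 tsT ts max in auto)
    then have ge: "(C + 1) * (k1 - k2) \<le> Wt"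
      by (simp add: zero_le_mult_iff W_def k1_def k2_def)
    have "k1 ^ (p + 1) * Q1 \<le> k1 ^ (p + 1) * Q2" using bd by (intro mult_left_mono) auto
    moreover have "(k1 ^ (p + 1) - k2 ^ (p + 1)) * Q2 \<le> (real (p + 1) * B ^ (p + 1) * (k1 - k2)) * B"
      using lip[of "p + 1"] bd B(1)
      by (intro order_trans[OF mult_left_mono[of Q2 B]] mult_right_mono) auto
    ultimately have i1: "k1 ^ (p + 1) * Q1 - k2 ^ (p + 1) * Q2 \<le> (real (p + 1) * B ^ (p + 1) * (k1 - k2)) * B"
      by (simp only: left_diff_distrib)
    have "P1\<^sup>2 \<le> B\<^sup>2" using bd(4) by (simp add: abs_le_square_iff[symmetric])
    then have "(k1 ^ p - k2 ^ p) * P1\<^sup>2 \<le> (real p * B ^ p * (k1 - k2)) * B\<^sup>2"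
      using lip[of p] bd B(1) by (intro mult_mono) auto
    then have i2: "real (p - 1) * (k1 ^ p * P1\<^sup>2) - real (p - 1) * (k2 ^ p * P1\<^sup>2) \<le> real (p - 1) * ((real p * B ^ p * (k1 - k2)) * B\<^sup>2)"
      by (simp only: right_diff_distrib[symmetric] left_diff_distrib[symmetric]) (intro mult_left_mono, auto)
    have i3: "k1 ^ (p + 2) / real p - k2 ^ (p + 2) / real p \<le> (real (p + 2) * B ^ (p + 2) * (k1 - k2)) / real p"
      using lip(1)[of "p + 2"] by (simp only: diff_divide_distrib[symmetric]) (intro divide_right_mono, auto)
    have "Wt \<le> C * (k1 - k2)"
      using i1 i2 i3 by (simp add: Wt_def C_def algebra_simps)
    with ge bd(2) show False by (simp add: algebra_simps)
  qed
  have dec: "kk 0 t (a + real j * l) \<le> kk 0 t a" for a j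
  proof (induction j)
    case (Suc j)
    have "kk 0 t (a + real (Suc j) * l) = kk 0 t ((a + real j * l) + l)" by (simp add: algebra_simps)
    with le[OF t, of "a + real j * l"] Suc show ?case by simp
  qed simp
  have "kk 0 t x = kk 0 t ((x + l) + real (n - 1) * l)"
  proof -
    have "(x + l) + real (n - 1) * l = x + P" using n by (simp add: of_nat_diff algebra_simps)
    then show ?thesis using per[OF t, of x] by (simp only:)
  qed
  with dec[of "x + l" "n - 1"] le[OF t, of x] show ?thesis by simp
qed

subsection \<open>Decay estimates\<close>

context curvature_trap
begin

lemma Re_R_0_bound:
  assumes t: "t \<in> {0..<T}"
  shows "\<bar>Re (R t 0)\<bar> \<le> xx t / (4 * real p)"
  using trapped_R_0(2)[OF t trapping[OF t]] abs_Re_le_cmod[of "R t 0"] by linarith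

text \<open>\<open>ln K - sg / p + xx\<close> is non-increasing: its derivative is
  \<open>K ^ (p + 1)\<close> times \<open>Re (R t 0) - xx / p\<close>. The deviation from a round
  circle is therefore paid by the total variation of \<open>xx\<close>, at most 1, which produces
  the factor \<open>exp 1\<close>.\<close>

lemma ln_K_bound:
  assumes t: "t \<in> {0..<T}"
  shows "xx t \<le> exp 1 * K 0 / K t"
proof -
  have T0: "0 \<in> {0..<T}" using T by simp
  have "ln (K t) - sg t / real p + xx t \<le> ln (K 0) - sg 0 / real p + xx 0"
  proof (rule nonincreasing_from_deriv[where f="\<lambda>s. ln (K s) - sg s / real p + xx s" and T=T and f'="\<lambda>s.
      K s ^ (p + 1) * (1 / real p + Re (R s 0)) - K s ^ (p + 1) / real p + - (K s ^ (p + 1) / real p * xx s)"])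
    fix s assume s: "s \<in> {0..<T}"
    have x: "(xx has_real_derivative - (K s ^ (p + 1) / real p * xx s)) (at s within {0..<T})"
      unfolding xx_def[abs_def] using p0
      by (auto intro!: derivative_eq_intros sg_has_derivative[OF s] simp: field_simps)
    have l: "((\<lambda>s. ln (K s)) has_real_derivative (K s ^ (p + 1) * (1 / real p + Re (R s 0)))) (at s within {0..<T})"
      using K_pos[OF s] by (auto intro!: derivative_eq_intros K_has_derivative[OF s] simp: field_simps)
    show "((\<lambda>s. ln (K s) - sg s / real p + xx s) has_real_derivative
        K s ^ (p + 1) * (1 / real p + Re (R s 0)) - K s ^ (p + 1) / real p + - (K s ^ (p + 1) / real p * xx s)) (at s within {0..<T})"
      by (intro DERIV_add DERIV_diff l x DERIV_cdivide sg_has_derivative[OF s])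
    have "Re (R s 0) \<le> xx s / (4 * real p)" using Re_R_0_bound[OF s] by simp
    also have "\<dots> \<le> xx s / real p" using xx_bounds[OF s] p0 by (intro divide_left_mono) auto
    finally have "K s ^ (p + 1) * (Re (R s 0) - xx s / real p) \<le> 0"
      using K_pos[OF s] by (intro mult_nonneg_nonpos) auto
    then show "K s ^ (p + 1) * (1 / real p + Re (R s 0)) - K s ^ (p + 1) / real p + - (K s ^ (p + 1) / real p * xx s) \<le> 0"
      by (simp add: algebra_simps)
  qed (use t in auto)
  then have "ln (K t) - sg t / real p \<le> ln (K 0) + 1"
    using xx_bounds[OF t] xx_bounds[OF T0] by (simp add: sg_0)
  then have "exp (- (sg t / real p)) \<le> exp (ln (K 0) + 1 - ln (K t))" by simp
  also have "\<dots> = exp 1 * K 0 / K t"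
    using K_pos[OF t] K_pos[OF T0] by (simp add: exp_diff exp_add)
  finally show ?thesis by (simp add: xx_def)
qed

lemma z_decay:
  assumes t: "t \<in> {0..<T}" and q: "q \<noteq> 0"
  shows "norm (z t q) \<le> 3 * M0 * (exp 1 * K 0 / K t) powr \<beta> / ((of_int q)\<^sup>2 * G q)"
proof -
  have x: "0 < xx t" "xx t \<le> 1" using xx_bounds[OF t] by auto
  have "0 \<le> (1 - xx t) * mu q" using x mu_bounds(1)[of q] by (intro mult_nonneg_nonneg) auto
  then have "ee t q \<le> - (\<beta> / real p) * sg t + 1" using x unfolding ee_def by linarith
  then have "exp (ee t q) \<le> exp (- (\<beta> / real p) * sg t) * exp 1" by (simp add: exp_add[symmetric])
  also have "exp (- (\<beta> / real p) * sg t) = xx t powr \<beta>"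
    using p0 by (simp add: xx_def powr_def)
  also have "xx t powr \<beta> * exp 1 \<le> (exp 1 * K 0 / K t) powr \<beta> * 3"
    using ln_K_bound[OF t] x beta1 exp_le by (intro mult_mono powr_mono2) auto
  finally have "M0 * exp (ee t q) \<le> M0 * ((exp 1 * K 0 / K t) powr \<beta> * 3)"
    using M0_pos by (intro mult_left_mono) auto
  then have "bar t q \<le> M0 * ((exp 1 * K 0 / K t) powr \<beta> * 3) / ((of_int q)\<^sup>2 * G q)"
    using G_pos[of q] by (simp add: bar_def divide_right_mono)
  then show ?thesis
    using trapping[OF t] q unfolding trapped_def by (auto simp: mult_ac intro: order_trans)
qed

text \<open>The width of the strip of analyticity is proportional to \<open>1 - xx t\<close>; it is
  positive as soon as time has elapsed.\<close>

lemma xx_less_1: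
  assumes t: "t \<in> {0..<T}" "0 < t"
  shows "xx t < 1"
proof -
  have "(sg has_derivative (*) (K s ^ (p + 1))) (at s within {0..t})" if "0 \<le> s" "s \<le> t" for s
    using has_field_derivative_subset[OF sg_has_derivative, of s "{0..t}"] that t
    by (simp add: has_field_derivative_def subset_iff)
  from mvt_very_simple[OF _ this] t obtain s where s: "s \<in> {0..t}" "sg t - sg 0 = K s ^ (p + 1) * t" by auto
  have "0 < K s ^ (p + 1) * t" using s t by (intro mult_pos_pos zero_less_power K_pos) auto
  then have "0 < sg t" using s by (simp add: sg_0)
  then show ?thesis using p0 by (simp add: xx_def)
qed

lemma z_exp_decay:
  assumes t: "t \<in> {0..<T}" and q: "q \<noteq> 0"
  shows "norm (z t q) \<le> 3 * M0 * exp (- ((1 - xx t) / 2 * mu q))"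
proof -
  have x: "0 < xx t" "xx t \<le> 1" using xx_bounds[OF t] by auto
  have "0 \<le> \<beta> / real p * sg t" using beta1 p0 sg_nonneg[OF t] by auto
  then have "ee t q \<le> 1 + - ((1 - xx t) / 2 * mu q)" using x by (simp add: ee_def)
  then have "exp (ee t q) \<le> exp 1 * exp (- ((1 - xx t) / 2 * mu q))" by (simp only: exp_add[symmetric] exp_le_cancel_iff)
  also have "\<dots> \<le> 3 * exp (- ((1 - xx t) / 2 * mu q))" using exp_le by (intro mult_right_mono) auto
  finally have e: "exp (ee t q) \<le> 3 * exp (- ((1 - xx t) / 2 * mu q))" .
  have "1 \<le> \<bar>real_of_int q\<bar>" using q by auto
  from power_mono[OF this, of 2] have "1 \<le> (real_of_int q)\<^sup>2 * G q"
    using mult_mono[of 1 "(real_of_int q)\<^sup>2" 1 "G q"] G_ge_1[of q] by simp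
  then have "M0 / ((real_of_int q)\<^sup>2 * G q) \<le> M0" using M0_pos by (simp add: divide_le_eq mult_le_cancel_left1)
  with e have "bar t q \<le> M0 * (3 * exp (- ((1 - xx t) / 2 * mu q)))"
    unfolding bar_def using M0_pos by (intro mult_mono) auto
  with trapping[OF t] q show ?thesis unfolding trapped_def by (auto simp: mult_ac intro: order_trans)
qed

text \<open>The weight \<open>G\<close> pays for the \<open>j\<close> derivatives, and the remaining
  factor \<open>1 / q\<^sup>2\<close> is summed to \<open>zeta2\<close>.\<close>

lemma w_decay:
  assumes t: "t \<in> {0..<T}" and D: "\<And>q. \<bar>of_int q\<bar> ^ j \<le> D * G q"
  shows "norm (w j t x) \<le> lam ^ j * D * (3 * M0) * zeta2 * (exp 1 * K 0 / K t) powr \<beta>"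
proof -
  define c0 where "c0 = 3 * M0 * (exp 1 * K 0 / K t) powr \<beta>"
  have c0: "0 \<le> c0" using M0_pos by (simp add: c0_def)
  have h: "((\<lambda>q. (lam ^ j * D * c0) * (1 / (real_of_int q)\<^sup>2)) has_sum (lam ^ j * D * c0) * zeta2) UNIV"
    by (rule has_sum_cmult_right[OF zeta2_has_sum])
  have s: "((\<lambda>q. (\<i> * of_real (lam * of_int q)) ^ j * z t q * echar lam q x) has_sum w j t x) UNIV"
    by (rule fourier_rep_has_sum[OF rep_w[OF t]])
  have le: "norm ((\<i> * of_real (lam * of_int q)) ^ j * z t q * echar lam q x) \<le> (lam ^ j * D * c0) * (1 / (real_of_int q)\<^sup>2)" for q
  proof (cases "q = 0")
    case False
    have "norm ((\<i> * of_real (lam * of_int q)) ^ j * z t q * echar lam q x) = lam ^ j * \<bar>of_int q\<bar> ^ j * norm (z t q)"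
      using lam by (simp add: norm_mult norm_power abs_mult power_mult_distrib)
    also have "\<dots> \<le> lam ^ j * (D * G q) * (c0 / ((of_int q)\<^sup>2 * G q))"
    proof -
      have "0 \<le> D * G q" by (rule order_trans[OF _ D[of q]]) simp
      then show ?thesis using D[of q] z_decay[OF t False] lam by (intro mult_mono) (auto simp: c0_def)
    qed
    also have "\<dots> = (lam ^ j * D * c0) * (1 / (real_of_int q)\<^sup>2)"
      using G_pos[of q] by simp
    finally show ?thesis .
  qed (simp add: z_def)
  have "norm (w j t x) \<le> (lam ^ j * D * c0) * zeta2"
    by (rule norm_infsum_le[OF s h le])
  then show ?thesis by (simp add: c0_def mult_ac)
qed

text \<open>For a round circle this is exactly \<open>(p + 1) / p\<close> times the remaining time.
  In general its slope is a small perturbation of that constant, so it serves to estimate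
  \<open>T - t\<close>.\<close>

definition J :: "real \<Rightarrow> real" where "J t = inverse (K t ^ (p + 1))"

lemma J_pos: "t \<in> {0..<T} \<Longrightarrow> 0 < J t"
  using K_pos by (simp add: J_def)

lemma J_has_derivative:
  assumes t: "t \<in> {0..<T}"
  shows "(J has_real_derivative - (real (p + 1) * (1 / real p + Re (R t 0)))) (at t within {0..<T})"
proof -
  have K0: "K t \<noteq> 0" using K_pos[OF t] by simp
  have "((\<lambda>s. K s ^ (p + 1)) has_real_derivative real (p + 1) * (K t ^ (p + 2) * (1 / real p + Re (R t 0)) * K t ^ p)) (at t within {0..<T})"
    using DERIV_power[OF K_has_derivative[OF t], of "p + 1"] by simp
  from DERIV_inverse_fun[OF this] K0
  have "(J has_real_derivative - ((real (p + 1) * (K t ^ (p + 2) * (1 / real p + Re (R t 0)) * K t ^ p)) * inverse ((K t ^ (p + 1)) ^ Suc (Suc 0)))) (at t within {0..<T})"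
    unfolding J_def[abs_def] by auto
  moreover have "(real (p + 1) * (K t ^ (p + 2) * (1 / real p + Re (R t 0)) * K t ^ p)) * inverse ((K t ^ (p + 1)) ^ Suc (Suc 0))
     = real (p + 1) * (1 / real p + Re (R t 0))"
  proof -
    have "K t ^ (p + 2) * K t ^ p = (K t ^ (p + 1)) ^ Suc (Suc 0)" by (simp add: power_add[symmetric])
    then have 1: "(K t ^ (p + 2) * K t ^ p) * inverse ((K t ^ (p + 1)) ^ Suc (Suc 0)) = 1"
      by (simp only:) (rule right_inverse, use K0 in simp)
    have "(a * (b * c * d)) * e = a * c * ((b * d) * e)" for a b c d e :: real by (simp only: mult_ac)
    from this[of "real (p + 1)" "K t ^ (p + 2)" _ "K t ^ p"] 1 show ?thesis by (simp only: mult_1_right)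
  qed
  ultimately show ?thesis by (simp only:)
qed

lemma J_rate:
  assumes t: "t \<in> {0..<T}"
  shows "real (p + 1) / (2 * real p) \<le> real (p + 1) * (1 / real p + Re (R t 0))"
    "real (p + 1) * (1 / real p + Re (R t 0)) \<le> 2 * real (p + 1) / real p"
proof -
  have "xx t / (4 * real p) \<le> 1 / (4 * real p)" using xx_bounds[OF t] p0 by (intro divide_right_mono) auto
  then have a: "\<bar>Re (R t 0)\<bar> \<le> 1 / (4 * real p)" using Re_R_0_bound[OF t] by simp
  have b: "1 / (2 * real p) = 2 * (1 / (4 * real p))" "1 / real p = 4 * (1 / (4 * real p))" using p0 by simp_all
  have "0 < 1 / (4 * real p)" using p0 by simp
  with a b have "1 / (2 * real p) \<le> 1 / real p + Re (R t 0)" "1 / real p + Re (R t 0) \<le> 2 * (1 / real p)" by linarith+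
  from this[THEN mult_left_mono[OF _ of_nat_0_le_iff], of "p + 1"]
  have l: "real (p + 1) * (1 / (2 * real p)) \<le> real (p + 1) * (1 / real p + Re (R t 0))"
    "real (p + 1) * (1 / real p + Re (R t 0)) \<le> real (p + 1) * (2 * (1 / real p))" by blast+
  have "real (p + 1) * (1 / (2 * real p)) = real (p + 1) / (2 * real p)"
    "real (p + 1) * (2 * (1 / real p)) = 2 * real (p + 1) / real p" by simp_all
  with l show "real (p + 1) / (2 * real p) \<le> real (p + 1) * (1 / real p + Re (R t 0))"
    "real (p + 1) * (1 / real p + Re (R t 0)) \<le> 2 * real (p + 1) / real p" by (simp_all only:)
qed

lemma J_diff:
  assumes "0 \<le> s" "s \<le> t" "t < T"
  shows "real (p + 1) / (2 * real p) * (t - s) \<le> J s - J t" "J s - J t \<le> 2 * real (p + 1) / real p * (t - s)"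
proof -
  have "J t + real (p + 1) / (2 * real p) * t \<le> J s + real (p + 1) / (2 * real p) * s"
  proof (rule nonincreasing_from_deriv[OF _ _ assms])
    fix u assume u: "u \<in> {0..<T}"
    show "((\<lambda>u. J u + real (p + 1) / (2 * real p) * u) has_real_derivative
       - (real (p + 1) * (1 / real p + Re (R u 0))) + real (p + 1) / (2 * real p)) (at u within {0..<T})"
      by (intro DERIV_add J_has_derivative[OF u] DERIV_cmult_Id)
    show "- (real (p + 1) * (1 / real p + Re (R u 0))) + real (p + 1) / (2 * real p) \<le> 0"
      using J_rate[OF u] by simp
  qed
  then show "real (p + 1) / (2 * real p) * (t - s) \<le> J s - J t" by (simp add: right_diff_distrib)
  have "- J t + - (2 * real (p + 1) / real p) * t \<le> - J s + - (2 * real (p + 1) / real p) * s"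
  proof (rule nonincreasing_from_deriv[OF _ _ assms])
    fix u assume u: "u \<in> {0..<T}"
    show "((\<lambda>u. - J u + - (2 * real (p + 1) / real p) * u) has_real_derivative
       - (- (real (p + 1) * (1 / real p + Re (R u 0)))) + - (2 * real (p + 1) / real p)) (at u within {0..<T})"
      by (intro DERIV_add DERIV_minus J_has_derivative[OF u] DERIV_cmult_Id)
    show "- (- (real (p + 1) * (1 / real p + Re (R u 0)))) + - (2 * real (p + 1) / real p) \<le> 0"
      using J_rate[OF u] by simp
  qed
  then show "J s - J t \<le> 2 * real (p + 1) / real p * (t - s)" by (simp add: right_diff_distrib)
qed

lemma J_antimono:
  assumes "0 \<le> s" "s \<le> t" "t < T"
  shows "J t \<le> J s"
proof -
  have "0 \<le> real (p + 1) / (2 * real p) * (t - s)" using assms p0 by simp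
  with J_diff(1)[OF assms] show ?thesis by linarith
qed

text \<open>Pointwise control by the mean, so that a blow-up of the curvature becomes a blow-up of
  \<open>K\<close>. The bound of \<open>w_decay\<close> is used with \<open>j = 0\<close> and
  \<open>D = 1\<close>.\<close>

lemma kk_le_K:
  assumes t: "t \<in> {0..<T}"
  shows "kk 0 t x \<le> K t * (1 + 3 * M0 * zeta2 * (exp 1 * K 0 / K t) powr \<beta>)"
proof -
  have "norm (w 0 t x) \<le> lam ^ 0 * 1 * (3 * M0) * zeta2 * (exp 1 * K 0 / K t) powr \<beta>"
    by (rule w_decay[OF t]) (use G_ge_1 in auto)
  then have "\<bar>kk 0 t x / K t - 1\<bar> \<le> 3 * M0 * zeta2 * (exp 1 * K 0 / K t) powr \<beta>"
    unfolding w_def norm_of_real by simp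
  then have "kk 0 t x / K t \<le> 1 + 3 * M0 * zeta2 * (exp 1 * K 0 / K t) powr \<beta>" by linarith
  then show ?thesis using K_pos[OF t] by (simp add: pos_divide_le_eq mult.commute)
qed

section \<open>Consequences of blow-up at the time \<open>T\<close>\<close>

context
  assumes blow_up: "\<And>M. \<exists>t\<in>{0..<T}. \<exists>x. M < kk 0 t x"
begin

lemma J_small:
  assumes t1: "t1 \<in> {0..<T}" and e: "0 < e"
  obtains t where "t1 < t" "t < T" "J t < e"
proof -
  \<comment> \<open>The minimum with \<open>J t1\<close> ensures, as \<open>J\<close> is
    non-increasing, that the time found lies after \<open>t1\<close>.\<close>
  define e' where "e' = min e (J t1)"
  have e': "0 < e'" using e J_pos[OF t1] by (simp add: e'_def)
  define D where "D = 1 + 3 * M0 * zeta2 * exp 1 powr \<beta>"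
  have T0: "0 \<in> {0..<T}" using T by simp
  have D: "1 \<le> D" using M0_pos zeta2_pos by (simp add: D_def)
  obtain t x where t: "t \<in> {0..<T}" and big: "D * max 1 (1 / e') < kk 0 t x" using blow_up by blast
  have J0: "J t \<le> J 0" using J_antimono[of 0 t] t by simp
  have "K 0 \<le> K t"
  proof (rule power_le_imp_le_base)
    show "K 0 ^ Suc p \<le> K t ^ Suc p"
    proof -
      have "K 0 ^ (p + 1) \<le> K t ^ (p + 1)"
        using J0 K_pos[OF t] K_pos[OF T0] unfolding J_def
        by (subst (asm) inverse_le_iff_le) (auto intro: zero_less_power mult_pos_pos)
      then show ?thesis by simp
    qed
  qed (use K_pos[OF t] in simp)
  then have "exp 1 * K 0 / K t \<le> exp 1" using K_pos[OF t] by (simp add: field_simps)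
  then have "(exp 1 * K 0 / K t) powr \<beta> \<le> exp 1 powr \<beta>"
    using beta1 K_pos[OF t] K_pos[OF T0] by (intro powr_mono2) auto
  then have "1 + 3 * M0 * zeta2 * (exp 1 * K 0 / K t) powr \<beta> \<le> D"
    using M0_pos zeta2_pos unfolding D_def by (intro add_left_mono mult_left_mono) auto
  then have "K t * (1 + 3 * M0 * zeta2 * (exp 1 * K 0 / K t) powr \<beta>) \<le> K t * D"
    using K_pos[OF t] by (intro mult_left_mono) auto
  with kk_le_K[OF t, of x] big have "D * max 1 (1 / e') < D * K t" by (simp add: mult.commute)
  then have K: "1 < K t" "1 / e' < K t" using D by auto
  have "K t \<le> K t ^ (p + 1)" using K(1) power_increasing[of 1 "p + 1" "K t"] by simp
  with K(2) have "1 / e' < K t ^ (p + 1)" by (rule less_le_trans)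
  then have Je: "J t < e'" using e' K_pos[OF t] by (simp add: J_def field_simps)
  have "t1 < t"
  proof (rule ccontr)
    assume "\<not> t1 < t"
    then have "J t1 \<le> J t" using J_antimono[of t t1] t t1 by simp
    with Je show False by (simp add: e'_def)
  qed
  with t Je that show thesis by (auto simp: e'_def)
qed

text \<open>Lower bound: \<open>J\<close> falls at least at the rate
  \<open>(p + 1) / (2 * p)\<close> and is still positive at every time before \<open>T\<close>.
  Upper bound: it becomes arbitrarily small after \<open>t\<close>, while falling at most at the
  rate \<open>2 * (p + 1) / p\<close>.\<close>

lemma J_bounds:
  assumes t: "t \<in> {0..<T}"
  shows "real (p + 1) / (2 * real p) * (T - t) \<le> J t" "J t \<le> 2 * real (p + 1) / real p * (T - t)"
proof -
  define c1 where "c1 = real (p + 1) / (2 * real p)"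
  define c2 where "c2 = 2 * real (p + 1) / real p"
  have c: "0 < c1" "0 < c2" using p0 by (simp_all add: c1_def c2_def)
  have lower: "c1 * (t1 - t) \<le> J t" if "t \<le> t1" "t1 < T" for t1
  proof -
    have t1: "t1 \<in> {0..<T}" using that t by auto
    show ?thesis using J_diff(1)[of t t1] J_pos[OF t1] t that by (simp add: c1_def)
  qed
  have "T - t \<le> J t / c1"
  proof (rule dense_le_bounded[of 0])
    show "0 < T - t" using t by simp
    fix u assume u: "0 < u" "u < T - t"
    then show "u \<le> J t / c1" using lower[of "t + u"] c by (simp add: field_simps)
  qed
  then show "real (p + 1) / (2 * real p) * (T - t) \<le> J t" using c unfolding c1_def[symmetric] by (simp add: field_simps)
  have "J t \<le> c2 * (T - t) + e" if e: "0 < e" for e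
  proof -
    obtain t2 where t2: "t < t2" "t2 < T" "J t2 < e" using J_small[OF t e] by blast
    have "J t - J t2 \<le> c2 * (t2 - t)" using J_diff(2)[of t t2] t t2 by (simp add: c2_def)
    also have "\<dots> \<le> c2 * (T - t)" using t2 c by (intro mult_left_mono) auto
    finally show ?thesis using t2 by simp
  qed
  then show "J t \<le> 2 * real (p + 1) / real p * (T - t)" unfolding c2_def[symmetric] by (rule field_le_epsilon)
qed

text \<open>The 4 is the quotient of the two rates in \<open>J_bounds\<close>. It is kept after the
  root of order \<open>p + 1\<close> because \<open>4 \<le> 4 ^ (p + 1)\<close>; the 2 in
  \<open>K_scale\<close> arises in the same way.\<close>

lemma K_ratio:
  assumes t: "t \<in> {0..<T}"
  shows "K 0 / K t \<le> 4 * ((T - t) / T) powr (1 / real (p + 1))"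
proof -
  have T0: "0 \<in> {0..<T}" using T by simp
  have "J t / J 0 \<le> (2 * real (p + 1) / real p * (T - t)) / (real (p + 1) / (2 * real p) * (T - 0))"
    using J_bounds[OF t] J_bounds[OF T0] J_pos[OF t] T p0 t by (intro frac_le) auto
  also have "\<dots> = 4 * ((T - t) / T)"
  proof -
    have "(2 * a / b * x) / (a / (2 * b) * y) = 4 * (x / y)" if "a \<noteq> 0" "b \<noteq> 0" for a b x y :: real
      using that by (simp add: field_simps)
    from this[of "real (p + 1)" "real p" "T - t" "T - 0"] p0 show ?thesis by simp
  qed
  also have "J t / J 0 = (K 0 / K t) ^ (p + 1)"
    using K_pos[OF t] K_pos[OF T0] by (simp add: J_def power_divide field_simps)
  finally have "(K 0 / K t) ^ (p + 1) \<le> 4 * ((T - t) / T)" .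
  moreover have "4 * ((T - t) / T) \<le> (4 * ((T - t) / T) powr (1 / real (p + 1))) ^ (p + 1)"
  proof -
    have "(((T - t) / T) powr (1 / real (p + 1))) ^ (p + 1) = (T - t) / T"
      using t T by (simp add: powr_realpow[symmetric] powr_powr del: power_Suc)
    moreover have "(4::real) \<le> 4 ^ (p + 1)" using power_increasing[of 1 "p + 1" "4::real"] by simp
    ultimately show ?thesis using t T unfolding power_mult_distrib by (intro mult_mono) auto
  qed
  ultimately have "(K 0 / K t) ^ Suc p \<le> (4 * ((T - t) / T) powr (1 / real (p + 1))) ^ Suc p" by simp
  then show ?thesis by (rule power_le_imp_le_base) simp
qed

lemma K_scale:
  assumes t: "t \<in> {0..<T}"
  shows "(real (p + 1) * (T - t) / real p) powr (1 / real (p + 1)) * K t \<le> 2"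
proof -
  have "real (p + 1) * (T - t) / real p \<le> 2 * J t" using J_bounds(1)[OF t] p0 by (simp add: field_simps)
  then have "(real (p + 1) * (T - t) / real p) * K t ^ (p + 1) \<le> 2 * J t * K t ^ (p + 1)"
    using K_pos[OF t] by (intro mult_right_mono) auto
  also have "\<dots> = 2" using K_pos[OF t] by (simp add: J_def field_simps)
  also have "(2::real) \<le> 2 ^ Suc p" using power_increasing[of 1 "Suc p" "2::real"] by simp
  finally have "(real (p + 1) * (T - t) / real p) * K t ^ (p + 1) \<le> 2 ^ Suc p" .
  moreover have "((real (p + 1) * (T - t) / real p) powr (1 / real (p + 1)) * K t) ^ Suc p = (real (p + 1) * (T - t) / real p) * K t ^ (p + 1)"
    using t p0 unfolding power_mult_distrib by (simp add: powr_realpow[symmetric] powr_powr del: power_Suc)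
  ultimately have "((real (p + 1) * (T - t) / real p) powr (1 / real (p + 1)) * K t) ^ Suc p \<le> 2 ^ Suc p" by simp
  then show ?thesis by (rule power_le_imp_le_base) simp
qed

end

end

subsection \<open>Continuous lifts of unit vectors\<close>

text \<open>Near \<open>x\<close> continuity keeps \<theta> within distance \<pi> of its value at
  \<open>x\<close>, so the principal logarithm of the quotient recovers the difference of angles
  exactly and can be differentiated at 1.\<close>

lemma lift_has_derivative:
  assumes cont: "continuous (at x within S) \<theta>"
    and der: "((\<lambda>s. cis (\<theta> s)) has_vector_derivative \<i> * of_real g * cis (\<theta> x)) (at x within S)"
    and x: "x \<in> S"
  shows "(\<theta> has_real_derivative g) (at x within S)"
proof -
  define F where "F s = \<theta> x + Im (Ln (cis (\<theta> s) * cis (- \<theta> x)))" for s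
  have c1: "cis (\<theta> x) * cis (- \<theta> x) = 1" by (simp add: cis_mult)
  have "((\<lambda>s. cis (\<theta> s) * cis (- \<theta> x)) has_vector_derivative \<i> * of_real g * cis (\<theta> x) * cis (- \<theta> x)) (at x within S)"
    by (rule has_vector_derivative_mult_left[OF der])
  then have 1: "((\<lambda>s. cis (\<theta> s) * cis (- \<theta> x)) has_vector_derivative \<i> * of_real g) (at x within S)"
    using c1 by (simp add: mult.assoc)
  have "(Ln has_field_derivative inverse 1) (at (cis (\<theta> x) * cis (- \<theta> x)))"
    unfolding c1 by (rule has_field_derivative_Ln) auto
  from field_vector_diff_chain_within[OF 1 has_field_derivative_at_within[OF this]]
  have "((\<lambda>s. Ln (cis (\<theta> s) * cis (- \<theta> x))) has_vector_derivative \<i> * of_real g) (at x within S)"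
    by (simp add: o_def)
  from bounded_linear.has_vector_derivative[OF bounded_linear_Im this]
  have "((\<lambda>s. Im (Ln (cis (\<theta> s) * cis (- \<theta> x)))) has_real_derivative g) (at x within S)"
    by (simp add: has_real_derivative_iff_has_vector_derivative)
  from DERIV_add[OF DERIV_const this] have Fd: "(F has_real_derivative g) (at x within S)"
    unfolding F_def[abs_def] by simp
  obtain d where d: "d > 0" "\<And>s. s \<in> S \<Longrightarrow> dist s x < d \<Longrightarrow> dist (\<theta> s) (\<theta> x) < pi"
    using cont pi_gt_zero unfolding continuous_within_eps_delta by blast
  show ?thesis
  proof (rule has_field_derivative_transform_within[OF Fd d(1) x])
    fix s assume s: "s \<in> S" "dist s x < d"
    have "Ln (cis (\<theta> s) * cis (- \<theta> x)) = Ln (exp (\<i> * of_real (\<theta> s - \<theta> x)))"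
      by (simp only: cis_mult) (simp add: cis_conv_exp)
    also have "\<dots> = \<i> * of_real (\<theta> s - \<theta> x)"
      by (rule Ln_exp) (use d(2)[OF s] in \<open>auto simp: dist_real_def\<close>)
    finally show "F s = \<theta> s" by (simp add: F_def)
  qed
qed

lemma lift_constant:
  fixes d :: "real \<Rightarrow> real"
  assumes cont: "continuous_on S d" and S: "convex S" and one: "\<And>s. s \<in> S \<Longrightarrow> cis (d s) = c"
    and "a \<in> S" "b \<in> S"
  shows "d a = d b"
proof -
  have "(d has_field_derivative 0) (at x within S)" if x: "x \<in> S" for x
  proof (rule lift_has_derivative[OF _ _ x])
    show "continuous (at x within S) d" using cont x by (simp add: continuous_on_eq_continuous_within)
    have "((\<lambda>s. c) has_vector_derivative 0) (at x within S)" by simp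
    then have "((\<lambda>s. cis (d s)) has_vector_derivative 0) (at x within S)"
      by (rule has_vector_derivative_transform[OF x, rotated]) (simp add: one)
    then show "((\<lambda>s. cis (d s)) has_vector_derivative \<i> * of_real 0 * cis (d x)) (at x within S)" by simp
  qed
  then obtain e where "\<And>x. x \<in> S \<Longrightarrow> d x = e"
    using has_field_derivative_zero_constant[OF S] by metis
  with assms show ?thesis by simp
qed

text \<open>The real part of the logarithmic derivative \<open>Z' / Z\<close> drives the modulus; in
  the next lemma its imaginary part drives the direction.\<close>

lemma norm_has_derivative_complex:
  fixes Z :: "real \<Rightarrow> complex"
  assumes "(Z has_vector_derivative Z') (at x within S)" "Z x \<noteq> 0"
  shows "((\<lambda>x. norm (Z x)) has_real_derivative norm (Z x) * Re (Z' / Z x)) (at x within S)"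
proof -
  have "((\<lambda>x. norm (Z x)) has_derivative (\<lambda>h. (h *\<^sub>R Z') \<bullet> sgn (Z x))) (at x within S)"
    using has_derivative_compose[OF assms(1)[unfolded has_vector_derivative_def] has_derivative_norm[OF assms(2)]]
    by simp
  moreover have "(h *\<^sub>R Z') \<bullet> sgn (Z x) = (norm (Z x) * Re (Z' / Z x)) * h" for h
  proof -
    have "Z' \<bullet> sgn (Z x) = norm (Z x) * Re (Z' / Z x)"
      using assms(2) unfolding Re_divide' sgn_div_norm
      by (simp add: inner_complex_def power2_eq_square field_simps)
    then show ?thesis by simp
  qed
  then have "(\<lambda>h. (h *\<^sub>R Z') \<bullet> sgn (Z x)) = (*) (norm (Z x) * Re (Z' / Z x))" by (rule ext)
  ultimately show ?thesis by (simp only: has_field_derivative_def)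
qed

lemma sgn_has_derivative_complex:
  fixes Z :: "real \<Rightarrow> complex"
  assumes "(Z has_vector_derivative Z') (at x within S)" "Z x \<noteq> 0"
  shows "((\<lambda>x. sgn (Z x)) has_vector_derivative \<i> * of_real (Im (Z' / Z x)) * sgn (Z x)) (at x within S)"
proof -
  have n: "norm (Z x) \<noteq> 0" using assms by simp
  have "((\<lambda>x. inverse (norm (Z x))) has_real_derivative - (norm (Z x) * Re (Z' / Z x) * inverse ((norm (Z x))\<^sup>2))) (at x within S)"
    using DERIV_inverse_fun[OF norm_has_derivative_complex[OF assms] n] by (simp add: power2_eq_square)
  then have "((\<lambda>x. inverse (norm (Z x))) has_real_derivative - (Re (Z' / Z x) * inverse (norm (Z x)))) (at x within S)"
    using n by (simp add: power2_eq_square field_simps)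
  from has_vector_derivative_scaleR[OF this assms(1)]
  have "((\<lambda>x. inverse (norm (Z x)) *\<^sub>R Z x) has_vector_derivative
     inverse (norm (Z x)) *\<^sub>R Z' + (- (Re (Z' / Z x) * inverse (norm (Z x)))) *\<^sub>R Z x) (at x within S)" .
  moreover have "inverse (norm (Z x)) *\<^sub>R Z' + (- (Re (Z' / Z x) * inverse (norm (Z x)))) *\<^sub>R Z x
     = (Z' / Z x - of_real (Re (Z' / Z x))) * (inverse (norm (Z x)) *\<^sub>R Z x)"
    using assms(2) by (simp add: scaleR_conv_of_real field_simps)
  moreover have "Z' / Z x - of_real (Re (Z' / Z x)) = \<i> * of_real (Im (Z' / Z x))"
    by (simp add: complex_eq_iff)
  ultimately show ?thesis by (simp add: sgn_div_norm divide_inverse mult.commute)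
qed

subsection \<open>Families smooth in the space variable\<close>

text \<open>Space derivatives up to order \<open>r\<close>, each jointly continuous in time and
  space; time derivatives are treated separately by explicit equations. The grading by
  \<open>r\<close> allows induction for quotients and roots, whose derivatives contain the function
  itself.\<close>

primrec space_Ck :: "real set \<Rightarrow> nat \<Rightarrow> (real \<Rightarrow> real \<Rightarrow> real) \<Rightarrow> bool" where
  "space_Ck I 0 F \<longleftrightarrow> continuous_on (I \<times> UNIV) (\<lambda>(t, u). F t u)"
| "space_Ck I (Suc r) F \<longleftrightarrow> continuous_on (I \<times> UNIV) (\<lambda>(t, u). F t u) \<and>
     (\<exists>F'. (\<forall>t\<in>I. \<forall>u. (F t has_real_derivative F' t u) (at u)) \<and> space_Ck I r F')"

definition space_smooth :: "real set \<Rightarrow> (real \<Rightarrow> real \<Rightarrow> real) \<Rightarrow> bool" where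
  "space_smooth I F \<longleftrightarrow> (\<forall>r. space_Ck I r F)"

definition du :: "(real \<Rightarrow> real \<Rightarrow> real) \<Rightarrow> real \<Rightarrow> real \<Rightarrow> real" where
  "du F t u = deriv (F t) u"

lemma space_Ck_cont: "space_Ck I r F \<Longrightarrow> continuous_on (I \<times> UNIV) (\<lambda>(t, u). F t u)"
  by (cases r) auto

lemma continuous_on_family_cong:
  assumes "\<And>t u. t \<in> I \<Longrightarrow> F t u = G t u"
  shows "continuous_on (I \<times> UNIV) (\<lambda>(t, u). F t u) \<longleftrightarrow> continuous_on (I \<times> UNIV) (\<lambda>(t, u). G t u)"
  using assms by (intro continuous_on_cong) auto

lemma space_Ck_cong:
  assumes "\<And>t u. t \<in> I \<Longrightarrow> F t u = G t u"
  shows "space_Ck I r F \<longleftrightarrow> space_Ck I r G"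
proof -
  have "F t = G t" if "t \<in> I" for t using assms[OF that] by auto
  moreover note continuous_on_family_cong[where I=I and F=F and G=G, OF assms]
  ultimately show ?thesis by (cases r) simp_all
qed

lemma space_Ck_antimono: "space_Ck I (Suc r) F \<Longrightarrow> space_Ck I r F"
proof (induction r arbitrary: F)
  case (Suc r)
  then obtain F' where F': "\<forall>t\<in>I. \<forall>u. (F t has_real_derivative F' t u) (at u)" "space_Ck I (Suc r) F'"
    and c: "continuous_on (I \<times> UNIV) (\<lambda>(t, u). F t u)" by auto
  from Suc.IH[OF F'(2)] F'(1) c show ?case by auto
qed auto

lemma space_Ck_add: "space_Ck I r F \<Longrightarrow> space_Ck I r G \<Longrightarrow> space_Ck I r (\<lambda>t u. F t u + G t u)"
proof (induction r arbitrary: F G)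
  case 0
  then show ?case by (auto simp: case_prod_unfold intro!: continuous_intros)
next
  case (Suc r)
  obtain F' where F: "\<forall>t\<in>I. \<forall>u. (F t has_real_derivative F' t u) (at u)" "space_Ck I r F'" using Suc.prems by auto
  obtain G' where G: "\<forall>t\<in>I. \<forall>u. (G t has_real_derivative G' t u) (at u)" "space_Ck I r G'" using Suc.prems by auto
  have c: "continuous_on (I \<times> UNIV) (\<lambda>(t, u). F t u + G t u)"
    using Suc.prems[THEN space_Ck_cont] by (auto simp: case_prod_unfold intro!: continuous_intros)
  show ?case
    unfolding space_Ck.simps
  proof (intro conjI c exI[of _ "\<lambda>t u. F' t u + G' t u"] ballI allI)
    show "((\<lambda>u. F t u + G t u) has_real_derivative F' t u + G' t u) (at u)" if "t \<in> I" for t u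
      using F G that by (auto intro!: DERIV_add)
  qed (rule Suc.IH[OF F(2) G(2)])
qed

lemma space_Ck_mult: "space_Ck I r F \<Longrightarrow> space_Ck I r G \<Longrightarrow> space_Ck I r (\<lambda>t u. F t u * G t u)"
proof (induction r arbitrary: F G)
  case 0
  then show ?case by (auto simp: case_prod_unfold intro!: continuous_intros)
next
  case (Suc r)
  obtain F' where F: "\<forall>t\<in>I. \<forall>u. (F t has_real_derivative F' t u) (at u)" "space_Ck I r F'" using Suc.prems by auto
  obtain G' where G: "\<forall>t\<in>I. \<forall>u. (G t has_real_derivative G' t u) (at u)" "space_Ck I r G'" using Suc.prems by auto
  have c: "continuous_on (I \<times> UNIV) (\<lambda>(t, u). F t u * G t u)"
    using Suc.prems[THEN space_Ck_cont] by (auto simp: case_prod_unfold intro!: continuous_intros)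
  show ?case
    unfolding space_Ck.simps
  proof (intro conjI c exI[of _ "\<lambda>t u. F' t u * G t u + G' t u * F t u"] ballI allI)
    show "((\<lambda>u. F t u * G t u) has_real_derivative F' t u * G t u + G' t u * F t u) (at u)" if "t \<in> I" for t u
      using F G that by (auto intro!: DERIV_mult)
    show "space_Ck I r (\<lambda>t u. F' t u * G t u + G' t u * F t u)"
      by (intro space_Ck_add Suc.IH F(2) G(2) Suc.prems[THEN space_Ck_antimono])
  qed
qed

lemma space_Ck_const: "space_Ck I r (\<lambda>t u. c)"
  by (induction r arbitrary: c) (auto simp: case_prod_unfold intro!: exI[of _ "\<lambda>t u. 0"])

lemma space_Ck_inverse: "space_Ck I r F \<Longrightarrow> (\<And>t u. t \<in> I \<Longrightarrow> F t u \<noteq> 0) \<Longrightarrow> space_Ck I r (\<lambda>t u. inverse (F t u))"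
proof (induction r)
  case 0
  then show ?case by (auto simp: case_prod_unfold intro!: continuous_intros)
next
  case (Suc r)
  obtain F' where F: "\<forall>t\<in>I. \<forall>u. (F t has_real_derivative F' t u) (at u)" "space_Ck I r F'" using Suc.prems by auto
  have i: "space_Ck I r (\<lambda>t u. inverse (F t u))" using Suc space_Ck_antimono by blast
  have c: "continuous_on (I \<times> UNIV) (\<lambda>(t, u). inverse (F t u))" by (rule space_Ck_cont[OF i])
  show ?case
    unfolding space_Ck.simps
  proof (intro conjI c exI[of _ "\<lambda>t u. (- 1) * (F' t u * (inverse (F t u) * inverse (F t u)))"] ballI allI)
    show "((\<lambda>u. inverse (F t u)) has_real_derivative (- 1) * (F' t u * (inverse (F t u) * inverse (F t u)))) (at u)" if "t \<in> I" for t u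
      using DERIV_inverse_fun[of "F t" "F' t u" u UNIV] F Suc.prems(2)[OF that] that by simp
    show "space_Ck I r (\<lambda>t u. (- 1) * (F' t u * (inverse (F t u) * inverse (F t u))))"
      by (intro space_Ck_mult space_Ck_const F(2) i)
  qed
qed

lemma space_Ck_sqrt: "space_Ck I r F \<Longrightarrow> (\<And>t u. t \<in> I \<Longrightarrow> 0 < F t u) \<Longrightarrow> space_Ck I r (\<lambda>t u. sqrt (F t u))"
proof (induction r)
  case 0
  then show ?case by (auto simp: case_prod_unfold intro!: continuous_intros)
next
  case (Suc r)
  obtain F' where F: "\<forall>t\<in>I. \<forall>u. (F t has_real_derivative F' t u) (at u)" "space_Ck I r F'" using Suc.prems by auto
  have i: "space_Ck I r (\<lambda>t u. sqrt (F t u))" using Suc space_Ck_antimono by blast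
  have c: "continuous_on (I \<times> UNIV) (\<lambda>(t, u). sqrt (F t u))" by (rule space_Ck_cont[OF i])
  show ?case
    unfolding space_Ck.simps
  proof (intro conjI c exI[of _ "\<lambda>t u. F' t u * ((1 / 2) * inverse (sqrt (F t u)))"] ballI allI)
    show "((\<lambda>u. sqrt (F t u)) has_real_derivative F' t u * ((1 / 2) * inverse (sqrt (F t u)))) (at u)" if "t \<in> I" for t u
      using F(1) Suc.prems(2)[OF that, of u] that by (auto intro!: derivative_eq_intros)
    show "space_Ck I r (\<lambda>t u. F' t u * ((1 / 2) * inverse (sqrt (F t u))))"
    proof (intro space_Ck_mult space_Ck_const F(2) space_Ck_inverse i)
      show "sqrt (F t u) \<noteq> 0" if "t \<in> I" for t u using Suc.prems(2)[OF that, of u] by simp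
    qed
  qed
qed

lemma space_smooth_cont: "space_smooth I F \<Longrightarrow> continuous_on (I \<times> UNIV) (\<lambda>(t, u). F t u)"
  unfolding space_smooth_def using space_Ck_cont by blast

lemma space_smooth_du:
  assumes "space_smooth I F"
  shows "t \<in> I \<Longrightarrow> (F t has_real_derivative du F t u) (at u)" "space_smooth I (du F)"
proof -
  show d: "(F t has_real_derivative du F t u) (at u)" if "t \<in> I" for t u
  proof -
    have "space_Ck I (Suc 0) F" using assms by (simp add: space_smooth_def del: space_Ck.simps)
    then obtain F' where "\<forall>t\<in>I. \<forall>u. (F t has_real_derivative F' t u) (at u)" by auto
    then have "(F t has_real_derivative F' t u) (at u)" using that by simp
    then show ?thesis using DERIV_imp_deriv[of "F t" "F' t u" u] by (simp add: du_def)
  qed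
  show "space_smooth I (du F)"
    unfolding space_smooth_def
  proof
    fix r
    have "space_Ck I (Suc r) F" using assms by (simp add: space_smooth_def del: space_Ck.simps)
    then obtain F' where F': "\<forall>t\<in>I. \<forall>u. (F t has_real_derivative F' t u) (at u)" "space_Ck I r F'" by auto
    have "F' t u = du F t u" if "t \<in> I" for t u
      by (rule DERIV_unique[OF _ d[OF that]]) (use F'(1) that in simp)
    then show "space_Ck I r (du F)" using F'(2) space_Ck_cong[of I F' "du F" r] by simp
  qed
qed

lemma space_smooth_du_eq:
  "(\<And>t u. t \<in> I \<Longrightarrow> (F t has_real_derivative F' t u) (at u)) \<Longrightarrow> t \<in> I \<Longrightarrow> du F t u = F' t u"
  unfolding du_def using DERIV_imp_deriv by blast

lemma space_smooth_tower:
  assumes "\<And>j. continuous_on (I \<times> UNIV) (\<lambda>(t, u). E j t u)"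
    and "\<And>j t u. t \<in> I \<Longrightarrow> (E j t has_real_derivative E (Suc j) t u) (at u)"
  shows "space_smooth I (E j)"
proof -
  have "space_Ck I r (E j)" for r j
  proof (induction r arbitrary: j)
    case (Suc r)
    show ?case unfolding space_Ck.simps
      by (intro conjI assms(1) exI[of _ "E (Suc j)"] ballI allI assms(2) Suc)
  qed (use assms in auto)
  then show ?thesis by (simp add: space_smooth_def)
qed

lemma space_smooth_intros:
  "space_smooth I (\<lambda>t u. c)"
  "space_smooth I F \<Longrightarrow> space_smooth I G \<Longrightarrow> space_smooth I (\<lambda>t u. F t u + G t u)"
  "space_smooth I F \<Longrightarrow> space_smooth I G \<Longrightarrow> space_smooth I (\<lambda>t u. F t u * G t u)"
  "space_smooth I F \<Longrightarrow> (\<And>t u. t \<in> I \<Longrightarrow> F t u \<noteq> 0) \<Longrightarrow> space_smooth I (\<lambda>t u. inverse (F t u))"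
  "space_smooth I F \<Longrightarrow> (\<And>t u. t \<in> I \<Longrightarrow> 0 < F t u) \<Longrightarrow> space_smooth I (\<lambda>t u. sqrt (F t u))"
  by (simp_all add: space_smooth_def space_Ck_const space_Ck_add space_Ck_mult space_Ck_inverse space_Ck_sqrt)

lemma space_smooth_power: "space_smooth I F \<Longrightarrow> space_smooth I (\<lambda>t u. F t u ^ n)"
  by (induction n) (auto intro: space_smooth_intros)

text \<open>The mean value theorem in space at each time. The intermediate points converge to
  \<open>U t\<close>, so joint continuity of \<open>Fu\<close> gives the limit of the slopes; the
  time dependence of \<open>F\<close> needs no regularity here. The two following rules rest on
  this.\<close>

lemma partial_mvt:
  fixes F Fu :: "real \<Rightarrow> real \<Rightarrow> real"
  assumes der: "\<And>s u. s \<in> I \<Longrightarrow> (F s has_real_derivative Fu s u) (at u)"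
    and cont: "continuous_on (I \<times> UNIV) (\<lambda>(s, u). Fu s u)"
    and U: "continuous (at t within I) U" and t: "t \<in> I"
  obtains \<phi> where "(\<phi> \<longlongrightarrow> Fu t (U t)) (at t within I)" "\<And>s. s \<in> I \<Longrightarrow> F s (U s) - F s (U t) = \<phi> s * (U s - U t)"
proof -
  have "\<exists>\<xi>. \<bar>\<xi> - U t\<bar> \<le> \<bar>U s - U t\<bar> \<and> F s (U s) - F s (U t) = Fu s \<xi> * (U s - U t)" if s: "s \<in> I" for s
  proof (cases "U s" "U t" rule: linorder_cases)
    case less
    from MVT2[OF less, of "F s" "Fu s"] der[OF s] obtain z where "U s < z" "z < U t" "F s (U t) - F s (U s) = (U t - U s) * Fu s z" by auto
    then show ?thesis by (intro exI[of _ z]) (auto simp: algebra_simps)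
  next
    case greater
    from MVT2[OF greater, of "F s" "Fu s"] der[OF s] obtain z where "U t < z" "z < U s" "F s (U s) - F s (U t) = (U s - U t) * Fu s z" by auto
    then show ?thesis by (intro exI[of _ z]) (auto simp: algebra_simps)
  qed auto
  then obtain \<xi> where \<xi>: "\<And>s. s \<in> I \<Longrightarrow> \<bar>\<xi> s - U t\<bar> \<le> \<bar>U s - U t\<bar>"
    "\<And>s. s \<in> I \<Longrightarrow> F s (U s) - F s (U t) = Fu s (\<xi> s) * (U s - U t)" by metis
  have evI: "\<forall>\<^sub>F s in at t within I. s \<in> I" by (simp add: eventually_at_filter)
  have Ulim: "((\<lambda>s. \<bar>U s - U t\<bar>) \<longlongrightarrow> 0) (at t within I)"
    using U by (simp add: continuous_within LIM_zero tendsto_rabs_zero)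
  have "((\<lambda>s. \<xi> s - U t) \<longlongrightarrow> 0) (at t within I)"
    by (rule Lim_null_comparison[OF _ Ulim]) (use \<xi>(1) evI in \<open>auto elim: eventually_mono\<close>)
  then have \<xi>lim: "(\<xi> \<longlongrightarrow> U t) (at t within I)" by (simp add: LIM_zero_iff)
  have "((\<lambda>s. (s, \<xi> s)) \<longlongrightarrow> (t, U t)) (at t within I)"
    by (intro tendsto_Pair tendsto_ident_at \<xi>lim)
  then have "((\<lambda>s. (\<lambda>(s, u). Fu s u) (s, \<xi> s)) \<longlongrightarrow> (\<lambda>(s, u). Fu s u) (t, U t)) (at t within I)"
    by (intro continuous_on_tendsto_compose[OF cont]) (use t evI in \<open>auto elim: eventually_mono\<close>)
  then have "((\<lambda>s. Fu s (\<xi> s)) \<longlongrightarrow> Fu t (U t)) (at t within I)" by simp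
  with \<xi>(2) that show thesis by blast
qed

lemma family_chain_rule:
  fixes F Fu :: "real \<Rightarrow> real \<Rightarrow> real"
  assumes der: "\<And>s u. s \<in> I \<Longrightarrow> (F s has_real_derivative Fu s u) (at u)"
    and cont: "continuous_on (I \<times> UNIV) (\<lambda>(s, u). Fu s u)"
    and Ft: "((\<lambda>s. F s (U t)) has_real_derivative Ft) (at t within I)"
    and U: "(U has_real_derivative U') (at t within I)" and t: "t \<in> I"
  shows "((\<lambda>s. F s (U s)) has_real_derivative Ft + Fu t (U t) * U') (at t within I)"
proof -
  obtain \<phi> where \<phi>: "(\<phi> \<longlongrightarrow> Fu t (U t)) (at t within I)" "\<And>s. s \<in> I \<Longrightarrow> F s (U s) - F s (U t) = \<phi> s * (U s - U t)"
    using partial_mvt[OF der cont DERIV_continuous[OF U] t] by metis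
  have "((\<lambda>s. (F s (U t) - F t (U t)) / (s - t) + \<phi> s * ((U s - U t) / (s - t))) \<longlongrightarrow> Ft + Fu t (U t) * U') (at t within I)"
    using Ft U \<phi>(1) unfolding has_field_derivative_iff by (intro tendsto_intros)
  then have "((\<lambda>s. (F s (U s) - F t (U t)) / (s - t)) \<longlongrightarrow> Ft + Fu t (U t) * U') (at t within I)"
  proof (rule Lim_transform_eventually)
    have "(F s (U t) - F t (U t)) / (s - t) + \<phi> s * ((U s - U t) / (s - t)) = (F s (U s) - F t (U t)) / (s - t)" if "s \<in> I" for s
      using \<phi>(2)[OF that] by (simp add: add_divide_distrib[symmetric])
    then show "\<forall>\<^sub>F s in at t within I. (F s (U t) - F t (U t)) / (s - t) + \<phi> s * ((U s - U t) / (s - t)) = (F s (U s) - F t (U t)) / (s - t)"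
      by (simp add: eventually_at_filter)
  qed
  then show ?thesis by (simp add: has_field_derivative_iff)
qed

text \<open>Along the level set, \<open>F s (U t) - F t (U t)\<close> is minus the increment in
  space, so dividing by the slope isolates the difference quotient of \<open>U\<close>.\<close>

lemma implicit_inverse_derivative:
  fixes F Fu :: "real \<Rightarrow> real \<Rightarrow> real"
  assumes der: "\<And>s u. s \<in> I \<Longrightarrow> (F s has_real_derivative Fu s u) (at u)"
    and cont: "continuous_on (I \<times> UNIV) (\<lambda>(s, u). Fu s u)"
    and Ft: "((\<lambda>s. F s (U t)) has_real_derivative Ft) (at t within I)"
    and U: "continuous (at t within I) U" and t: "t \<in> I"
    and level: "\<And>s. s \<in> I \<Longrightarrow> F s (U s) = x" and nz: "Fu t (U t) \<noteq> 0"
  shows "(U has_real_derivative - Ft / Fu t (U t)) (at t within I)"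
proof -
  obtain \<phi> where \<phi>: "(\<phi> \<longlongrightarrow> Fu t (U t)) (at t within I)" "\<And>s. s \<in> I \<Longrightarrow> F s (U s) - F s (U t) = \<phi> s * (U s - U t)"
    using partial_mvt[OF der cont U t] by metis
  have "((\<lambda>s. - ((F s (U t) - F t (U t)) / (s - t)) / \<phi> s) \<longlongrightarrow> - Ft / Fu t (U t)) (at t within I)"
    using Ft \<phi>(1) nz unfolding has_field_derivative_iff by (intro tendsto_intros)
  then have "((\<lambda>s. (U s - U t) / (s - t)) \<longlongrightarrow> - Ft / Fu t (U t)) (at t within I)"
  proof (rule Lim_transform_eventually)
    have nz': "\<forall>\<^sub>F s in at t within I. \<phi> s \<noteq> 0"
      by (rule tendsto_imp_eventually_ne[OF \<phi>(1) nz])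
    have "- ((F s (U t) - F t (U t)) / (s - t)) / \<phi> s = (U s - U t) / (s - t)" if "s \<in> I" "\<phi> s \<noteq> 0" for s
    proof -
      have "- (F s (U t) - F t (U t)) = \<phi> s * (U s - U t)" using \<phi>(2)[OF that(1)] level[OF that(1)] level[OF t] by simp
      then show ?thesis using that(2) by (simp add: minus_divide_left)
    qed
    then show "\<forall>\<^sub>F s in at t within I. - ((F s (U t) - F t (U t)) / (s - t)) / \<phi> s = (U s - U t) / (s - t)"
      using nz' by (auto simp: eventually_at_filter elim: eventually_mono)
  qed
  then show ?thesis by (simp add: has_field_derivative_iff)
qed

subsection \<open>The flow in terms of the normal angle\<close>

text \<open>This makes one-sided derivatives unique, also at the initial time.\<close>

lemma at_within_Ico_neq_bot:
  fixes t T :: real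
  assumes "t \<in> {0..<T}"
  shows "at t within {0..<T} \<noteq> bot"
proof -
  have "at t within {t..(t + T) / 2} \<le> at t within {0..<T}" using assms by (intro at_le) auto
  moreover have "at t within {t..(t + T) / 2} = at_right t" using assms by (intro at_within_Icc_at_right) auto
  ultimately show ?thesis using trivial_limit_at_right_real[of t] by (auto simp: bot_unique)
qed

text \<open>Applied with \<open>c = 1\<close> for closed curves and with a rotation
  \<open>c = cis l\<close> for symmetric initial curves.\<close>

lemma vector_derivative_shift_mult:
  fixes f :: "real \<Rightarrow> complex"
  assumes "\<And>u. f (u + P) = c * f u" "\<And>u. (f has_vector_derivative f' u) (at u)"
  shows "f' (u + P) = c * f' u"
proof -
  have "((\<lambda>u. u + P) has_vector_derivative 1) (at u)" by (auto intro!: derivative_eq_intros)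
  from vector_diff_chain_at[OF this, of f "f' (u + P)"] assms(2)[of "u + P"]
  have "((\<lambda>u. f (u + P)) has_vector_derivative f' (u + P)) (at u)" by (simp add: o_def)
  moreover have "((\<lambda>u. f (u + P)) has_vector_derivative c * f' u) (at u)"
    unfolding assms(1) by (rule has_vector_derivative_mult_right[OF assms(2)])
  ultimately show ?thesis by (rule vector_derivative_unique_at)
qed

lemma du_shift:
  assumes "\<And>u. F t (u + P) = F t u"
  shows "du F t (u + P) = du F t u"
proof -
  have "(F t has_real_derivative D) (at (u + P)) \<longleftrightarrow> (F t has_real_derivative D) (at u)" for D
    using DERIV_shift[of "F t" D u P] assms by simp
  then show ?thesis by (simp add: du_def deriv_def)
qed

text \<open>The counterpart of \<open>first_exit_finite\<close> for a compact parameter set: the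
  contact set in space-time is compact, and so is its projection to time.\<close>

lemma first_touch_compact:
  fixes H :: "real \<Rightarrow> real \<Rightarrow> real"
  assumes C: "compact C" and cont: "continuous_on ({0..b} \<times> C) (\<lambda>(t, u). H t u)"
    and start: "\<And>u. u \<in> C \<Longrightarrow> 0 < H 0 u"
    and bad: "u0 \<in> C" "0 \<le> b" "H b u0 \<le> 0"
  obtains t u where "0 < t" "t \<le> b" "u \<in> C" "H t u = 0" "\<And>s w. w \<in> C \<Longrightarrow> 0 \<le> s \<Longrightarrow> s < t \<Longrightarrow> 0 < H s w"
    "\<And>w. w \<in> C \<Longrightarrow> 0 \<le> H t w"
proof -
  define S where "S = {x \<in> {0..b} \<times> C. (\<lambda>(t, u). H t u) x \<le> 0}"
  have cl: "closed S"
    using continuous_closed_preimage[OF cont, of "{..0}"] compact_imp_closed[OF C]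
    by (simp add: S_def vimage_def Int_def closed_Times)
  have "compact S"
  proof -
    have "bounded S" by (rule bounded_subset[OF compact_imp_bounded[OF compact_Times[OF compact_Icc C]]]) (auto simp: S_def)
    with cl show ?thesis by (simp add: compact_eq_bounded_closed)
  qed
  then have "compact (fst ` S)" by (intro compact_continuous_image continuous_intros)
  moreover have "fst ` S \<noteq> {}" using bad by (auto simp: S_def)
  ultimately obtain t where t: "t \<in> fst ` S" "\<And>s. s \<in> fst ` S \<Longrightarrow> t \<le> s"
    using compact_attains_inf by metis
  from t(1) obtain u where u: "u \<in> C" "0 \<le> t" "t \<le> b" "H t u \<le> 0" by (auto simp: S_def)
  have t0: "0 < t" using u start[OF u(1)] by (cases "t = 0") auto
  have before: "0 < H s w" if "w \<in> C" "0 \<le> s" "s < t" for s w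
  proof (rule ccontr)
    assume "\<not> 0 < H s w"
    then have "(s, w) \<in> S" using that u by (auto simp: S_def)
    then have "s \<in> fst ` S" by force
    with t(2)[of s] that show False by simp
  qed
  have at: "0 \<le> H t w" if w: "w \<in> C" for w
  proof (rule ccontr)
    assume neg: "\<not> 0 \<le> H t w"
    have "continuous_on {0..t} (\<lambda>s. (\<lambda>(t, u). H t u) (s, w))"
      by (rule continuous_on_compose2[OF cont]) (use u w in \<open>auto intro!: continuous_intros\<close>)
    then have "continuous_on {0..t} (\<lambda>s. H s w)" by simp
    then have "\<exists>s. 0 \<le> s \<and> s \<le> t \<and> H s w = 0"
      using neg before[OF w, of 0] t0 by (intro IVT2') auto
    then obtain s where s: "0 \<le> s" "s \<le> t" "H s w = 0" by blast
    then have "s < t" using neg by (cases "s = t") auto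
    with before[OF w s(1)] s(3) show False by simp
  qed
  show thesis by (rule that[OF t0 u(3,1) _ before at]) (use u(4) at[OF u(1)] in auto)
qed

text \<open>\<open>D i j\<close> is the mixed partial derivative of order \<open>i\<close> in time
  and \<open>j\<close> in the parameter. The assumption \<open>angle0_shift\<close> says that the
  rotation index is \<open>m\<close>. Positive curvature is assumed at time 0 only.\<close>

locale pcsf_flow =
  fixes p m :: nat and T :: real and \<gamma> :: "real \<Rightarrow> complex" and X :: "real \<Rightarrow> real \<Rightarrow> complex"
    and D :: "nat \<Rightarrow> nat \<Rightarrow> real \<Rightarrow> real \<Rightarrow> complex" and \<theta>0 :: "real \<Rightarrow> real"
  assumes p1: "1 \<le> p" and m0: "0 < m" and sol: "pcsf_solution p m \<gamma> T X"
    and D00: "D 0 0 = X"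
    and D_cont: "\<And>i j. continuous_on ({0..<T} \<times> UNIV) (\<lambda>(t, u). D i j t u)"
    and D_t: "\<And>i j t u. t \<in> {0..<T} \<Longrightarrow> ((\<lambda>s. D i j s u) has_vector_derivative D (Suc i) j t u) (at t within {0..<T})"
    and D_u: "\<And>i j t u. t \<in> {0..<T} \<Longrightarrow> (D i j t has_vector_derivative D i (Suc j) t u) (at u)"
    and init_pos: "\<And>u. 0 < curvature \<gamma> u"
    and angle0: "normal_angle \<gamma> \<theta>0"
    and angle0_shift: "\<And>u. \<theta>0 (u + 2 * pi * real m) = \<theta>0 u + 2 * pi * real m"
begin

abbreviation "I \<equiv> {0..<T}"
abbreviation "P \<equiv> 2 * pi * real m"

lemma T0: "0 < T" and X0: "X 0 = \<gamma>" and X_per: "t \<in> I \<Longrightarrow> X t (u + P) = X t u"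
  and immersed: "t \<in> I \<Longrightarrow> vector_derivative (X t) (at u) \<noteq> 0"
  and flow: "t \<in> I \<Longrightarrow> ((\<lambda>s. X s u) has_vector_derivative
           - (1 / real p * curvature (X t) u ^ p) *\<^sub>R outward_normal (X t) u) (at t within I)"
  using sol unfolding pcsf_solution_def by auto

lemma P_pos: "0 < P" using m0 by simp

section \<open>Speed, turning and curvature along the flow\<close>

definition v :: "real \<Rightarrow> real \<Rightarrow> real" where "v t u = norm (D 0 1 t u)"
text \<open>The turning of the tangent per unit of the parameter: the imaginary part of the
  logarithmic derivative of the velocity.\<close>

definition g :: "real \<Rightarrow> real \<Rightarrow> real" where "g t u = Im (D 0 2 t u / D 0 1 t u)"
definition ka :: "real \<Rightarrow> real \<Rightarrow> real" where "ka t u = g t u * inverse (v t u)"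
definition f :: "real \<Rightarrow> real \<Rightarrow> real" where "f t u = ka t u ^ p * (1 / real p)"
text \<open>The arc-length derivative of the inward normal speed \<open>f\<close>. By
  \<open>sgn_t\<close> it is the rate at which the tangent, and with it the normal, turns in time at
  a fixed parameter.\<close>

definition h :: "real \<Rightarrow> real \<Rightarrow> real" where "h t u = du f t u * inverse (v t u)"

lemma X_u: "t \<in> I \<Longrightarrow> vector_derivative (X t) (at u) = D 0 1 t u"
  using D_u[of t 0 0 u] D00 by (simp add: vector_derivative_at)

lemma D01_u: "t \<in> I \<Longrightarrow> (D 0 1 t has_vector_derivative D 0 2 t u) (at u)"
  using D_u[of t 0 1 u] by (simp add: numeral_2_eq_2)

lemma D01_nz: "t \<in> I \<Longrightarrow> D 0 1 t u \<noteq> 0"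
  using immersed X_u by metis

lemma v_pos: "t \<in> I \<Longrightarrow> 0 < v t u"
  using D01_nz by (simp add: v_def)

lemma curvature_eq:
  assumes t: "t \<in> I"
  shows "curvature (X t) u = ka t u"
proof -
  have e: "(\<lambda>w. vector_derivative (X t) (at w)) = D 0 1 t" using X_u[OF t] by auto
  have d: "vector_derivative (D 0 1 t) (at u) = D 0 2 t u" by (rule vector_derivative_at[OF D01_u[OF t]])
  have "Im (cnj a * b) / norm a ^ 3 = Im (b / a) * inverse (norm a)" if "a \<noteq> 0" for a b :: complex
  proof -
    have "Im (b / a) = Im (cnj a * b) / (norm a)\<^sup>2"
      by (simp add: Im_divide cmod_power2 mult.commute)
    moreover have "c / n ^ 3 = c / n\<^sup>2 * inverse n" for c n :: real
      by (simp add: field_simps power3_eq_cube power2_eq_square)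
    ultimately show ?thesis by simp
  qed
  from this[OF D01_nz[OF t]] show ?thesis
    unfolding curvature_def e d X_u[OF t] ka_def g_def v_def by simp
qed

lemma outward_normal_eq: "t \<in> I \<Longrightarrow> outward_normal (X t) u = - \<i> * sgn (D 0 1 t u)"
  by (simp add: outward_normal_def X_u)

lemma D10:
  assumes t: "t \<in> I"
  shows "D 1 0 t u = of_real (f t u) * (\<i> * sgn (D 0 1 t u))"
proof -
  have "((\<lambda>s. X s u) has_vector_derivative D 1 0 t u) (at t within I)"
    using D_t[OF t, of 0 0 u] D00 by simp
  then have "D 1 0 t u = - (1 / real p * curvature (X t) u ^ p) *\<^sub>R outward_normal (X t) u"
    using vector_derivative_unique_within[OF at_within_Ico_neq_bot[OF t] _ flow[OF t]] by blast
  then show ?thesis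
    by (simp add: outward_normal_eq[OF t] curvature_eq[OF t] f_def scaleR_conv_of_real)
qed

lemma D_smooth: "space_smooth I (\<lambda>t u. Re (D i j t u))" "space_smooth I (\<lambda>t u. Im (D i j t u))"
proof -
  have c: "continuous_on (I \<times> UNIV) (\<lambda>x. D i j (fst x) (snd x))" for j
    using D_cont[of i j] by (simp add: case_prod_unfold)
  show "space_smooth I (\<lambda>t u. Re (D i j t u))"
  proof (rule space_smooth_tower[where E="\<lambda>j t u. Re (D i j t u)"])
    show "continuous_on (I \<times> UNIV) (\<lambda>(t, u). Re (D i j t u))" for j
      unfolding case_prod_unfold by (intro continuous_intros c)
    show "((\<lambda>u. Re (D i j t u)) has_real_derivative Re (D i (Suc j) t u)) (at u)" if "t \<in> I" for j t u
      using bounded_linear.has_vector_derivative[OF bounded_linear_Re D_u[OF that]]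
      by (simp add: has_real_derivative_iff_has_vector_derivative)
  qed
  show "space_smooth I (\<lambda>t u. Im (D i j t u))"
  proof (rule space_smooth_tower[where E="\<lambda>j t u. Im (D i j t u)"])
    show "continuous_on (I \<times> UNIV) (\<lambda>(t, u). Im (D i j t u))" for j
      unfolding case_prod_unfold by (intro continuous_intros c)
    show "((\<lambda>u. Im (D i j t u)) has_real_derivative Im (D i (Suc j) t u)) (at u)" if "t \<in> I" for j t u
      using bounded_linear.has_vector_derivative[OF bounded_linear_Im D_u[OF that]]
      by (simp add: has_real_derivative_iff_has_vector_derivative)
  qed
qed

lemma norm_sq_pos: "t \<in> I \<Longrightarrow> 0 < Re (D 0 1 t u) * Re (D 0 1 t u) + Im (D 0 1 t u) * Im (D 0 1 t u)"
  using D01_nz[of t u] by (simp add: complex_neq_0 flip: power2_eq_square)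

lemma v_smooth: "space_smooth I v"
proof -
  have "space_smooth I (\<lambda>t u. sqrt (Re (D 0 1 t u) * Re (D 0 1 t u) + Im (D 0 1 t u) * Im (D 0 1 t u)))"
    by (intro space_smooth_intros D_smooth norm_sq_pos)
  then show ?thesis by (simp add: v_def[abs_def] cmod_def power2_eq_square)
qed

lemma g_smooth: "space_smooth I g"
proof -
  have nz: "t \<in> I \<Longrightarrow> Re (D 0 1 t u) * Re (D 0 1 t u) + Im (D 0 1 t u) * Im (D 0 1 t u) \<noteq> 0" for t u
    by (rule less_imp_neq[OF norm_sq_pos, THEN not_sym])
  have "space_smooth I (\<lambda>t u. (Im (D 0 2 t u) * Re (D 0 1 t u) + (- 1) * (Re (D 0 2 t u) * Im (D 0 1 t u))) *
      inverse (Re (D 0 1 t u) * Re (D 0 1 t u) + Im (D 0 1 t u) * Im (D 0 1 t u)))"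
    by (intro space_smooth_intros D_smooth nz)
  moreover have "(\<lambda>t u. (Im (D 0 2 t u) * Re (D 0 1 t u) + (- 1) * (Re (D 0 2 t u) * Im (D 0 1 t u))) *
      inverse (Re (D 0 1 t u) * Re (D 0 1 t u) + Im (D 0 1 t u) * Im (D 0 1 t u))) = g"
    by (intro ext) (simp add: g_def Im_divide power2_eq_square divide_inverse algebra_simps)
  ultimately show ?thesis by simp
qed

lemma v_nz: "t \<in> I \<Longrightarrow> v t u \<noteq> 0"
  using v_pos[of t u] by simp

lemma ka_smooth: "space_smooth I ka"
  unfolding ka_def[abs_def]
  by (intro space_smooth_intros g_smooth v_smooth v_nz)

lemma f_smooth: "space_smooth I f"
  unfolding f_def[abs_def] by (intro space_smooth_intros space_smooth_power ka_smooth)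

lemma inv_v_smooth: "space_smooth I (\<lambda>t u. inverse (v t u))"
  by (intro space_smooth_intros v_smooth v_nz)

lemma h_smooth: "space_smooth I h"
  unfolding h_def[abs_def] by (intro space_smooth_intros(3) space_smooth_du f_smooth inv_v_smooth)

lemma g_ka: "t \<in> I \<Longrightarrow> g t u = ka t u * v t u"
  using v_pos[of t u] by (simp add: ka_def)

lemma du_f: "t \<in> I \<Longrightarrow> du f t u = h t u * v t u"
  using v_pos[of t u] by (simp add: h_def)

text \<open>The logarithmic derivatives of \<open>X\<^sub>u\<close> in both variables turn the commutation of partial
  derivatives into the evolution equations of speed and curvature.\<close>

definition cc :: "real \<Rightarrow> real \<Rightarrow> complex" where
  "cc t u = of_real (- (f t u * ka t u)) + \<i> * of_real (h t u)"

lemma D11: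
  assumes t: "t \<in> I"
  shows "D 1 1 t u = D 0 1 t u * cc t u"
proof -
  have "((\<lambda>u. of_real (f t u) * (\<i> * sgn (D 0 1 t u))) has_vector_derivative
      of_real (f t u) * (\<i> * (\<i> * of_real (g t u) * sgn (D 0 1 t u))) + of_real (du f t u) * (\<i> * sgn (D 0 1 t u))) (at u)"
    unfolding g_def
    by (intro has_vector_derivative_mult has_vector_derivative_mult_right has_vector_derivative_of_real
        space_smooth_du(1)[OF f_smooth t] sgn_has_derivative_complex[OF D01_u[OF t] D01_nz[OF t]])
  moreover have "D 1 0 t = (\<lambda>u. of_real (f t u) * (\<i> * sgn (D 0 1 t u)))" using D10[OF t] by auto
  ultimately have "D 1 1 t u = of_real (f t u) * (\<i> * (\<i> * of_real (g t u) * sgn (D 0 1 t u))) + of_real (du f t u) * (\<i> * sgn (D 0 1 t u))"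
    using D_u[OF t, of 1 0 u] vector_derivative_unique_at by (metis One_nat_def)
  also have "\<dots> = sgn (D 0 1 t u) * of_real (v t u) * cc t u"
    unfolding g_ka[OF t] du_f[OF t] cc_def by (simp add: algebra_simps)
  also have "sgn (D 0 1 t u) * of_real (v t u) = D 0 1 t u"
    using D01_nz[OF t] by (simp add: sgn_div_norm v_def scaleR_conv_of_real)
  finally show ?thesis .
qed

lemma D01_t: "t \<in> I \<Longrightarrow> ((\<lambda>s. D 0 1 s u) has_vector_derivative D 0 1 t u * cc t u) (at t within I)"
  using D_t[of t 0 1 u] D11[of t u] by simp

lemma v_t: 
  assumes t: "t \<in> I"
  shows "((\<lambda>s. v s u) has_real_derivative - (f t u * ka t u) * v t u) (at t within I)"
  using norm_has_derivative_complex[OF D01_t[OF t, of u] D01_nz[OF t]] D01_nz[OF t]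
  by (simp add: v_def cc_def mult.commute)

lemma sgn_t:
  assumes t: "t \<in> I"
  shows "((\<lambda>s. sgn (D 0 1 s u)) has_vector_derivative \<i> * of_real (h t u) * sgn (D 0 1 t u)) (at t within I)"
  using sgn_has_derivative_complex[OF D01_t[OF t, of u] D01_nz[OF t]] D01_nz[OF t]
  by (simp add: cc_def)

lemma sgn_u:
  assumes t: "t \<in> I"
  shows "((\<lambda>u. sgn (D 0 1 t u)) has_vector_derivative \<i> * of_real (g t u) * sgn (D 0 1 t u)) (at u)"
  using sgn_has_derivative_complex[OF D01_u[OF t] D01_nz[OF t]] by (simp add: g_def)

text \<open>The time derivative of the logarithmic derivative in \<open>u\<close> is the
  \<open>u\<close>-derivative of \<open>cc\<close>; its imaginary part is that of
  \<open>h\<close>.\<close>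

lemma g_t:
  assumes t: "t \<in> I"
  shows "((\<lambda>s. g s u) has_real_derivative du h t u) (at t within I)"
proof -
  have fk: "space_smooth I (\<lambda>t u. f t u * ka t u)" by (intro space_smooth_intros f_smooth ka_smooth)
  define c' where "c' = of_real (- du (\<lambda>t u. f t u * ka t u) t u) + \<i> * of_real (du h t u)"
  have "((\<lambda>u. cc t u) has_vector_derivative c') (at u)"
    unfolding cc_def c'_def
    by (intro has_vector_derivative_add has_vector_derivative_mult_right has_vector_derivative_of_real
        space_smooth_du(1)[OF h_smooth t] DERIV_minus space_smooth_du(1)[OF fk t])
  from has_vector_derivative_mult[OF D01_u[OF t] this]
  have "((\<lambda>u. D 0 1 t u * cc t u) has_vector_derivative D 0 1 t u * c' + D 0 2 t u * cc t u) (at u)" .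
  moreover have "D 1 1 t = (\<lambda>u. D 0 1 t u * cc t u)" using D11[OF t] by auto
  ultimately have "(D 1 1 t has_vector_derivative D 0 1 t u * c' + D 0 2 t u * cc t u) (at u)" by simp
  with D_u[OF t, of 1 1 u] have D12: "D 1 2 t u = D 0 1 t u * c' + D 0 2 t u * cc t u"
    using vector_derivative_unique_at[of "D 1 1 t"] by (simp add: numeral_2_eq_2)
  have D02_t: "((\<lambda>s. D 0 2 s u) has_vector_derivative D 0 1 t u * c' + D 0 2 t u * cc t u) (at t within I)"
    using D_t[OF t, of 0 2 u] D12 by simp
  have inv: "((\<lambda>s. inverse (D 0 1 s u)) has_vector_derivative - (cc t u * inverse (D 0 1 t u))) (at t within I)"
  proof -
    have "(inverse has_field_derivative - (inverse (D 0 1 t u) * inverse (D 0 1 t u))) (at (D 0 1 t u) within range (\<lambda>s. D 0 1 s u))"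
      using DERIV_inverse'[OF DERIV_ident D01_nz[OF t]] by (auto intro: has_field_derivative_at_within)
    from field_vector_diff_chain_within[OF D01_t[OF t, of u] has_field_derivative_subset[OF this]]
    have "((\<lambda>s. inverse (D 0 1 s u)) has_vector_derivative
        D 0 1 t u * cc t u * - (inverse (D 0 1 t u) * inverse (D 0 1 t u))) (at t within I)"
      by (simp add: o_def image_subset_iff)
    moreover have "D 0 1 t u * cc t u * - (inverse (D 0 1 t u) * inverse (D 0 1 t u)) = - (cc t u * inverse (D 0 1 t u))"
      using D01_nz[OF t, of u] by (simp add: field_simps)
    ultimately show ?thesis by (simp only:)
  qed
  have "((\<lambda>s. D 0 2 s u * inverse (D 0 1 s u)) has_vector_derivative
      D 0 2 t u * - (cc t u * inverse (D 0 1 t u)) + (D 0 1 t u * c' + D 0 2 t u * cc t u) * inverse (D 0 1 t u)) (at t within I)"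
    by (rule has_vector_derivative_mult[OF D02_t inv])
  moreover have "D 0 2 t u * - (cc t u * inverse (D 0 1 t u)) + (D 0 1 t u * c' + D 0 2 t u * cc t u) * inverse (D 0 1 t u) = c'"
    using D01_nz[OF t, of u] by (simp add: field_simps)
  ultimately have "((\<lambda>s. D 0 2 s u / D 0 1 s u) has_vector_derivative c') (at t within I)"
    by (simp add: divide_inverse)
  from bounded_linear.has_vector_derivative[OF bounded_linear_Im this]
  show ?thesis by (simp add: g_def has_real_derivative_iff_has_vector_derivative c'_def)
qed

lemma ka_t:
  assumes t: "t \<in> I"
  shows "((\<lambda>s. ka s u) has_real_derivative du h t u * inverse (v t u) + f t u * (ka t u)\<^sup>2) (at t within I)"
proof -
  have vn: "v t u \<noteq> 0" using v_pos[OF t, of u] by simp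
  have "((\<lambda>s. inverse (v s u)) has_real_derivative f t u * ka t u * inverse (v t u)) (at t within I)"
    using DERIV_inverse_fun[OF v_t[OF t, of u] vn] vn by (simp add: field_simps)
  from DERIV_mult[OF g_t[OF t, of u] this]
  show ?thesis using vn by (simp add: ka_def power2_eq_square mult_ac)
qed

lemma D_per: "t \<in> I \<Longrightarrow> D 0 j t (u + P) = D 0 j t u"
proof (induction j arbitrary: u)
  case 0
  then show ?case using X_per D00 by simp
next
  case (Suc j)
  show ?case
    using vector_derivative_shift_mult[of "D 0 j t" P 1 "D 0 (Suc j) t" u] Suc D_u by simp
qed

lemma v_per: "t \<in> I \<Longrightarrow> v t (u + P) = v t u"
  and g_per: "t \<in> I \<Longrightarrow> g t (u + P) = g t u"
  by (simp_all add: v_def g_def D_per)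

lemma ka_per: "t \<in> I \<Longrightarrow> ka t (u + P) = ka t u"
  by (simp add: ka_def v_per g_per)

lemma h_per: "t \<in> I \<Longrightarrow> h t (u + P) = h t u"
  using du_shift[of f t P u] by (simp add: h_def v_per f_def ka_per)

lemma ka_u: "t \<in> I \<Longrightarrow> (ka t has_real_derivative du ka t u) (at u)"
  by (rule space_smooth_du(1)[OF ka_smooth])

lemma du_f_ka:
  assumes t: "t \<in> I"
  shows "du f t u = ka t u ^ (p - 1) * du ka t u"
proof (rule space_smooth_du_eq[where I=I, OF _ t])
  show "(f t has_real_derivative ka t u ^ (p - 1) * du ka t u) (at u)" if "t \<in> I" for t u
    unfolding f_def[abs_def] using p1
    by (auto intro!: derivative_eq_intros ka_u[OF that])
qed

text \<open>Minimum principle with a slowly sinking positive barrier. At a first contact both the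
  diffusion and the reaction term are non-negative, whereas the barrier sinks with slope
  \<open>- e\<close>.\<close>

lemma ka_pos:
  assumes t: "t \<in> I"
  shows "0 < ka t u"
proof (rule ccontr)
  assume neg: "\<not> 0 < ka t u"
  have z: "0 \<in> I" using T0 by simp
  have sub: "{0..t} \<subseteq> I" using t by auto
  have kc: "continuous_on ({0..t} \<times> S) (\<lambda>(s, u). ka s u)" for S
    by (rule continuous_on_subset[OF space_smooth_cont[OF ka_smooth]]) (use sub in auto)
  have kc0: "continuous_on {0..P} (ka 0)"
    by (meson ka_u[OF z] DERIV_isCont continuous_at_imp_continuous_on)
  obtain u1 where u1: "u1 \<in> {0..P}" "\<And>w. w \<in> {0..P} \<Longrightarrow> ka 0 u1 \<le> ka 0 w"
    using continuous_attains_inf[OF compact_Icc _ kc0] P_pos by auto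
  define k0 where "k0 = ka 0 u1"
  have k0: "0 < k0" using init_pos[of u1] curvature_eq[OF z, of u1] by (simp add: k0_def X0)
  \<comment> \<open>With this slope the barrier \<open>k0 - e * (1 + s)\<close> is at least
    \<open>k0 / 2\<close> up to time \<open>t\<close> and starts strictly below the minimum of the
    initial curvature.\<close>
  define e where "e = k0 / (2 * (1 + t))"
  have t0: "0 \<le> t" using t by simp
  have e: "0 < e" "e * (1 + t) = k0 / 2" using k0 t0 by (simp_all add: e_def field_simps)
  define H where "H s w = ka s w - k0 + e * (1 + s)" for s w
  obtain u0 where u0: "u0 \<in> {0..P}" "ka t u0 = ka t u" using periodic_representative[of "ka t" P u, OF ka_per[OF t] P_pos] by blast
  obtain s w where sw: "0 < s" "s \<le> t" "w \<in> {0..P}" "H s w = 0"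
    and before: "\<And>r x. x \<in> {0..P} \<Longrightarrow> 0 \<le> r \<Longrightarrow> r < s \<Longrightarrow> 0 < H r x"
    and at: "\<And>x. x \<in> {0..P} \<Longrightarrow> 0 \<le> H s x"
  proof (rule first_touch_compact[of "{0..P}" t H u0])
    show "continuous_on ({0..t} \<times> {0..P}) (\<lambda>(s, w). H s w)"
      using kc[of "{0..P}"] unfolding H_def case_prod_unfold by (intro continuous_intros)
    show "0 < H 0 w" if "w \<in> {0..P}" for w using u1(2)[OF that] e(1) by (simp add: H_def k0_def)
    show "H t u0 \<le> 0" using neg u0(2) e(2) k0 by (simp add: H_def)
  qed (use u0 t0 in auto)
  have s: "s \<in> I" using sw t by auto
  have kpos: "0 < ka s w"
  proof -
    have "e * (1 + s) \<le> e * (1 + t)" using sw e by (intro mult_left_mono) auto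
    then show ?thesis using sw(4) e(2) k0 by (simp add: H_def)
  qed
  have min: "- ka s x \<le> - ka s w" for x
  proof -
    obtain y where y: "y \<in> {0..P}" "ka s y = ka s x" using periodic_representative[of "ka s" P x, OF ka_per[OF s] P_pos] by blast
    then show ?thesis using at[OF y(1)] sw(4) by (simp add: H_def)
  qed
  have d1: "((\<lambda>u. - ka s u) has_real_derivative - du ka s x) (at x)" for x
    by (rule DERIV_minus[OF ka_u[OF s]])
  have d2: "((\<lambda>u. - du ka s u) has_real_derivative - du (du ka) s w) (at w)"
    by (rule DERIV_minus[OF space_smooth_du(1)[OF space_smooth_du(2)[OF ka_smooth] s]])
  have mx: "du ka s w = 0" "0 \<le> du (du ka) s w"
    using second_deriv_nonpos_at_max[OF d1 d2 min] by auto
  \<comment> \<open>\<open>h\<close> is \<open>A\<close> times the first derivative of the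
    curvature, which vanishes at the minimum, so the derivative of \<open>h\<close> there reduces to
    \<open>A\<close> times the second derivative.\<close>
  define A where "A t u = ka t u ^ (p - 1) * inverse (v t u)" for t u
  have A: "space_smooth I A" unfolding A_def[abs_def]
    by (intro space_smooth_intros(3) space_smooth_power ka_smooth inv_v_smooth)
  have hA: "h s = (\<lambda>u. A s u * du ka s u)"
    using du_f_ka[OF s] by (auto simp: h_def A_def)
  have "(h s has_real_derivative du A s w * du ka s w + du (du ka) s w * A s w) (at w)"
    unfolding hA by (rule DERIV_mult[OF space_smooth_du(1)[OF A s] space_smooth_du(1)[OF space_smooth_du(2)[OF ka_smooth] s]])
  then have "du h s w = du (du ka) s w * A s w"
    using mx(1) DERIV_imp_deriv by (simp add: du_def[of h])
  moreover have "0 < A s w" using kpos v_pos[OF s] by (simp add: A_def)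
  ultimately have "0 \<le> du h s w * inverse (v s w)" using mx(2) v_pos[OF s, of w] by simp
  moreover have "0 \<le> f s w * (ka s w)\<^sup>2" using kpos by (simp add: f_def)
  moreover have "0 \<le> - ((du h s w * inverse (v s w) + f s w * (ka s w)\<^sup>2) + e)"
  proof (rule deriv_nonneg_at_left_max[where f="\<lambda>s. - H s w" and t=s and T=T])
    show "((\<lambda>s. - H s w) has_real_derivative - ((du h s w * inverse (v s w) + f s w * (ka s w)\<^sup>2) + e)) (at s within {0..<T})"
      unfolding H_def by (auto intro!: derivative_eq_intros ka_t[OF s])
    show "- H r w \<le> - H s w" if "0 \<le> r" "r < s" for r using before[OF sw(3) that] sw(4) by simp
  qed (use sw s in auto)
  ultimately show False using e(1) by linarith
qed

lemma g_pos: "t \<in> I \<Longrightarrow> 0 < g t u"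
  by (simp add: g_ka ka_pos v_pos)

text \<open>The normal angle is built by integrating its rate of change from the initial angle,
  which gives regularity in time at once; \<open>th_cis\<close> identifies it as a lift.\<close>

definition th :: "real \<Rightarrow> real \<Rightarrow> real" where
  "th t u = \<theta>0 u + integral {0..t} (\<lambda>s. h s u)"

lemma h_cont_t: "continuous_on I (\<lambda>s. h s u)"
proof -
  have "continuous_on I (\<lambda>s. (\<lambda>(s, u). h s u) (s, u))"
    by (rule continuous_on_compose2[OF space_smooth_cont[OF h_smooth]]) (auto intro!: continuous_intros)
  then show ?thesis by simp
qed

lemma th_t:
  assumes t: "t \<in> I"
  shows "((\<lambda>s. th s u) has_real_derivative h t u) (at t within I)"
  unfolding th_def using DERIV_add[OF DERIV_const integral_has_derivative_Ico[OF h_cont_t t]] by fastforce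

text \<open>The tangent rotated back by the constructed angle has derivative zero in time, so it
  keeps its initial value \<open>\<i>\<close>.\<close>

lemma th_cis:
  assumes t: "t \<in> I"
  shows "cis (th t u) = - \<i> * sgn (D 0 1 t u)"
proof -
  define Q where "Q s = sgn (D 0 1 s u) * cis (- th s u)" for s
  have "(Q has_vector_derivative 0) (at s within I)" if s: "s \<in> I" for s
  proof -
    from cis_has_vector_derivative[OF DERIV_minus[OF th_t[OF s, of u]]]
    have "((\<lambda>s. cis (- th s u)) has_vector_derivative \<i> * of_real (- h s u) * cis (- th s u)) (at s within I)" .
    from has_vector_derivative_mult[OF sgn_t[OF s, of u] this]
    show ?thesis by (simp add: Q_def[abs_def])
  qed
  then obtain c where c: "\<And>s. s \<in> I \<Longrightarrow> Q s = c"
    using has_vector_derivative_zero_constant[of I Q] by auto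
  have z: "0 \<in> I" using T0 by simp
  have "- \<i> * sgn (D 0 1 0 u) = cis (\<theta>0 u)"
    using angle0 outward_normal_eq[OF z, of u] by (simp add: normal_angle_def X0)
  then have "Q 0 = \<i> * (cis (\<theta>0 u) * cis (- \<theta>0 u))"
    by (simp add: Q_def th_def) (metis (no_types, lifting) mult.assoc complex_i_mult_minus minus_mult_minus mult_minus_left mult_minus_right minus_minus)
  then have "Q t = \<i>" using c[OF t] c[OF z] by (simp add: cis_mult)
  then have "sgn (D 0 1 t u) * cis (- th t u) * cis (th t u) = \<i> * cis (th t u)" by (simp add: Q_def)
  then have "sgn (D 0 1 t u) = \<i> * cis (th t u)" by (simp add: mult.assoc cis_mult)
  then show ?thesis by simp
qed

lemma th_u:
  assumes t: "t \<in> I"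
  shows "(th t has_real_derivative g t u) (at u)"
proof -
  have "continuous_on UNIV (\<lambda>u. integral (cbox 0 t) (\<lambda>s. h s u))"
  proof (rule integral_continuous_on_param)
    have "continuous_on (UNIV \<times> cbox 0 t) (\<lambda>x. (\<lambda>(s, u). h s u) (snd x, fst x))"
      by (rule continuous_on_compose2[OF space_smooth_cont[OF h_smooth]])
         (use t in \<open>auto intro!: continuous_intros\<close>)
    then show "continuous_on (UNIV \<times> cbox 0 t) (\<lambda>(u, s). h s u)" by (simp add: case_prod_unfold)
  qed
  then have "continuous_on UNIV (th t)"
    using angle0 unfolding th_def[abs_def] normal_angle_def by (auto intro!: continuous_intros)
  then have c: "continuous (at u within UNIV) (th t)" by (simp add: continuous_on_eq_continuous_within)
  show ?thesis
  proof (rule lift_has_derivative[OF c])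
    have "((\<lambda>u. - \<i> * sgn (D 0 1 t u)) has_vector_derivative - \<i> * (\<i> * of_real (g t u) * sgn (D 0 1 t u))) (at u)"
      by (rule has_vector_derivative_mult_right[OF sgn_u[OF t]])
    then show "((\<lambda>s. cis (th t s)) has_vector_derivative \<i> * of_real (g t u) * cis (th t u)) (at u)"
      unfolding th_cis[OF t] by (simp add: mult_ac)
  qed simp
qed

lemma th_shift:
  assumes t: "t \<in> I"
  shows "th t (u + P) = th t u + P"
proof -
  have "integral {0..t} (\<lambda>s. h s (u + P)) = integral {0..t} (\<lambda>s. h s u)"
    by (rule integral_cong) (use h_per t in auto)
  then show ?thesis using angle0_shift[of u] by (simp add: th_def)
qed

lemma th_strict_mono:
  assumes t: "t \<in> I" and "a < b"
  shows "th t a < th t b"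
  by (rule DERIV_pos_imp_increasing[OF \<open>a < b\<close>]) (use th_u[OF t] g_pos[OF t] in blast)

lemma th_cont: "t \<in> I \<Longrightarrow> continuous_on S (th t)"
  by (meson th_u DERIV_isCont continuous_at_imp_continuous_on)

lemma th_surj:
  assumes t: "t \<in> I"
  shows "\<exists>u. th t u = x"
proof -
  have sh: "th t (real n * P) = th t 0 + real n * P" "th t (- (real n * P)) = th t 0 - real n * P" for n
  proof (induction n)
    case (Suc n)
    have "real (Suc n) * P = real n * P + P" by (simp add: algebra_simps)
    then show "th t (real (Suc n) * P) = th t 0 + real (Suc n) * P"
      using th_shift[OF t, of "real n * P"] Suc by simp
    have e: "- (real (Suc n) * P) + P = - (real n * P)" by (simp add: algebra_simps)
    show "th t (- (real (Suc n) * P)) = th t 0 - real (Suc n) * P"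
      using th_shift[OF t, of "- (real (Suc n) * P)"] Suc unfolding e by (simp add: algebra_simps)
  qed auto
  obtain n where "\<bar>x - th t 0\<bar> / P < real n" using reals_Archimedean2 by blast
  then have "\<bar>x - th t 0\<bar> < real n * P" using P_pos by (simp only: pos_divide_less_eq)
  then have "th t (- (real n * P)) \<le> x" "x \<le> th t (real n * P)" using sh[of n] by linarith+
  moreover have "- (real n * P) \<le> real n * P" using P_pos by (simp add: mult_nonneg_nonneg)
  ultimately show ?thesis using IVT'[of "th t" "- (real n * P)" x "real n * P"] th_cont[OF t] by blast
qed

lemma th_inj: "t \<in> I \<Longrightarrow> inj (th t)"
  by (rule injI) (metis less_irrefl linorder_neqE_linordered_idom th_strict_mono)

section \<open>The normal angle as parameter\<close>

definition U :: "real \<Rightarrow> real \<Rightarrow> real" where "U t x = inv (th t) x"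

lemma th_U: "t \<in> I \<Longrightarrow> th t (U t x) = x"
  unfolding U_def using th_surj[of t x] by (intro f_inv_into_f) auto

lemma U_th: "t \<in> I \<Longrightarrow> U t (th t u) = u"
  unfolding U_def by (rule inv_f_f[OF th_inj])

lemma U_shift: "t \<in> I \<Longrightarrow> U t (x + P) = U t x + P"
  using U_th[of t "U t x + P"] th_shift[of t "U t x"] th_U[of t x] by simp

lemma th_less_iff: "t \<in> I \<Longrightarrow> th t a < th t b \<longleftrightarrow> a < b"
  by (metis less_asym linorder_neqE_linordered_idom th_strict_mono)

lemma th_cont_t: "continuous_on I (\<lambda>s. th s u)"
  using th_t by (meson DERIV_continuous continuous_on_eq_continuous_within)

text \<open>By monotonicity, \<open>a < U s w < b\<close> is equivalent to
  \<open>th s a < w < th s b\<close>, and the latter is an open condition on \<open>(s, w)\<close>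
  because \<open>th\<close> is continuous in time at fixed parameters.\<close>

lemma U_cont: "continuous_on (I \<times> UNIV) (\<lambda>(t, x). U t x)"
  unfolding continuous_on_def
proof (intro ballI)
  fix y assume "y \<in> I \<times> (UNIV :: real set)"
  then obtain t x where y: "y = (t, x)" "t \<in> I" by auto
  have "((\<lambda>(t, x). U t x) \<longlongrightarrow> U t x) (at (t, x) within I \<times> UNIV)"
  proof (rule tendstoI)
    fix e :: real assume e: "0 < e"
    define a where "a = U t x - e / 2"
    define b where "b = U t x + e / 2"
    have ab: "th t a < x" "x < th t b"
      using th_strict_mono[OF y(2), of a "U t x"] th_strict_mono[OF y(2), of "U t x" b] th_U[OF y(2), of x] e
      by (simp_all add: a_def b_def)
    have lim: "((\<lambda>z. th (fst z) c) \<longlongrightarrow> th t c) (at (t, x) within I \<times> UNIV)" for c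
    proof -
      have "continuous_on (I \<times> UNIV) (\<lambda>z. th (fst z) c)"
        by (rule continuous_on_compose2[OF th_cont_t]) (auto intro!: continuous_intros)
      then have "((\<lambda>z. th (fst z) c) \<longlongrightarrow> th (fst (t, x)) c) (at (t, x) within I \<times> UNIV)"
        using y(2) unfolding continuous_on_def by blast
      then show ?thesis by simp
    qed
    have limx: "(snd \<longlongrightarrow> x) (at (t, x) within I \<times> UNIV)"
      using tendsto_snd[OF tendsto_ident_at, of "(t, x)" "I \<times> UNIV"] by simp
    have "\<forall>\<^sub>F z in at (t, x) within I \<times> UNIV. 0 < snd z - th (fst z) a"
      using order_tendstoD(1)[OF tendsto_diff[OF limx lim[of a]], of 0] ab by simp
    moreover have "\<forall>\<^sub>F z in at (t, x) within I \<times> UNIV. 0 < th (fst z) b - snd z"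
      using order_tendstoD(1)[OF tendsto_diff[OF lim[of b] limx], of 0] ab by simp
    moreover have "\<forall>\<^sub>F z in at (t, x) within I \<times> UNIV. z \<in> I \<times> UNIV" by (simp add: eventually_at_filter)
    ultimately show "\<forall>\<^sub>F z in at (t, x) within I \<times> UNIV. dist ((\<lambda>(t, x). U t x) z) (U t x) < e"
    proof eventually_elim
      case (elim z)
      obtain s w where z: "z = (s, w)" by (cases z)
      have s: "s \<in> I" using elim z by simp
      have "th s a < th s (U s w)" "th s (U s w) < th s b" using elim th_U[OF s, of w] by (simp_all add: z)
      then have "a < U s w" "U s w < b" using th_less_iff[OF s] by auto
      then show ?case using e by (simp add: z dist_real_def a_def b_def)
    qed
  qed
  then show "((\<lambda>(t, x). U t x) \<longlongrightarrow> (case y of (t, x) \<Rightarrow> U t x)) (at y within I \<times> UNIV)" by (simp add: y)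
qed

lemma U_x:
  assumes t: "t \<in> I"
  shows "(U t has_real_derivative inverse (g t (U t x))) (at x)"
proof (rule DERIV_inverse_function[where f="th t" and a="x - 1" and b="x + 1"])
  show "(th t has_real_derivative g t (U t x)) (at (U t x))" by (rule th_u[OF t])
  show "g t (U t x) \<noteq> 0" using g_pos[OF t, of "U t x"] by simp
  have "continuous_on UNIV (\<lambda>y. (\<lambda>(t, x). U t x) (t, y))"
    by (rule continuous_on_compose2[OF U_cont]) (use t in \<open>auto intro!: continuous_intros\<close>)
  then show "isCont (U t) x" by (simp add: continuous_on_eq_continuous_at)
qed (use th_U[OF t] in auto)

lemma U_t:
  assumes t: "t \<in> I"
  shows "((\<lambda>s. U s x) has_real_derivative - h t (U t x) / g t (U t x)) (at t within I)"
proof (rule implicit_inverse_derivative[where F=th and Fu=g and x=x])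
  have "continuous_on I (\<lambda>s. (\<lambda>(t, x). U t x) (s, x))"
    by (rule continuous_on_compose2[OF U_cont]) (auto intro!: continuous_intros)
  then show "continuous (at t within I) (\<lambda>s. U s x)" using t by (simp add: continuous_on_eq_continuous_within)
  show "g t (U t x) \<noteq> 0" using g_pos[OF t, of "U t x"] by simp
qed (use th_u th_t th_U space_smooth_cont[OF g_smooth] t in auto)

text \<open>Iterates of the derivative in the normal angle, expressed in the original
  parameter.\<close>

primrec angle_deriv :: "(real \<Rightarrow> real \<Rightarrow> real) \<Rightarrow> nat \<Rightarrow> real \<Rightarrow> real \<Rightarrow> real" where
  "angle_deriv F 0 = F"
| "angle_deriv F (Suc j) = (\<lambda>t u. du (angle_deriv F j) t u * inverse (g t u))"

lemma inv_g_smooth: "space_smooth I (\<lambda>t u. inverse (g t u))"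
  by (intro space_smooth_intros g_smooth less_imp_neq[OF g_pos, THEN not_sym])

lemma angle_deriv_smooth: "space_smooth I F \<Longrightarrow> space_smooth I (angle_deriv F j)"
  by (induction j) (auto intro: space_smooth_intros(3) space_smooth_du inv_g_smooth)

lemma angle_deriv_x:
  assumes F: "space_smooth I F" and t: "t \<in> I"
  shows "((\<lambda>x. angle_deriv F j t (U t x)) has_real_derivative angle_deriv F (Suc j) t (U t x)) (at x)"
  using DERIV_chain2[OF space_smooth_du(1)[OF angle_deriv_smooth[OF F] t] U_x[OF t]] by simp

lemma comp_U_cont:
  assumes "continuous_on (I \<times> UNIV) (\<lambda>(t, u). F t u)"
  shows "continuous_on (I \<times> UNIV) (\<lambda>(t, x). F t (U t x))"
proof -
  have "continuous_on (I \<times> UNIV) (\<lambda>z. (\<lambda>(t, u). F t u) (fst z, (\<lambda>(t, x). U t x) z))"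
    by (rule continuous_on_compose2[OF assms])
       (auto intro!: continuous_on_Pair continuous_on_fst continuous_on_id U_cont)
  then show ?thesis by (simp add: case_prod_unfold)
qed

definition kk :: "nat \<Rightarrow> real \<Rightarrow> real \<Rightarrow> real" where
  "kk j t x = angle_deriv ka j t (U t x)"

lemma kk_cont: "continuous_on (I \<times> UNIV) (\<lambda>(t, x). kk j t x)"
  unfolding kk_def by (intro comp_U_cont space_smooth_cont angle_deriv_smooth ka_smooth)

lemma kk_dx: "t \<in> I \<Longrightarrow> (kk j t has_real_derivative kk (Suc j) t x) (at x)"
  unfolding kk_def[abs_def] by (rule angle_deriv_x[OF ka_smooth])

lemma kk_pos: "t \<in> I \<Longrightarrow> 0 < kk 0 t x"
  by (simp add: kk_def ka_pos)

lemma kk_per: "t \<in> I \<Longrightarrow> kk 0 t (x + P) = kk 0 t x"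
  by (simp add: kk_def U_shift ka_per)

text \<open>Time derivative at fixed angle instead of fixed parameter. With
  \<open>h = k ^ p * k\<^sub>\<theta>\<close>, the motion of the point of given angle contributes
  \<open>- k ^ p * k\<^sub>\<theta>\<^sup>2\<close>, which lowers the coefficient of the gradient
  term from \<open>p\<close> to \<open>p - 1\<close>.\<close>

lemma kk_dt:
  assumes t: "t \<in> I"
  shows "((\<lambda>s. kk 0 s x) has_real_derivative
     kk 0 t x ^ (p + 1) * kk 2 t x + real (p - 1) * (kk 0 t x ^ p * (kk 1 t x)\<^sup>2) + kk 0 t x ^ (p + 2) / real p) (at t within I)"
proof -
  define u where "u = U t x"
  define k where "k = ka t u"
  define E1 where "E1 = angle_deriv ka 1 t u"
  define E2 where "E2 = angle_deriv ka 2 t u"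
  have gp: "0 < g t w" "0 < v t w" "0 < ka t w" for w using g_pos[OF t] v_pos[OF t] ka_pos[OF t] by auto
  have e1: "du ka t w = angle_deriv ka 1 t w * g t w" for w
    using gp(1)[of w] by simp
  have "du (angle_deriv ka 1) t u * inverse (g t u) = E2" by (simp add: E2_def numeral_2_eq_2)
  then have e2: "du (angle_deriv ka 1) t u = E2 * g t u" using gp(1)[of u] by (simp add: field_simps)
  have hE: "h t w = ka t w ^ p * angle_deriv ka 1 t w" for w
  proof -
    have "h t w = ka t w ^ (p - 1) * (angle_deriv ka 1 t w * (ka t w * v t w)) * inverse (v t w)"
      unfolding h_def du_f_ka[OF t] e1 by (simp only: g_ka[OF t])
    also have "\<dots> = (ka t w ^ (p - 1) * ka t w) * angle_deriv ka 1 t w"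
      using gp(2)[of w] by simp
    also have "ka t w ^ (p - 1) * ka t w = ka t w ^ p" using p1 by (simp add: power_eq_if)
    finally show ?thesis .
  qed
  have "((\<lambda>w. ka t w ^ p * angle_deriv ka 1 t w) has_real_derivative
      (real p * (k ^ (p - 1) * (E1 * g t u))) * E1 + (E2 * g t u) * k ^ p) (at u)"
  proof -
    have A: "((\<lambda>w. ka t w ^ p) has_real_derivative real p * (k ^ (p - 1) * (E1 * g t u))) (at u)"
    proof -
      have due: "du ka t u = E1 * g t u" unfolding E1_def by (rule e1)
      show ?thesis using DERIV_power[OF ka_u[OF t, of u], of p] unfolding due by (simp add: k_def mult_ac)
    qed
    have B: "(angle_deriv ka 1 t has_real_derivative E2 * g t u) (at u)"
      using space_smooth_du(1)[OF angle_deriv_smooth[OF ka_smooth] t, of 1 u] e2 by simp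
    show ?thesis using DERIV_mult[OF A B] by (simp only: k_def E1_def)
  qed
  moreover have "h t = (\<lambda>w. ka t w ^ p * angle_deriv ka 1 t w)" using hE by auto
  ultimately have "(h t has_real_derivative
      (real p * (k ^ (p - 1) * (E1 * g t u))) * E1 + (E2 * g t u) * k ^ p) (at u)" by simp
  then have duh: "du h t u = (real p * (k ^ (p - 1) * (E1 * g t u))) * E1 + (E2 * g t u) * k ^ p"
    unfolding du_def by (rule DERIV_imp_deriv)
  have kkp: "k ^ (p - 1) * k = k ^ p" using p1 by (simp add: power_eq_if)
  have "((\<lambda>s. ka s (U s x)) has_real_derivative
      (du h t (U t x) * inverse (v t (U t x)) + f t (U t x) * (ka t (U t x))\<^sup>2) + du ka t (U t x) * (- h t (U t x) / g t (U t x))) (at t within I)"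
  proof (rule family_chain_rule[where F=ka and Fu="du ka"])
    show "continuous_on (I \<times> UNIV) (\<lambda>(s, u). du ka s u)"
      by (rule space_smooth_cont[OF space_smooth_du(2)[OF ka_smooth]])
  qed (use ka_u ka_t[OF t] U_t[OF t] t in auto)
  moreover have "(du h t u * inverse (v t u) + f t u * (ka t u)\<^sup>2) + du ka t u * (- h t u / g t u) =
     k ^ (p + 1) * E2 + real (p - 1) * (k ^ p * E1\<^sup>2) + k ^ (p + 2) / real p"
  proof -
    have "du h t u * inverse (v t u) = real p * (k ^ p * E1\<^sup>2) + k ^ (p + 1) * E2"
      unfolding duh g_ka[OF t] k_def[symmetric] kkp[symmetric] using gp(2)[of u] p1
      by (simp add: power2_eq_square field_simps power_eq_if)
    moreover have "f t u * (ka t u)\<^sup>2 = k ^ (p + 2) / real p"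
      by (simp add: f_def k_def power_add power2_eq_square)
    moreover have "du ka t u * (- h t u / g t u) = - (k ^ p * E1\<^sup>2)"
      unfolding e1 hE E1_def[symmetric] k_def[symmetric] using gp(1)[of u] by (simp add: power2_eq_square)
    moreover have "real p * (k ^ p * E1\<^sup>2) = real (p - 1) * (k ^ p * E1\<^sup>2) + k ^ p * E1\<^sup>2"
    proof -
      have "real p = real (p - 1) + 1" using p1 by simp
      then have "real p * c = real (p - 1) * c + c" for c by (metis distrib_right mult_1)
      then show ?thesis .
    qed
    ultimately show ?thesis by linarith
  qed
  ultimately show ?thesis
    by (simp only: kk_def u_def k_def E1_def E2_def angle_deriv.simps(1))
qed

end

subsection \<open>Analyticity from exponentially decaying Fourier coefficients\<close>

lemma summable_exp_int:
  fixes a :: real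
  assumes a: "0 < a"
  shows "(\<lambda>q::int. exp (- (a * \<bar>of_int q\<bar>))) summable_on UNIV"
proof -
  have e: "exp (- (a * real n)) = exp (- a) ^ n" for n
    by (simp add: exp_of_nat_mult[symmetric] mult.commute)
  have "summable (\<lambda>n. exp (- a) ^ n)" using a by (intro summable_geometric) simp
  then have "(\<lambda>n::nat. exp (- (a * real n))) summable_on UNIV"
    unfolding e by (intro summable_nonneg_imp_summable_on) auto
  from summable_on_int_even[OF this] show ?thesis by simp
qed

text \<open>In the strip of half-width \<open>a / (2 * lam)\<close> the characters grow at most like
  \<open>exp (a / 2 * |q|)\<close>, half of the assumed decay, so the series converges uniformly
  there.\<close>

lemma fourier_holomorphic_extension:
  fixes x0 :: real
  assumes lam: "0 < lam" and a: "0 < a" and decay: "\<And>q. norm (f q) \<le> B * exp (- (a * \<bar>of_int q\<bar>))"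
    and rep: "fourier_rep lam f F"
  obtains G where "G holomorphic_on ball (of_real x0) (a / (2 * lam))" "\<And>y. G (complex_of_real y) = F y"
proof -
  define r where "r = a / (2 * lam)"
  have r: "0 < r" using lam a by (simp add: r_def)
  define e where "e q \<zeta> = f q * exp (\<i> * of_real (lam * of_int q) * \<zeta>)" for q and \<zeta> :: complex
  define G where "G \<zeta> = (\<Sum>\<^sub>\<infinity>q. e q \<zeta>)" for \<zeta>
  have B0: "0 \<le> B" using order_trans[OF norm_ge_zero decay[of 0]] by simp
  have "uniform_limit (cball (of_real x0) r) (\<lambda>Y \<zeta>. \<Sum>q\<in>Y. e q \<zeta>) G (finite_subsets_at_top UNIV)"
    unfolding G_def
  proof (rule Weierstrass_m_test_general[where M="\<lambda>q. B * exp (- (a / 2 * \<bar>of_int q\<bar>))"])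
    fix q \<zeta> assume "\<zeta> \<in> cball (complex_of_real x0) r"
    then have "\<bar>Im \<zeta>\<bar> \<le> r"
      using abs_Im_le_cmod[of "of_real x0 - \<zeta>"] by (simp add: dist_norm)
    then have "lam * \<bar>of_int q\<bar> * \<bar>Im \<zeta>\<bar> \<le> lam * \<bar>of_int q\<bar> * r"
      using lam by (intro mult_left_mono) auto
    also have "\<dots> = a / 2 * \<bar>of_int q\<bar>" using lam by (simp add: r_def)
    finally have "- (lam * of_int q * Im \<zeta>) \<le> a / 2 * \<bar>of_int q\<bar>"
      using abs_ge_minus_self[of "lam * of_int q * Im \<zeta>"] lam by (simp add: abs_mult)
    then have "norm (exp (\<i> * of_real (lam * of_int q) * \<zeta>)) \<le> exp (a / 2 * \<bar>of_int q\<bar>)" by simp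
    then have "norm (e q \<zeta>) \<le> (B * exp (- (a * \<bar>of_int q\<bar>))) * exp (a / 2 * \<bar>of_int q\<bar>)"
      unfolding e_def norm_mult using decay[of q] B0 by (intro mult_mono) auto
    also have "\<dots> = B * exp (- (a / 2 * \<bar>of_int q\<bar>))"
      by (simp add: exp_add[symmetric] mult.assoc)
    finally show "norm (e q \<zeta>) \<le> B * exp (- (a / 2 * \<bar>of_int q\<bar>))" .
  next
    show "(\<lambda>q. B * exp (- (a / 2 * \<bar>of_int q\<bar>))) summable_on UNIV"
      using a by (intro summable_on_cmult_right summable_exp_int) auto
  qed
  then have "G holomorphic_on ball (of_real x0) r"
    by (rule holomorphic_uniform_limit[rotated])
       (auto intro!: always_eventually continuous_intros holomorphic_intros simp: e_def)
  moreover have "G (of_real y) = F y" for y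
  proof -
    have "e q (of_real y) = f q * echar lam q y" for q
      by (simp add: e_def echar_def cis_conv_exp mult.assoc)
    then show ?thesis
      using infsumI[OF fourier_rep_has_sum[OF rep, of y]] by (simp add: G_def)
  qed
  ultimately show thesis using that unfolding r_def by blast
qed

text \<open>The derivative extends holomorphically near each real point, because the extension of
  \<open>k\<close> has no zeros in a small disc. A primitive differs from \<Gamma> on the real axis
  by a constant, which goes into the zeroth coefficient of the power series.\<close>

lemma real_analytic_of_deriv:
  fixes \<Gamma> :: "real \<Rightarrow> complex" and k :: "real \<Rightarrow> real"
  assumes lam: "0 < lam" and a: "0 < a" and decay: "\<And>q. norm (f q) \<le> B * exp (- (a * \<bar>of_int q\<bar>))"
    and rep: "fourier_rep lam f (\<lambda>x. of_real (k x))" and pos: "\<And>x. 0 < k x"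
    and der: "\<And>x. (\<Gamma> has_vector_derivative c * cis x / of_real (k x)) (at x)"
  shows "real_analytic \<Gamma>"
  unfolding real_analytic_def
proof
  fix x0
  obtain G where G: "G holomorphic_on ball (of_real x0) (a / (2 * lam))" "\<And>y. G (complex_of_real y) = of_real (k y)"
    using fourier_holomorphic_extension[OF lam a decay rep] by metis
  have r0: "0 < a / (2 * lam)" using lam a by simp
  have "isCont G (of_real x0)"
    using holomorphic_on_imp_continuous_on[OF G(1)] r0 by (simp add: continuous_on_interior)
  moreover have "G (of_real x0) \<noteq> 0" using G(2)[of x0] pos[of x0] by simp
  ultimately obtain d where d: "0 < d" "\<And>\<zeta>. dist (of_real x0) \<zeta> < d \<Longrightarrow> G \<zeta> \<noteq> 0"
    using continuous_at_avoid[of "of_real x0" G 0] by blast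
  define r where "r = min d (a / (2 * lam))"
  have r: "0 < r" using d r0 by (simp add: r_def)
  define S where "S = ball (complex_of_real x0) r"
  have nz: "\<And>\<zeta>. \<zeta> \<in> S \<Longrightarrow> G \<zeta> \<noteq> 0" using d by (simp add: S_def r_def)
  have hol: "(\<lambda>\<zeta>. c * exp (\<i> * \<zeta>) / G \<zeta>) holomorphic_on S"
    using nz by (intro holomorphic_intros holomorphic_on_subset[OF G(1)]) (auto simp: S_def r_def)
  obtain H where H: "\<And>\<zeta>. \<zeta> \<in> S \<Longrightarrow> (H has_field_derivative c * exp (\<i> * \<zeta>) / G \<zeta>) (at \<zeta> within S)"
    by (rule holomorphic_convex_primitive'[OF _ _ hol]) (auto simp: S_def)
  have Hol: "H holomorphic_on ball (of_real x0) r"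
    using H unfolding holomorphic_on_def field_differentiable_def S_def by blast
  define A where "A n = (deriv ^^ n) H (of_real x0) / fact n" for n
  have inS: "of_real y \<in> S \<longleftrightarrow> y \<in> ball x0 r" for y
    by (simp add: S_def dist_real_def dist_norm flip: of_real_diff)
  have ps: "(\<lambda>n. A n * (of_real y - of_real x0) ^ n) sums H (of_real y)" if "y \<in> ball x0 r" for y
    using holomorphic_power_series[OF Hol, of "of_real y"] inS[of y] that by (simp add: A_def S_def)
  have "((\<lambda>y. \<Gamma> y - H (of_real y)) has_vector_derivative 0) (at y within ball x0 r)" if y: "y \<in> ball x0 r" for y
  proof -
    have "(H has_field_derivative c * exp (\<i> * of_real y) / G (of_real y)) (at (of_real y))"
      using H[of "of_real y"] inS[of y] y at_within_open[of "of_real y" S] by (simp add: S_def)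
    from field_vector_diff_chain_within[OF has_vector_derivative_of_real[OF DERIV_ident] has_field_derivative_at_within[OF this]]
    have "((\<lambda>y. H (of_real y)) has_vector_derivative c * cis y / of_real (k y)) (at y within ball x0 r)"
      by (simp add: o_def G(2) cis_conv_exp)
    from has_vector_derivative_diff[OF has_vector_derivative_at_within[OF der] this] show ?thesis by simp
  qed
  then obtain c0 where c0: "\<And>y. y \<in> ball x0 r \<Longrightarrow> \<Gamma> y - H (of_real y) = c0"
    using has_vector_derivative_zero_constant[of "ball x0 r" "\<lambda>y. \<Gamma> y - H (of_real y)"] by auto
  show "\<exists>r>0. \<exists>b. \<forall>y. \<bar>y - x0\<bar> < r \<longrightarrow> (\<lambda>j. (y - x0) ^ j *\<^sub>R b j) sums \<Gamma> y"
  proof (intro exI[of _ r] conjI r exI[of _ "\<lambda>j. A j + (if j = 0 then c0 else 0)"] allI impI)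
    fix y assume "\<bar>y - x0\<bar> < r"
    then have y: "y \<in> ball x0 r" by (simp add: dist_real_def abs_minus_commute)
    have "(\<lambda>j. A j * (of_real y - of_real x0) ^ j + (if j = 0 then c0 else 0)) sums (H (of_real y) + c0)"
      by (intro sums_add ps[OF y] sums_single)
    moreover have "(\<lambda>j. A j * (of_real y - of_real x0) ^ j + (if j = 0 then c0 else 0)) =
       (\<lambda>j. (y - x0) ^ j *\<^sub>R (A j + (if j = 0 then c0 else 0)))"
      by (auto simp: fun_eq_iff scaleR_conv_of_real)
    moreover have "H (of_real y) + c0 = \<Gamma> y" using c0[OF y] by (simp add: diff_eq_eq add.commute)
    ultimately show "(\<lambda>j. (y - x0) ^ j *\<^sub>R (A j + (if j = 0 then c0 else 0))) sums \<Gamma> y" by simp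
  qed
qed

subsection \<open>Initial data\<close>

lemma perturbed_circle_shift:
  assumes "\<And>u. \<phi> (u + L) = \<phi> u"
  shows "perturbed_circle \<phi> \<delta> (u + L) = cis L * perturbed_circle \<phi> \<delta> u"
  unfolding perturbed_circle_def assms by (simp add: cis_mult[symmetric] scaleR_conv_of_real algebra_simps)

text \<open>The velocity is \<open>\<i> * r u * cis u\<close> with
  \<open>Re (r u) = 1 + \<delta> * \<phi> u > 0\<close>. So the principal argument of
  \<open>r\<close> is continuous and periodic, and \<theta> differs from \<open>u\<close> plus this
  argument by a constant.\<close>

lemma perturbed_circle_angle_shift:
  assumes sm: "smooth_fun \<phi>" and per: "\<And>u. \<phi> (u + L) = \<phi> u" and pos: "\<And>u. 0 < 1 + \<delta> * \<phi> u"
    and ang: "normal_angle (perturbed_circle \<phi> \<delta>) \<theta>"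
  shows "\<theta> (u + L) = \<theta> u + L"
proof -
  obtain D where D: "D 0 = \<phi>" "\<And>j x. (D j has_vector_derivative D (Suc j) x) (at x)"
    using sm unfolding smooth_fun_def by blast
  define \<phi>' where "\<phi>' = D 1"
  have d\<phi>: "(\<phi> has_real_derivative \<phi>' x) (at x)" for x
    using D(2)[of 0 x] D(1) by (simp add: \<phi>'_def has_real_derivative_iff_has_vector_derivative)
  have c\<phi>: "continuous_on UNIV \<phi>" using d\<phi> by (meson DERIV_isCont continuous_at_imp_continuous_on)
  have c\<phi>': "continuous_on UNIV \<phi>'"
    using D(2)[of 1] unfolding \<phi>'_def by (meson has_vector_derivative_continuous continuous_at_imp_continuous_on)
  have per': "\<phi>' (x + L) = \<phi>' x" for x
  proof -
    have "((\<lambda>x. \<phi> (x + L)) has_real_derivative \<phi>' (x + L)) (at x)"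
      by (subst DERIV_shift[symmetric]) (rule d\<phi>)
    moreover have "(\<lambda>x. \<phi> (x + L)) = \<phi>" using per by auto
    ultimately show ?thesis using d\<phi>[of x] DERIV_unique by metis
  qed
  define r where "r u = Complex (1 + \<delta> * \<phi> u) (- (\<delta> * \<phi>' u))" for u
  have rpos: "r u \<notin> \<real>\<^sub>\<le>\<^sub>0" "r u \<noteq> 0" for u
    using pos[of u] by (auto simp: r_def complex_nonpos_Reals_iff complex_eq_iff)
  have contr: "continuous_on UNIV r"
    unfolding r_def Complex_eq by (intro continuous_intros c\<phi> c\<phi>')
  have normal: "outward_normal (perturbed_circle \<phi> \<delta>) u = sgn (r u) * cis u" for u
  proof -
    have c1: "(cis has_vector_derivative \<i> * cis u) (at u)"
      using cis_has_vector_derivative[OF DERIV_ident, of u UNIV] by simp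
    have c2: "((\<lambda>u. complex_of_real (\<delta> * \<phi> u)) has_vector_derivative of_real (\<delta> * \<phi>' u)) (at u)"
      by (intro has_vector_derivative_of_real DERIV_cmult d\<phi>)
    have "((\<lambda>u. cis u + of_real (\<delta> * \<phi> u) * cis u) has_vector_derivative
       \<i> * cis u + (of_real (\<delta> * \<phi> u) * (\<i> * cis u) + of_real (\<delta> * \<phi>' u) * cis u)) (at u)"
      by (intro has_vector_derivative_add has_vector_derivative_mult c1 c2)
    moreover have "\<i> * cis u + (of_real (\<delta> * \<phi> u) * (\<i> * cis u) + of_real (\<delta> * \<phi>' u) * cis u) = (\<i> * r u) * cis u"
    proof -
      have "\<i> * r u = \<i> + of_real (\<delta> * \<phi> u) * \<i> + of_real (\<delta> * \<phi>' u)"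
        by (simp add: r_def complex_eq_iff)
      then show ?thesis by (simp only: distrib_right mult.assoc add.assoc)
    qed
    moreover have "(\<lambda>u. cis u + of_real (\<delta> * \<phi> u) * cis u) = perturbed_circle \<phi> \<delta>"
      by (simp add: fun_eq_iff perturbed_circle_def scaleR_conv_of_real)
    ultimately have "vector_derivative (perturbed_circle \<phi> \<delta>) (at u) = (\<i> * r u) * cis u"
      by (simp add: vector_derivative_at)
    moreover have "sgn (\<i> * r u * cis u) = \<i> * (sgn (r u) * cis u)"
      by (simp add: sgn_mult sgn_div_norm norm_mult)
    ultimately show ?thesis by (simp add: outward_normal_def)
  qed
  have "cis (\<theta> u - u - Im (Ln (r u))) = 1" for u
  proof -
    have "cis (\<theta> u) = sgn (r u) * cis u" using ang normal[of u] by (simp add: normal_angle_def)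
    moreover have "sgn (r u) = cis (Im (Ln (r u)))"
      using cis_Arg[OF rpos(2)[of u]] Arg_eq_Im_Ln[OF rpos(2)[of u]] by simp
    ultimately have "cis (\<theta> u) = cis (Im (Ln (r u))) * cis u" by simp
    then have "cis (\<theta> u) * cis (- u) * cis (- Im (Ln (r u))) = cis (Im (Ln (r u))) * cis u * cis (- u) * cis (- Im (Ln (r u)))"
      by simp
    then show ?thesis by (simp add: cis_mult)
  qed
  moreover have "continuous_on UNIV (\<lambda>u. \<theta> u - u - Im (Ln (r u)))"
    using ang rpos(1) unfolding normal_angle_def by (auto intro!: continuous_intros contr)
  ultimately have "\<theta> (u + L) - (u + L) - Im (Ln (r (u + L))) = \<theta> u - u - Im (Ln (r u))"
    by (intro lift_constant[where S=UNIV and d="\<lambda>u. \<theta> u - u - Im (Ln (r u))" and c=1]) auto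
  then show ?thesis by (simp add: r_def per per')
qed

lemma (in curvature_flow) fourier_decay:
  assumes t: "t \<in> {0..<T}"
  obtains B where "0 < B" "\<And>q. (lam * \<bar>of_int q\<bar>) ^ j * norm (y t q) \<le> B"
proof -
  have "compact (kk j t ` {0..L})" by (intro compact_continuous_image cont_x[OF t] compact_Icc)
  from compact_imp_bounded[OF this] obtain B where B: "0 < B" "\<forall>u \<in> kk j t ` {0..L}. norm u \<le> B"
    unfolding bounded_pos by blast
  have "(lam * \<bar>of_int q\<bar>) ^ j * norm (y t q) \<le> B" for q
  proof -
    have "norm (fco lam (\<lambda>x. complex_of_real (kk j t x)) q) \<le> B"
      by (rule norm_fco_le[OF lam]) (use B cont_x[OF t] in \<open>auto intro!: continuous_intros\<close>)
    then show ?thesis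
      unfolding fco_kk[OF t] using lam by (simp add: norm_mult norm_power abs_mult)
  qed
  with B(1) that show thesis by blast
qed

text \<open>The factor 2 comes from adding real and imaginary part. The bound \<open>B\<close> makes
  the suprema in \<open>norm_2\<close> genuine.\<close>

lemma norm_2_upper:
  assumes bd: "\<And>k. (real_of_int k)\<^sup>2 * norm (fourier_coeff lam f k) \<le> B" and q: "q \<noteq> 0"
  shows "(real_of_int q)\<^sup>2 * norm (fourier_coeff lam f q) \<le> 2 * norm_2 lam f"
proof -
  have bR: "bdd_above ((\<lambda>k. \<bar>real_of_int k\<bar>\<^sup>2 * \<bar>Re (fourier_coeff lam f k)\<bar>) ` (- {0}))"
  proof (rule bdd_aboveI2[where M=B])
    show "\<bar>real_of_int k\<bar>\<^sup>2 * \<bar>Re (fourier_coeff lam f k)\<bar> \<le> B" for k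
      using mult_left_mono[OF abs_Re_le_cmod[of "fourier_coeff lam f k"], of "(real_of_int k)\<^sup>2"] bd[of k] by simp
  qed
  have bI: "bdd_above ((\<lambda>k. \<bar>real_of_int k\<bar>\<^sup>2 * \<bar>Im (fourier_coeff lam f k)\<bar>) ` (- {0}))"
  proof (rule bdd_aboveI2[where M=B])
    show "\<bar>real_of_int k\<bar>\<^sup>2 * \<bar>Im (fourier_coeff lam f k)\<bar> \<le> B" for k
      using mult_left_mono[OF abs_Im_le_cmod[of "fourier_coeff lam f k"], of "(real_of_int k)\<^sup>2"] bd[of k] by simp
  qed
  have "\<bar>real_of_int q\<bar>\<^sup>2 * \<bar>Re (fourier_coeff lam f q)\<bar> \<le> norm_2 lam f"
    unfolding norm_2_def by (rule order_trans[OF cSUP_upper[OF _ bR] max.cobounded1]) (use q in simp)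
  moreover have "\<bar>real_of_int q\<bar>\<^sup>2 * \<bar>Im (fourier_coeff lam f q)\<bar> \<le> norm_2 lam f"
    unfolding norm_2_def by (rule order_trans[OF cSUP_upper[OF _ bI] max.cobounded2]) (use q in simp)
  moreover have "(real_of_int q)\<^sup>2 * norm (fourier_coeff lam f q) \<le>
     (real_of_int q)\<^sup>2 * (\<bar>Re (fourier_coeff lam f q)\<bar> + \<bar>Im (fourier_coeff lam f q)\<bar>)"
    by (intro mult_left_mono cmod_le) auto
  ultimately show ?thesis by (simp add: distrib_left)
qed

text \<open>For smooth initial data a weight growing like \<open>|q|\<^sup>l\<close> costs nothing if it is switched on
  slowly enough.\<close>

lemma (in curvature_flow) slow_weight:
  assumes M: "0 < M" and small: "\<And>q. q \<noteq> 0 \<Longrightarrow> (of_int q)\<^sup>2 * norm (z 0 q) \<le> M / 4"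
  obtains \<epsilon> where "0 < \<epsilon>" "\<epsilon> \<le> 1" "\<And>q. q \<noteq> 0 \<Longrightarrow> (of_int q)\<^sup>2 * (1 + \<epsilon> * \<bar>of_int q\<bar>) ^ l * norm (z 0 q) < M"
proof -
  have T0: "0 \<in> {0..<T}" using T by simp
  obtain B where B: "0 < B" "\<And>q. (lam * \<bar>of_int q\<bar>) ^ (l + 3) * norm (y 0 q) \<le> B"
    using fourier_decay[OF T0] by metis
  define D where "D = 2 ^ l * B / (K 0 * lam ^ (l + 3))"
  define Q where "Q = max 1 (D / M)"
  \<comment> \<open>For \<open>|q| \<le> Q\<close> this gives
    \<open>l * \<epsilon> * |q| \<le> 1 / 2\<close>, so the weight is at most
    \<open>exp (1 / 2) \<le> 2\<close>, and \<open>2 * (M / 4) < M\<close>. Beyond \<open>Q\<close>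
    the decay from \<open>l + 3\<close> derivatives takes over.\<close>
  define \<epsilon> where "\<epsilon> = 1 / (2 * Q * (real l + 1))"
  have Q: "1 \<le> Q" "D / M \<le> Q" by (simp_all add: Q_def)
  have e0: "0 < \<epsilon>" using Q by (simp add: \<epsilon>_def)
  have "1 * 1 \<le> (2 * Q) * (real l + 1)" using Q by (intro mult_mono) auto
  then have e1: "\<epsilon> \<le> 1" by (simp add: \<epsilon>_def)
  show thesis
  proof (rule that[OF e0 e1])
    fix q :: int assume q: "q \<noteq> 0"
    define a where "a = \<bar>real_of_int q\<bar>"
    have a1: "1 \<le> a" using q by (auto simp: a_def)
    have aq: "(of_int q)\<^sup>2 = a\<^sup>2" by (simp add: a_def)
    have "a\<^sup>2 * (1 + \<epsilon> * a) ^ l * norm (z 0 q) < M"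
    proof (cases "a \<le> Q")
      case True
      have "real l * (\<epsilon> * a) \<le> real l * (\<epsilon> * Q)" using True e0 by (intro mult_left_mono) auto
      also have "\<dots> = (1 / 2) * (real l / (real l + 1))" using Q by (simp add: \<epsilon>_def)
      also have "\<dots> \<le> (1 / 2) * 1" by (intro mult_left_mono) auto
      finally have le: "real l * (\<epsilon> * a) \<le> 1 / 2" by simp
      have "(1 + \<epsilon> * a) ^ l \<le> exp (\<epsilon> * a) ^ l"
        using exp_ge_add_one_self[of "\<epsilon> * a"] e0 a1 by (intro power_mono) auto
      also have "\<dots> = exp (real l * (\<epsilon> * a))" by (simp add: exp_of_nat_mult)
      also have "\<dots> \<le> exp (1 / 2)" using le by simp
      also have "\<dots> \<le> 2"
      proof (rule power2_le_imp_le)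
        have "(exp (1 / 2 :: real))\<^sup>2 = exp 1" by (simp add: power2_eq_square exp_add[symmetric])
        then show "(exp (1 / 2 :: real))\<^sup>2 \<le> 2\<^sup>2" using exp_le by simp
      qed simp
      finally have "(1 + \<epsilon> * a) ^ l * (a\<^sup>2 * norm (z 0 q)) \<le> 2 * (M / 4)"
        using small[OF q] e0 a1 unfolding aq by (intro mult_mono) auto
      then show ?thesis using M by (simp add: mult_ac)
    next
      case False
      have "D \<le> M * Q" using Q(2) M by (simp add: field_simps)
      also have "\<dots> < M * a" using False M by simp
      finally have big: "D < M * a" .
      have K0: "0 < K 0" by (rule K_pos[OF T0])
      have "norm (z 0 q) = norm (y 0 q) / K 0" using q K0 by (simp add: z_def norm_divide)
      also have "\<dots> \<le> B / (lam * a) ^ (l + 3) / K 0"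
      proof (rule divide_right_mono)
        have "0 < (lam * a) ^ (l + 3)" using lam a1 by simp
        then show "norm (y 0 q) \<le> B / (lam * a) ^ (l + 3)"
          using B(2)[of q] by (simp only: pos_le_divide_eq a_def mult.commute)
      qed (use K0 in simp)
      finally have zb: "norm (z 0 q) \<le> B / (lam * a) ^ (l + 3) / K 0" .
      have "\<epsilon> * a \<le> 1 * a" using e1 a1 by (intro mult_right_mono) auto
      then have "1 + \<epsilon> * a \<le> 2 * a" using a1 by linarith
      then have "(1 + \<epsilon> * a) ^ l \<le> (2 * a) ^ l" using a1 e0 by (intro power_mono) auto
      then have "a\<^sup>2 * (1 + \<epsilon> * a) ^ l * norm (z 0 q) \<le> a\<^sup>2 * (2 * a) ^ l * (B / (lam * a) ^ (l + 3) / K 0)"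
        using zb a1 e0 by (intro mult_mono) auto
      also have "\<dots> = D / a"
        using a1 lam K0 by (simp add: D_def power_mult_distrib power_add field_simps eval_nat_numeral)
      also have "\<dots> < M" using big a1 by (simp add: field_simps)
      finally show ?thesis .
    qed
    then show "(of_int q)\<^sup>2 * (1 + \<epsilon> * \<bar>of_int q\<bar>) ^ l * norm (z 0 q) < M"
      unfolding aq by (simp add: a_def)
  qed
qed

subsection \<open>The normalized flow\<close>

lemma original_time_range:
  assumes "0 < T" "0 \<le> \<tau>"
  shows "original_time p T \<tau> \<in> {0..<T}"
proof -
  have "0 \<le> (real p + 1) * \<tau>" using assms by simp
  then have "exp (- ((real p + 1) * \<tau>)) \<le> 1" by (simp only: exp_le_one_iff neg_le_0_iff_le)
  then have "exp (- (real p + 1) * \<tau>) \<le> 1" by (simp only: mult_minus_left)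
  then show ?thesis using assms by (simp add: original_time_def)
qed

lemma original_time_pos:
  assumes "0 < T" "0 < \<tau>"
  shows "0 < original_time p T \<tau>"
proof -
  have "0 < (real p + 1) * \<tau>" using assms by simp
  then have "exp (- ((real p + 1) * \<tau>)) < 1" by (simp only: exp_less_one_iff neg_less_0_iff_less)
  then have "exp (- (real p + 1) * \<tau>) < 1" by (simp only: mult_minus_left)
  then show ?thesis using assms by (simp add: original_time_def)
qed

lemma original_time_ratio:
  assumes "0 < T"
  shows "((T - original_time p T \<tau>) / T) powr (1 / real (p + 1)) = exp (- \<tau>)"
proof -
  have "(T - original_time p T \<tau>) / T = exp (- (real p + 1) * \<tau>)"
    using assms by (simp add: original_time_def field_simps)
  then show ?thesis by (simp add: powr_def field_simps)
qed

context pcsf_flow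
begin

definition sc :: "real \<Rightarrow> real" where
  "sc t = (real p / ((real p + 1) * (T - t))) powr (1 / (real p + 1))"

lemma sc_pos: "t \<in> I \<Longrightarrow> 0 < sc t"
  using p1 by (simp add: sc_def)

lemma inverse_sc: "t \<in> I \<Longrightarrow> inverse (sc t) = (real (p + 1) * (T - t) / real p) powr (1 / real (p + 1))"
  using p1 by (simp add: sc_def powr_divide inverse_eq_divide add.commute)

lemma normalized_flow_eq: "normalized_flow p T X \<tau> = (\<lambda>u. sc (original_time p T \<tau>) *\<^sub>R X (original_time p T \<tau>) u)"
  by (rule ext) (simp add: normalized_flow_def sc_def Let_def)

lemma scaled_derivative:
  assumes t: "t \<in> I"
  shows "vector_derivative (\<lambda>u. c *\<^sub>R X t u) (at u) = c *\<^sub>R D 0 1 t u"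
proof -
  have "((\<lambda>u. c *\<^sub>R X t u) has_vector_derivative c *\<^sub>R D 0 1 t u) (at u)"
    using D_u[OF t, of 0 0 u] D00 by (auto intro!: derivative_eq_intros)
  then show ?thesis by (rule vector_derivative_at)
qed

lemma scaled_normal: "t \<in> I \<Longrightarrow> 0 < c \<Longrightarrow> outward_normal (\<lambda>u. c *\<^sub>R X t u) u = cis (th t u)"
  by (simp add: outward_normal_def scaled_derivative th_cis sgn_scaleR)

lemma scaled_curvature:
  assumes t: "t \<in> I" and c: "0 < c"
  shows "curvature (\<lambda>u. c *\<^sub>R X t u) u = ka t u / c"
proof -
  have d: "vector_derivative (\<lambda>w. c *\<^sub>R D 0 1 t w) (at u) = c *\<^sub>R D 0 2 t u"
    using D01_u[OF t, of u] by (intro vector_derivative_at) (auto intro!: derivative_eq_intros)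
  have e: "vector_derivative (D 0 1 t) (at u) = D 0 2 t u" by (rule vector_derivative_at[OF D01_u[OF t]])
  have X': "(\<lambda>w. vector_derivative (X t) (at w)) = D 0 1 t" using X_u[OF t] by auto
  have "curvature (\<lambda>u. c *\<^sub>R X t u) u = Im (cnj (c *\<^sub>R D 0 1 t u) * (c *\<^sub>R D 0 2 t u)) / norm (c *\<^sub>R D 0 1 t u) ^ 3"
    unfolding curvature_def scaled_derivative[OF t] d ..
  also have "\<dots> = (Im (cnj (D 0 1 t u) * D 0 2 t u) / norm (D 0 1 t u) ^ 3) / c"
  proof -
    have "Im (cnj (c *\<^sub>R D 0 1 t u) * (c *\<^sub>R D 0 2 t u)) = c\<^sup>2 * Im (cnj (D 0 1 t u) * D 0 2 t u)"
      by (simp add: power2_eq_square algebra_simps)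
    moreover have "(c\<^sup>2 * i) / (c * n) ^ 3 = (i / n ^ 3) / c" for i n
      using c by (simp add: power2_eq_square power3_eq_cube)
    ultimately show ?thesis by (simp only: norm_scaleR abs_of_pos[OF c])
  qed
  also have "Im (cnj (D 0 1 t u) * D 0 2 t u) / norm (D 0 1 t u) ^ 3 = ka t u"
    using curvature_eq[OF t, of u] unfolding curvature_def X_u[OF t] X' e .
  finally show ?thesis .
qed

text \<open>Two continuous lifts of the same normal with the same initial value coincide, so every
  admissible family of angles is the constructed one. Scaling the curve does not affect the
  normal.\<close>

lemma angle_family_eq:
  assumes fam: "normal_angle_family {0..} (normalized_flow p T X) \<Theta>" and init: "\<Theta> 0 = \<theta>0" and \<tau>: "0 \<le> \<tau>"
  shows "\<Theta> \<tau> = th (original_time p T \<tau>)"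
proof
  fix u
  let ?ot = "original_time p T"
  have ot: "?ot s \<in> I" if "0 \<le> s" for s by (rule original_time_range[OF T0 that])
  have "continuous_on {0..} (\<lambda>s. (\<lambda>(t, u). \<Theta> t u) (s, u))"
  proof (rule continuous_on_compose2[of "{0..} \<times> UNIV" "\<lambda>(t, u). \<Theta> t u"])
    show "continuous_on ({0..} \<times> UNIV) (\<lambda>(t, u). \<Theta> t u)"
      using fam by (simp add: normal_angle_family_def)
  qed (auto intro!: continuous_intros)
  then have c1: "continuous_on {0..} (\<lambda>s. \<Theta> s u)" by simp
  have c2: "continuous_on {0..} (\<lambda>s. th (?ot s) u)"
  proof (rule continuous_on_compose2[OF th_cont_t])
    show "continuous_on {0..} ?ot" unfolding original_time_def by (intro continuous_intros)
  qed (use ot in blast)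
  have "cis (\<Theta> s u - th (?ot s) u) = 1" if "s \<in> {0..}" for s
  proof -
    have s: "0 \<le> s" using that by simp
    have "outward_normal (normalized_flow p T X s) u = cis (\<Theta> s u)"
      by (rule fam[unfolded normal_angle_family_def, THEN conjunct2, rule_format, OF that])
    moreover have "outward_normal (normalized_flow p T X s) u = cis (th (?ot s) u)"
      unfolding normalized_flow_eq by (rule scaled_normal[OF ot[OF s] sc_pos[OF ot[OF s]]])
    ultimately have "cis (\<Theta> s u) = cis (th (?ot s) u)" by simp
    then have "cis (\<Theta> s u) * cis (- th (?ot s) u) = cis (th (?ot s) u) * cis (- th (?ot s) u)" by simp
    then show ?thesis by (simp add: cis_mult)
  qed
  then have "\<Theta> \<tau> u - th (?ot \<tau>) u = \<Theta> 0 u - th (?ot 0) u"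
    by (intro lift_constant[where S="{0..}" and d="\<lambda>s. \<Theta> s u - th (?ot s) u" and c=1])
       (use c1 c2 \<tau> in \<open>auto intro!: continuous_intros\<close>)
  then show "\<Theta> \<tau> u = th (?ot \<tau>) u" by (simp add: init original_time_def th_def)
qed

lemma normalized_angle_curvature:
  assumes fam: "normal_angle_family {0..} (normalized_flow p T X) \<Theta>" and init: "\<Theta> 0 = \<theta>0" and \<tau>: "0 \<le> \<tau>"
  shows "angle_curvature (normalized_flow p T X \<tau>) (\<Theta> \<tau>) x
    = kk 0 (original_time p T \<tau>) x / sc (original_time p T \<tau>)"
proof -
  have t: "original_time p T \<tau> \<in> I" by (rule original_time_range[OF T0 \<tau>])
  show ?thesis
    unfolding angle_curvature_def normalized_flow_eq angle_family_eq[OF assms]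
    by (simp add: scaled_curvature[OF t sc_pos[OF t]] kk_def U_def)
qed

lemma initial_kk: "kk 0 0 x = angle_curvature \<gamma> \<theta>0 x"
proof -
  have z: "0 \<in> I" using T0 by simp
  have "th 0 = \<theta>0" by (auto simp: th_def)
  then show ?thesis using curvature_eq[OF z] by (simp add: kk_def angle_curvature_def U_def X0)
qed

lemma blow_up_kk:
  assumes "blows_up_at T X"
  shows "\<exists>t\<in>I. \<exists>x. M < kk 0 t x"
proof -
  obtain t u where "t \<in> I" "M < curvature (X t) u" using assms unfolding blows_up_at_def by blast
  then have "M < kk 0 t (th t u)" using curvature_eq[of t u] U_th[of t u] by (simp add: kk_def)
  with \<open>t \<in> I\<close> show ?thesis by blast
qed

lemma initial_shift:
  assumes sym: "\<And>u. \<gamma> (u + l) = cis l * \<gamma> u" and ang: "\<And>u. \<theta>0 (u + l) = \<theta>0 u + l"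
  shows "kk 0 0 (x + l) = kk 0 0 x"
proof -
  have z: "0 \<in> I" using T0 by simp
  have Dl: "D 0 j 0 (u + l) = cis l * D 0 j 0 u" for j u
  proof (induction j arbitrary: u)
    case 0
    then show ?case using sym D00 X0 by simp
  next
    case (Suc j)
    show ?case by (rule vector_derivative_shift_mult[where f="D 0 j 0"]) (rule Suc, rule D_u[OF z])
  qed
  have "ka 0 (u + l) = ka 0 u" for u
    by (simp add: ka_def g_def v_def Dl norm_mult)
  moreover have "U 0 (x + l) = U 0 x + l"
    using U_th[OF z, of "U 0 x + l"] ang[of "U 0 x"] th_U[OF z, of x] by (simp add: th_def)
  ultimately show ?thesis by (simp add: kk_def)
qed

text \<open>The reparametrization is by the normal angle: there the derivative of the curve is a
  constant times \<open>cis x / k x\<close>, so analyticity of the curvature passes to the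
  curve.\<close>

lemma analytic_time_slice:
  assumes t: "t \<in> I" and c: "0 < c" and lam: "0 < lam" and a: "0 < a"
    and decay: "\<And>q. norm (b q) \<le> B * exp (- (a * \<bar>of_int q\<bar>))"
    and rep: "fourier_rep lam b (\<lambda>x. of_real (kk 0 t x))"
  shows "analytic_closed_curve (2 * pi * real m) (\<lambda>u. c *\<^sub>R X t u)"
  unfolding analytic_closed_curve_def
proof (intro exI[of _ "U t"] conjI allI)
  have gs: "space_smooth I (\<lambda>t u. inverse (g t u))" by (rule inv_g_smooth)
  show "smooth_fun (U t)"
    unfolding smooth_fun_def
  proof (intro exI[of _ "\<lambda>j. case j of 0 \<Rightarrow> U t | Suc j \<Rightarrow> (\<lambda>x. angle_deriv (\<lambda>t u. inverse (g t u)) j t (U t x))"] conjI allI)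
    fix j x
    show "((case j of 0 \<Rightarrow> U t | Suc j \<Rightarrow> (\<lambda>x. angle_deriv (\<lambda>t u. inverse (g t u)) j t (U t x)))
       has_vector_derivative (case Suc j of 0 \<Rightarrow> U t | Suc j \<Rightarrow> (\<lambda>x. angle_deriv (\<lambda>t u. inverse (g t u)) j t (U t x))) x) (at x)"
    proof (cases j)
      case 0
      then show ?thesis using U_x[OF t, of x] by (simp add: has_real_derivative_iff_has_vector_derivative)
    next
      case (Suc i)
      then show ?thesis using angle_deriv_x[OF gs t, of i x]
        by (simp only: nat.case has_real_derivative_iff_has_vector_derivative)
    qed
  qed simp
  show "0 < deriv (U t) x" for x
    using DERIV_imp_deriv[OF U_x[OF t, of x]] g_pos[OF t, of "U t x"] by simp
  show "U t (x + 2 * pi * real m) = U t x + 2 * pi * real m" for x by (rule U_shift[OF t])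
  have der: "(((\<lambda>u. c *\<^sub>R X t u) \<circ> U t) has_vector_derivative (of_real c * \<i>) * cis x / of_real (kk 0 t x)) (at x)" for x
  proof -
    have "((\<lambda>u. c *\<^sub>R X t u) has_vector_derivative c *\<^sub>R D 0 1 t (U t x)) (at (U t x))"
      using D_u[OF t, of 0 0 "U t x"] D00 by (auto intro!: derivative_eq_intros)
    from vector_diff_chain_at[OF U_x[OF t, of x, unfolded has_real_derivative_iff_has_vector_derivative] this]
    have "(((\<lambda>u. c *\<^sub>R X t u) \<circ> U t) has_vector_derivative inverse (g t (U t x)) *\<^sub>R (c *\<^sub>R D 0 1 t (U t x))) (at x)" .
    moreover have "inverse (g t (U t x)) *\<^sub>R (c *\<^sub>R D 0 1 t (U t x)) = (of_real c * \<i>) * cis x / of_real (kk 0 t x)"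
    proof -
      define u where "u = U t x"
      have vp: "v t u \<noteq> 0" "ka t u \<noteq> 0" using v_nz[OF t] ka_pos[OF t, of u] by auto
      have "cis x = - \<i> * sgn (D 0 1 t u)" using th_cis[OF t, of u] th_U[OF t, of x] by (simp add: u_def)
      then have "sgn (D 0 1 t u) = \<i> * cis x" by simp
      then have "D 0 1 t u = of_real (v t u) * (\<i> * cis x)"
        using vp by (simp add: v_def sgn_div_norm scaleR_conv_of_real field_simps)
      then have "inverse (g t u) *\<^sub>R (c *\<^sub>R D 0 1 t u) = (of_real c * \<i>) * cis x / of_real (ka t u)"
        using vp by (simp add: g_ka[OF t] scaleR_conv_of_real field_simps)
      then show ?thesis by (simp add: u_def kk_def)
    qed
    ultimately show ?thesis by simp
  qed
  show "real_analytic ((\<lambda>u. c *\<^sub>R X t u) \<circ> U t)"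
    by (rule real_analytic_of_deriv[OF lam a decay rep kk_pos[OF t] der])
  show "vector_derivative ((\<lambda>u. c *\<^sub>R X t u) \<circ> U t) (at x) \<noteq> 0" for x
    using vector_derivative_at[OF der[of x]] c kk_pos[OF t, of x] by simp
qed

end

section \<open>Trapping applied to the curvature of the flow\<close>

context pcsf_flow
begin

abbreviation "\<psi> \<equiv> angle_curvature \<gamma> \<theta>0"

text \<open>A solution is only assumed to be closed with period \<open>P\<close>; the shorter period
  comes from the symmetry of the initial curve and its propagation.\<close>

lemma curvature_flowI:
  assumes lam: "0 < lam" and n: "0 < n" "real n * (2 * pi / lam) = P"
    and sym: "\<And>u. \<gamma> (u + 2 * pi / lam) = cis (2 * pi / lam) * \<gamma> u"
    and ang: "\<And>u. \<theta>0 (u + 2 * pi / lam) = \<theta>0 u + 2 * pi / lam"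
  shows "curvature_flow p lam T kk"
proof
  show "kk 0 t (x + 2 * pi / lam) = kk 0 t x" if "t \<in> {0..<T}" for t x
    by (rule curvature_symmetry[where T=T and P=P and p=p and n=n])
       (use kk_cont kk_dx kk_per kk_pos kk_dt initial_shift[OF sym ang] n lam p1 that in auto)
qed (use p1 lam T0 kk_cont kk_dx kk_pos kk_dt in auto)

lemma initial_modes:
  assumes cf: "curvature_flow p lam T kk"
  shows "curvature_flow.y lam kk 0 q = fourier_coeff lam \<psi> q"
    and "curvature_flow.K lam kk 0 = period_mean lam \<psi>" "0 < period_mean lam \<psi>"
    and "q \<noteq> 0 \<Longrightarrow> curvature_flow.z lam kk 0 q = fourier_coeff lam \<psi> q / of_real (period_mean lam \<psi>)"
proof -
  interpret cf: curvature_flow p lam T kk by (rule cf)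
  have z0: "0 \<in> {0..<T}" using T0 by simp
  have \<psi>: "kk 0 0 = \<psi>" using initial_kk by auto
  show K: "cf.K 0 = period_mean lam \<psi>" using cf.y_0[OF z0] by (simp add: cf.K_def \<psi>)
  show "0 < period_mean lam \<psi>" using cf.K_pos[OF z0] K by simp
  show y: "cf.y 0 q = fourier_coeff lam \<psi> q"
    using fun_cong[OF fco_of_real[of lam \<psi>], of q] by (simp add: cf.y_def \<psi>)
  show "q \<noteq> 0 \<Longrightarrow> cf.z 0 q = fourier_coeff lam \<psi> q / of_real (period_mean lam \<psi>)"
    using K y by (simp add: cf.z_def)
qed

text \<open>The weight is submultiplicative because \<open>1 + \<epsilon> * |q + s|\<close> is at
  most the product of the two factors; for \<open>\<epsilon> \<le> 1\<close> its growth constant is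
  1 with exponent \<open>l\<close>.\<close>

lemma trap_setup:
  assumes cf: "curvature_flow p lam T kk" and beta: "1 \<le> decay_rate p lam"
    and C: "1 \<le> C" "\<And>M. 0 \<le> M \<Longrightarrow> M \<le> 1 \<Longrightarrow> nlbound p lam M \<le> C * M\<^sup>2"
    and eps: "0 \<le> \<epsilon>" "\<epsilon> \<le> 1" and N: "0 \<le> N"
    and small: "\<And>q. q \<noteq> 0 \<Longrightarrow> (of_int q)\<^sup>2 * (1 + \<epsilon> * \<bar>of_int q\<bar>) ^ l *
      norm (fourier_coeff lam \<psi> q / of_real (period_mean lam \<psi>)) < trap_radius p lam C"
  shows "curvature_trap p lam T kk C (\<lambda>q. (1 + \<epsilon> * \<bar>of_int q\<bar>) ^ l) N 1 l"
proof -
  interpret cf: curvature_flow p lam T kk by (rule cf)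
  show ?thesis
  proof
    show "1 \<le> (1 + \<epsilon> * \<bar>real_of_int q\<bar>) ^ l" for q using eps by (intro one_le_power) auto
    show "(1 + \<epsilon> * \<bar>real_of_int (q + s)\<bar>) ^ l \<le> (1 + \<epsilon> * \<bar>real_of_int q\<bar>) ^ l * (1 + \<epsilon> * \<bar>real_of_int s\<bar>) ^ l" for q s
    proof -
      have "\<epsilon> * \<bar>real_of_int (q + s)\<bar> \<le> \<epsilon> * (\<bar>real_of_int q\<bar> + \<bar>real_of_int s\<bar>)"
        using eps by (intro mult_left_mono) auto
      moreover have "0 \<le> (\<epsilon> * \<bar>real_of_int q\<bar>) * (\<epsilon> * \<bar>real_of_int s\<bar>)" using eps by simp
      ultimately have "1 + \<epsilon> * \<bar>real_of_int (q + s)\<bar> \<le> (1 + \<epsilon> * \<bar>real_of_int q\<bar>) * (1 + \<epsilon> * \<bar>real_of_int s\<bar>)"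
        by (simp only: distrib_left distrib_right mult_1 mult_1_right)
      then show ?thesis unfolding power_mult_distrib[symmetric] using eps by (intro power_mono) auto
    qed
    show "(1 + \<epsilon> * \<bar>real_of_int q\<bar>) ^ l \<le> 1 * (1 + \<bar>real_of_int q\<bar>) ^ l" for q
      using eps mult_right_mono[OF eps(2), of "\<bar>real_of_int q\<bar>"] by (simp add: power_mono)
    show "(of_int q)\<^sup>2 * (1 + \<epsilon> * \<bar>of_int q\<bar>) ^ l * norm (cf.z 0 q) < trap_radius p lam C" if "q \<noteq> 0" for q
      using small[OF that] initial_modes(4)[OF cf that] by simp
  qed (use beta C N in auto)
qed

text \<open>The 8 is 2 times 4: \<open>norm_2_upper\<close> loses 2, and \<open>slow_weight\<close>
  asks for \<open>M / 4\<close>. The conclusion speaks of the initial curvature only, so \<epsilon>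
  does not depend on the solution.\<close>

lemma slow_weight_exists:
  assumes cf: "curvature_flow p lam T kk" and M: "0 < M"
    and hyp: "period_mean lam \<psi> \<ge> 8 / M * norm_2 lam \<psi>"
  shows "\<exists>\<epsilon>. 0 < \<epsilon> \<and> \<epsilon> \<le> 1 \<and> (\<forall>q. q \<noteq> 0 \<longrightarrow> (of_int q)\<^sup>2 * (1 + \<epsilon> * \<bar>of_int q\<bar>) ^ l *
      norm (fourier_coeff lam \<psi> q / of_real (period_mean lam \<psi>)) < M)"
proof -
  interpret cf: curvature_flow p lam T kk by (rule cf)
  have z0: "0 \<in> {0..<T}" using T0 by simp
  note y = initial_modes(1)[OF cf] and Kpos = initial_modes(3)[OF cf] and zq = initial_modes(4)[OF cf]
  obtain B where B: "\<And>q. (lam * \<bar>of_int q\<bar>) ^ 2 * norm (cf.y 0 q) \<le> B"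
    using cf.fourier_decay[OF z0, of 2] by metis
  have bd: "(real_of_int k)\<^sup>2 * norm (fourier_coeff lam \<psi> k) \<le> B / lam\<^sup>2" for k
    using B[of k] cf.lam y[of k] by (simp add: power_mult_distrib field_simps)
  have "(of_int q)\<^sup>2 * norm (cf.z 0 q) \<le> M / 4" if q: "q \<noteq> 0" for q
  proof -
    have "(real_of_int q)\<^sup>2 * norm (fourier_coeff lam \<psi> q) \<le> 2 * norm_2 lam \<psi>"
      by (rule norm_2_upper[OF bd q])
    also have "\<dots> \<le> M / 4 * period_mean lam \<psi>" using hyp M by (simp add: field_simps)
    finally show ?thesis
      using Kpos by (simp add: zq[OF q] norm_divide divide_le_eq)
  qed
  from cf.slow_weight[OF M this, of l] obtain \<epsilon> where "0 < \<epsilon>" "\<epsilon> \<le> 1"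
    "\<And>q. q \<noteq> 0 \<Longrightarrow> (of_int q)\<^sup>2 * (1 + \<epsilon> * \<bar>of_int q\<bar>) ^ l * norm (cf.z 0 q) < M" by blast
  then show ?thesis using zq by (intro exI[of _ \<epsilon>]) simp
qed

text \<open>No polynomial weight is used (\<open>l = 0\<close>). The trap holds at every truncation
  level with the same clock and the same radius, hence the exponential bound is uniform over all
  modes.\<close>

lemma normalized_analytic:
  assumes cf: "curvature_flow p lam T kk" and beta: "1 \<le> decay_rate p lam"
    and C: "1 \<le> C" "\<And>M. 0 \<le> M \<Longrightarrow> M \<le> 1 \<Longrightarrow> nlbound p lam M \<le> C * M\<^sup>2"
    and small: "\<And>q. q \<noteq> 0 \<Longrightarrow> (of_int q)\<^sup>2 *
      norm (fourier_coeff lam \<psi> q / of_real (period_mean lam \<psi>)) < trap_radius p lam C"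
    and \<tau>: "0 < \<tau>"
  shows "analytic_closed_curve (2 * pi * real m) (normalized_flow p T X \<tau>)"
proof -
  interpret cf: curvature_flow p lam T kk by (rule cf)
  define t where "t = original_time p T \<tau>"
  have t: "t \<in> {0..<T}" "0 < t"
    using original_time_range[OF T0, of \<tau>] original_time_pos[OF T0 \<tau>] \<tau> by (auto simp: t_def)
  define M where "M = trap_radius p lam C"
  \<comment> \<open>This is \<open>(1 - xx t) / 2\<close>, written out because the trap is
    interpreted below with several values of \<open>N\<close>.\<close>
  define a where "a = (1 - exp (- (integral {0..t} (\<lambda>s. cf.K s ^ (p + 1)) / real p))) / 2"
  have trap: "curvature_trap p lam T kk C (\<lambda>q. (1 + 0 * \<bar>of_int q\<bar>) ^ 0) N 1 0" if "0 \<le> N" for N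
    by (rule trap_setup[OF cf beta C]) (use small that in auto)
  have a: "0 < a"
  proof -
    interpret tr: curvature_trap p lam T kk C "\<lambda>q. (1 + 0 * \<bar>of_int q\<bar>) ^ 0" 0 1 0 by (rule trap) simp
    show ?thesis using tr.xx_less_1[OF t] by (simp add: a_def tr.xx_def tr.sg_def)
  qed
  have zb: "norm (cf.z t q) \<le> 3 * M * exp (- (a * \<bar>of_int q\<bar>))" if "q \<noteq> 0" for q
  proof -
    \<comment> \<open>The level \<open>N = |q|\<close> leaves the weight of the mode
      \<open>q\<close> itself untouched by the truncation.\<close>
    interpret tr: curvature_trap p lam T kk C "\<lambda>q. (1 + 0 * \<bar>of_int q\<bar>) ^ 0" "\<bar>of_int q\<bar>" 1 0 by (rule trap) simp
    have "(1 - tr.xx t) / 2 = a" by (simp add: a_def tr.xx_def tr.sg_def)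
    moreover have "tr.mu q = \<bar>of_int q\<bar>" by (simp add: tr.mu_def)
    ultimately show ?thesis using tr.z_exp_decay[OF t(1) that] by (simp add: M_def)
  qed
  have M: "0 < M"
  proof -
    interpret tr: curvature_trap p lam T kk C "\<lambda>q. (1 + 0 * \<bar>of_int q\<bar>) ^ 0" 0 1 0 by (rule trap) simp
    show ?thesis using tr.M0_pos by (simp add: M_def)
  qed
  have Kt: "0 < cf.K t" by (rule cf.K_pos[OF t(1)])
  have yb: "norm (cf.y t q) \<le> (cf.K t * (3 * M + 1)) * exp (- (a * \<bar>of_int q\<bar>))" for q
  proof (cases "q = 0")
    case True
    have "cf.K t * 1 \<le> cf.K t * (3 * M + 1)" using Kt M by (intro mult_left_mono) auto
    then show ?thesis using True Kt by (simp add: cf.y_0_K[OF t(1)])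
  next
    case False
    then have "norm (cf.y t q) = cf.K t * norm (cf.z t q)" using Kt by (simp add: cf.z_def norm_divide)
    also have "\<dots> \<le> cf.K t * (3 * M * exp (- (a * \<bar>of_int q\<bar>)))"
      using zb[OF False] Kt by (intro mult_left_mono) auto
    also have "\<dots> \<le> cf.K t * ((3 * M + 1) * exp (- (a * \<bar>of_int q\<bar>)))"
      using Kt by (intro mult_left_mono mult_right_mono) auto
    finally show ?thesis by (simp add: mult_ac)
  qed
  have rep: "fourier_rep lam (cf.y t) (\<lambda>x. of_real (kk 0 t x))"
    using cf.rep_kk[OF t(1), of 0] by simp
  show ?thesis
    unfolding normalized_flow_eq t_def[symmetric]
    by (rule analytic_time_slice[OF t(1) sc_pos[OF t(1)] cf.lam a yb rep])
qed

text \<open>Here \<open>N = 0\<close> switches the exponential weight off. In the constant, the 2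
  comes from \<open>K_scale\<close>, \<open>4 * exp 1\<close> from \<open>K_ratio\<close> and
  \<open>ln_K_bound\<close>, and \<open>(1 / \<epsilon>) ^ l\<close> from trading powers of
  \<open>|q|\<close> for the weight.\<close>

lemma normalized_decay:
  assumes cf: "curvature_flow p lam T kk" and beta: "1 \<le> decay_rate p lam"
    and C: "1 \<le> C" "\<And>M. 0 \<le> M \<Longrightarrow> M \<le> 1 \<Longrightarrow> nlbound p lam M \<le> C * M\<^sup>2"
    and eps: "0 < \<epsilon>" "\<epsilon> \<le> 1"
    and small: "\<And>q. q \<noteq> 0 \<Longrightarrow> (of_int q)\<^sup>2 * (1 + \<epsilon> * \<bar>of_int q\<bar>) ^ l *
      norm (fourier_coeff lam \<psi> q / of_real (period_mean lam \<psi>)) < trap_radius p lam C"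
    and blow: "blows_up_at T X"
    and fam: "normal_angle_family {0..} (normalized_flow p T X) \<Theta>" and init: "\<Theta> 0 = \<theta>0"
    and kt: "\<And>\<tau>. ktilde \<tau> = angle_curvature (normalized_flow p T X \<tau>) (\<Theta> \<tau>)"
    and \<tau>: "0 \<le> \<tau>"
  shows "Cl_norm l {0..2 * pi / lam} (\<lambda>x. ktilde \<tau> x - period_mean lam (ktilde \<tau>))
    \<le> (2 * (1 + lam) ^ l * (1 / \<epsilon>) ^ l * (3 * trap_radius p lam C) * zeta2 * (4 * exp 1) powr decay_rate p lam)
       * exp (- decay_rate p lam * \<tau>)"
proof -
  interpret cf: curvature_flow p lam T kk by (rule cf)
  interpret tr: curvature_trap p lam T kk C "\<lambda>q. (1 + \<epsilon> * \<bar>of_int q\<bar>) ^ l" 0 1 l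
    by (rule trap_setup[OF cf beta C]) (use eps small in auto)
  define t where "t = original_time p T \<tau>"
  have t: "t \<in> {0..<T}" unfolding t_def by (rule original_time_range[OF T0 \<tau>])
  define S where "S = inverse (sc t)"
  have S: "0 < S" using sc_pos[OF t] by (simp add: S_def)
  have Kt: "0 < cf.K t" by (rule cf.K_pos[OF t])
  have blow': "\<And>M. \<exists>t\<in>{0..<T}. \<exists>x. M < kk 0 t x" using blow_up_kk[OF blow] by blast
  have SK: "S * cf.K t \<le> 2" using tr.K_scale[OF blow' t] inverse_sc[OF t] by (simp add: S_def)
  have ratio: "cf.K 0 / cf.K t \<le> 4 * exp (- \<tau>)"
    using tr.K_ratio[OF blow' t] original_time_ratio[OF T0, of p \<tau>] by (simp add: t_def)
  define \<beta> where "\<beta> = decay_rate p lam"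
  have K0: "0 < cf.K 0" using cf.K_pos T0 by simp
  have pw: "(exp 1 * cf.K 0 / cf.K t) powr \<beta> \<le> (4 * exp 1) powr \<beta> * exp (- \<beta> * \<tau>)"
  proof -
    have "exp 1 * (cf.K 0 / cf.K t) \<le> exp 1 * (4 * exp (- \<tau>))" using ratio by (intro mult_left_mono) auto
    then have "(exp 1 * cf.K 0 / cf.K t) powr \<beta> \<le> ((4 * exp 1) * exp (- \<tau>)) powr \<beta>"
      using K0 Kt beta by (intro powr_mono2) (auto simp: \<beta>_def mult_ac)
    also have "\<dots> = (4 * exp 1) powr \<beta> * exp (- \<beta> * \<tau>)"
      by (simp add: powr_mult powr_def[of "exp (- \<tau>)"])
    finally show ?thesis .
  qed
  have ktt: "ktilde \<tau> = (\<lambda>x. S * kk 0 t x)"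
    using normalized_angle_curvature[OF fam init \<tau>] by (auto simp: kt t_def S_def divide_inverse mult.commute)
  have mean: "period_mean lam (ktilde \<tau>) = S * cf.K t"
  proof -
    have "cf.K t = period_mean lam (kk 0 t)" using cf.y_0[OF t] by (simp add: cf.K_def)
    then show ?thesis unfolding ktt by (simp add: period_mean_def)
  qed
  have dj: "(deriv ^^ j) (\<lambda>x. ktilde \<tau> x - period_mean lam (ktilde \<tau>)) = (\<lambda>x. S * (kk j t x - (if j = 0 then cf.K t else 0)))" for j
  proof (induction j)
    case 0
    then show ?case unfolding mean by (simp add: ktt right_diff_distrib)
  next
    case (Suc j)
    have "((\<lambda>x. S * (kk j t x - (if j = 0 then cf.K t else 0))) has_real_derivative S * (kk (Suc j) t x - 0)) (at x)" for x
      by (intro DERIV_cmult DERIV_diff kk_dx[OF t] DERIV_const)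
    then have "deriv (\<lambda>x. S * (kk j t x - (if j = 0 then cf.K t else 0))) = (\<lambda>x. S * kk (Suc j) t x)"
      using DERIV_imp_deriv by fastforce
    then show ?case using Suc by simp
  qed
  define A where "A = 2 * (1 + lam) ^ l * (1 / \<epsilon>) ^ l * (3 * trap_radius p lam C) * zeta2 * (4 * exp 1) powr \<beta>"
  have bound: "\<bar>(deriv ^^ j) (\<lambda>x. ktilde \<tau> x - period_mean lam (ktilde \<tau>)) x\<bar> \<le> A * exp (- \<beta> * \<tau>)" if j: "j \<le> l" for j x
  proof -
    have D: "\<bar>real_of_int q\<bar> ^ j \<le> (1 / \<epsilon>) ^ j * (1 + \<epsilon> * \<bar>of_int q\<bar>) ^ l" for q
    proof -
      have "\<bar>real_of_int q\<bar> ^ j = (1 / \<epsilon>) ^ j * (\<epsilon> * \<bar>of_int q\<bar>) ^ j"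
        using eps by (simp add: power_mult_distrib[symmetric])
      also have "(\<epsilon> * \<bar>of_int q\<bar>) ^ j \<le> (1 + \<epsilon> * \<bar>of_int q\<bar>) ^ j" using eps by (intro power_mono) auto
      also have "\<dots> \<le> (1 + \<epsilon> * \<bar>of_int q\<bar>) ^ l" using eps j by (intro power_increasing) auto
      finally show ?thesis using eps by (simp add: mult_left_mono)
    qed
    have "S * (kk j t x - (if j = 0 then cf.K t else 0)) = (S * cf.K t) * (kk j t x / cf.K t - (if j = 0 then 1 else 0))"
      using Kt by (simp add: field_simps)
    moreover have "norm (cf.w j t x) = \<bar>kk j t x / cf.K t - (if j = 0 then 1 else 0)\<bar>"
      unfolding cf.w_def norm_of_real ..
    ultimately have "\<bar>(deriv ^^ j) (\<lambda>x. ktilde \<tau> x - period_mean lam (ktilde \<tau>)) x\<bar> = (S * cf.K t) * norm (cf.w j t x)"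
      unfolding dj using S Kt by (simp add: abs_mult)
    also have "\<dots> \<le> 2 * (lam ^ j * (1 / \<epsilon>) ^ j * (3 * trap_radius p lam C) * zeta2 * (exp 1 * cf.K 0 / cf.K t) powr \<beta>)"
      using SK tr.w_decay[OF t D, of x] S Kt unfolding \<beta>_def by (intro mult_mono) auto
    also have "\<dots> \<le> 2 * (((1 + lam) ^ l) * (1 / \<epsilon>) ^ l * (3 * trap_radius p lam C) * zeta2 * ((4 * exp 1) powr \<beta> * exp (- \<beta> * \<tau>)))"
    proof -
      have "lam ^ j \<le> (1 + lam) ^ j" using cf.lam by (intro power_mono) auto
      also have "\<dots> \<le> (1 + lam) ^ l" using cf.lam j by (intro power_increasing) auto
      finally have 1: "lam ^ j \<le> (1 + lam) ^ l" .
      have 2: "(1 / \<epsilon>) ^ j \<le> (1 / \<epsilon>) ^ l" using eps j by (intro power_increasing) auto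
      have "lam ^ j * (1 / \<epsilon>) ^ j \<le> (1 + lam) ^ l * (1 / \<epsilon>) ^ l"
        using 1 2 cf.lam eps by (intro mult_mono) auto
      then have "lam ^ j * (1 / \<epsilon>) ^ j * ((3 * trap_radius p lam C) * zeta2) \<le> (1 + lam) ^ l * (1 / \<epsilon>) ^ l * ((3 * trap_radius p lam C) * zeta2)"
        using tr.M0_pos zeta2_pos by (intro mult_right_mono) auto
      from mult_mono[OF this pw] show ?thesis
        using cf.lam eps tr.M0_pos zeta2_pos by (simp add: mult.assoc)
    qed
    finally show ?thesis by (simp add: A_def mult_ac)
  qed
  have ne: "{0..2 * pi / lam} \<noteq> {}" using cf.lam by simp
  have "Cl_norm l {0..2 * pi / lam} (\<lambda>x. ktilde \<tau> x - period_mean lam (ktilde \<tau>)) \<le> A * exp (- \<beta> * \<tau>)"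
    unfolding Cl_norm_def
  proof (rule Max.boundedI)
    fix s assume "s \<in> (\<lambda>j. SUP x\<in>{0..2 * pi / lam}. \<bar>(deriv ^^ j) (\<lambda>x. ktilde \<tau> x - period_mean lam (ktilde \<tau>)) x\<bar>) ` {..l}"
    then obtain j where "j \<le> l" "s = (SUP x\<in>{0..2 * pi / lam}. \<bar>(deriv ^^ j) (\<lambda>x. ktilde \<tau> x - period_mean lam (ktilde \<tau>)) x\<bar>)" by auto
    then show "s \<le> A * exp (- \<beta> * \<tau>)" using bound by (auto intro!: cSUP_least[OF ne])
  qed auto
  then show ?thesis by (simp add: A_def \<beta>_def)
qed

end

theorem corollary2p1:
  fixes p n m :: nat and lam :: real
  assumes "1 \<le> p" and "0 < n" and "0 < m" and "coprime n m"
    and "lam = real n / real m"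
    and "sqrt ((real p + 2) / real p) < lam"
  shows "\<exists>c>0. \<forall>(\<phi> :: real \<Rightarrow> real) (\<delta> :: real) (\<theta>\<^sub>0 :: real \<Rightarrow> real) (\<psi> :: real \<Rightarrow> real).
    smooth_fun \<phi> \<longrightarrow>
    (\<forall>u. \<phi> (u + 2 * pi / lam) = \<phi> u) \<longrightarrow>
    \<delta> \<noteq> 0 \<longrightarrow>
    (\<forall>u. 0 < 1 + \<delta> * \<phi> u) \<longrightarrow>
    (\<forall>u. 0 < curvature (perturbed_circle \<phi> \<delta>) u) \<longrightarrow>
    normal_angle (perturbed_circle \<phi> \<delta>) \<theta>\<^sub>0 \<longrightarrow>
    \<psi> = angle_curvature (perturbed_circle \<phi> \<delta>) \<theta>\<^sub>0 \<longrightarrow>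
    period_mean lam \<psi> \<ge> c * norm_2 lam \<psi> \<longrightarrow>
    (\<forall>l::nat. \<exists>A>0. \<forall>T X \<Theta> ktilde.
        pcsf_solution p m (perturbed_circle \<phi> \<delta>) T X \<longrightarrow>
        blows_up_at T X \<longrightarrow>
        normal_angle_family {0..} (normalized_flow p T X) \<Theta> \<longrightarrow>
        \<Theta> 0 = \<theta>\<^sub>0 \<longrightarrow>
        (\<forall>\<tau>. ktilde \<tau> = angle_curvature (normalized_flow p T X \<tau>) (\<Theta> \<tau>)) \<longrightarrow>
        (\<forall>\<tau>\<ge>0. Cl_norm l {0..2 * pi / lam} (\<lambda>x. ktilde \<tau> x - period_mean lam (ktilde \<tau>))
                 \<le> A * exp (- decay_rate p lam * \<tau>))) \<and>
    (\<forall>T X.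
        pcsf_solution p m (perturbed_circle \<phi> \<delta>) T X \<longrightarrow>
        blows_up_at T X \<longrightarrow>
        (\<forall>\<tau>>0. analytic_closed_curve (2 * pi * real m) (normalized_flow p T X \<tau>)))"
proof -
  have lam: "0 < lam" using assms by simp
  \<comment> \<open>The hypothesis on \<open>lam\<close> says that the rate exceeds 1; this is what
    keeps the modes below \<open>xx\<close>.\<close>
  have beta: "1 \<le> decay_rate p lam"
  proof -
    have "sqrt ((real p + 2) / real p) ^ 2 < lam ^ 2"
      using assms(6) by (intro power_strict_mono) auto
    then have "(real p + 2) / real p < lam\<^sup>2" by simp
    then have "real p + 2 < lam\<^sup>2 * real p" using assms(1) by (simp add: field_simps)
    then show ?thesis by (simp add: decay_rate_eq[OF assms(1)])
  qed
  obtain C where C: "1 \<le> C" "\<And>M. 0 \<le> M \<Longrightarrow> M \<le> 1 \<Longrightarrow> nlbound p lam M \<le> C * M\<^sup>2"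
    using nlbound_quadratic[OF lam assms(1)] by metis
  define M where "M = trap_radius p lam C"
  have M: "0 < M" using assms(1) C(1) beta by (simp add: M_def trap_radius_def)
  show ?thesis
  proof (rule exI[of _ "8 / M"], intro conjI allI impI)
    show "0 < 8 / M" using M by simp
  next
    fix \<phi> \<delta> \<theta>0 \<psi>
    assume sm: "smooth_fun \<phi>" and per: "\<forall>u. \<phi> (u + 2 * pi / lam) = \<phi> u"
      and rpos: "\<forall>u. 0 < 1 + \<delta> * \<phi> u" and cpos: "\<forall>u. 0 < curvature (perturbed_circle \<phi> \<delta>) u"
      and ang: "normal_angle (perturbed_circle \<phi> \<delta>) \<theta>0"
      and \<psi>: "\<psi> = angle_curvature (perturbed_circle \<phi> \<delta>) \<theta>0"
      and hyp: "8 / M * norm_2 lam \<psi> \<le> period_mean lam \<psi>"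
    let ?\<gamma> = "perturbed_circle \<phi> \<delta>"
    have ang_l: "\<theta>0 (u + 2 * pi / lam) = \<theta>0 u + 2 * pi / lam" for u
      by (rule perturbed_circle_angle_shift[OF sm _ _ ang]) (use per rpos in auto)
    have nL: "real n * (2 * pi / lam) = 2 * pi * real m" using assms by simp
    have ang_j: "\<theta>0 (u + real j * (2 * pi / lam)) = \<theta>0 u + real j * (2 * pi / lam)" for u j
    proof (induction j)
      case (Suc j)
      have step: "v + real (Suc j) * x = (v + real j * x) + x" for v x by (simp add: algebra_simps)
      have "u + real (Suc j) * (2 * pi / lam) = (u + real j * (2 * pi / lam)) + 2 * pi / lam" by (rule step)
      then have "\<theta>0 (u + real (Suc j) * (2 * pi / lam)) = \<theta>0 (u + real j * (2 * pi / lam)) + 2 * pi / lam"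
        by (simp only: ang_l)
      also have "\<dots> = \<theta>0 u + real (Suc j) * (2 * pi / lam)" unfolding Suc by (rule step[symmetric])
      finally show ?case .
    qed simp
    have ang_P: "\<theta>0 (u + 2 * pi * real m) = \<theta>0 u + 2 * pi * real m" for u
      using ang_j[of u n] unfolding nL .
    have sym: "?\<gamma> (u + 2 * pi / lam) = cis (2 * pi / lam) * ?\<gamma> u" for u
      by (rule perturbed_circle_shift) (use per in auto)
    have flow: "\<exists>D. pcsf_flow p m T ?\<gamma> X D \<theta>0" if sol: "pcsf_solution p m ?\<gamma> T X" for T X
    proof -
      have "smooth_family {0..<T} X" using sol by (simp add: pcsf_solution_def)
      then obtain D where D: "D 0 0 = X"
        "\<And>i j. continuous_on ({0..<T} \<times> UNIV) (\<lambda>(t, u). D i j t u)"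
        "\<And>i j t u. t \<in> {0..<T} \<Longrightarrow> ((\<lambda>s. D i j s u) has_vector_derivative D (Suc i) j t u) (at t within {0..<T})"
        "\<And>i j t u. t \<in> {0..<T} \<Longrightarrow> (D i j t has_vector_derivative D i (Suc j) t u) (at u)"
        unfolding smooth_family_def by blast
      have "pcsf_flow p m T ?\<gamma> X D \<theta>0"
        by (rule pcsf_flow.intro) (use assms(1,3) sol D cpos ang ang_P in auto)
      then show ?thesis by blast
    qed
    have weight: "\<exists>\<epsilon>. 0 < \<epsilon> \<and> \<epsilon> \<le> 1 \<and> (\<forall>q. q \<noteq> 0 \<longrightarrow> (of_int q)\<^sup>2 * (1 + \<epsilon> * \<bar>of_int q\<bar>) ^ l *
      norm (fourier_coeff lam \<psi> q / of_real (period_mean lam \<psi>)) < M)" if sol: "pcsf_solution p m ?\<gamma> T X" for l T X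
    proof -
      obtain D where "pcsf_flow p m T ?\<gamma> X D \<theta>0" using flow[OF sol] by blast
      then interpret pf: pcsf_flow p m T ?\<gamma> X D \<theta>0 .
      have cf: "curvature_flow p lam T pf.kk"
        by (rule pf.curvature_flowI[OF lam assms(2) nL sym ang_l])
      show ?thesis using pf.slow_weight_exists[OF cf M] hyp unfolding \<psi> by blast
    qed
    show "\<exists>A>0. \<forall>T X \<Theta> ktilde.
        pcsf_solution p m ?\<gamma> T X \<longrightarrow> blows_up_at T X \<longrightarrow>
        normal_angle_family {0..} (normalized_flow p T X) \<Theta> \<longrightarrow> \<Theta> 0 = \<theta>0 \<longrightarrow>
        (\<forall>\<tau>. ktilde \<tau> = angle_curvature (normalized_flow p T X \<tau>) (\<Theta> \<tau>)) \<longrightarrow>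
        (\<forall>\<tau>\<ge>0. Cl_norm l {0..2 * pi / lam} (\<lambda>x. ktilde \<tau> x - period_mean lam (ktilde \<tau>))
                 \<le> A * exp (- decay_rate p lam * \<tau>))" for l
    \<comment> \<open>\<open>A\<close> has to be fixed before the solution. Any one solution
      provides \<epsilon>, whose defining inequality concerns the initial curvature alone and thus
      serves every other solution; without a solution the claim is vacuous.\<close>
    proof (cases "\<exists>T X. pcsf_solution p m ?\<gamma> T X")
      case False
      then have no: "\<not> pcsf_solution p m ?\<gamma> T X" for T X by blast
      show ?thesis by (rule exI[of _ 1]) (simp only: no, simp)
    next
      case True
      then obtain T0 X0 where "pcsf_solution p m ?\<gamma> T0 X0" by blast
      from weight[OF this, of l] obtain \<epsilon> where e: "0 < \<epsilon> \<and> \<epsilon> \<le> 1 \<and> (\<forall>q. q \<noteq> 0 \<longrightarrow> (of_int q)\<^sup>2 * (1 + \<epsilon> * \<bar>of_int q\<bar>) ^ l *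
        norm (fourier_coeff lam \<psi> q / of_real (period_mean lam \<psi>)) < M)" by (rule exE)
      then have eps: "0 < \<epsilon>" "\<epsilon> \<le> 1" by simp_all
      have small: "(of_int q)\<^sup>2 * (1 + \<epsilon> * \<bar>of_int q\<bar>) ^ l *
        norm (fourier_coeff lam \<psi> q / of_real (period_mean lam \<psi>)) < M" if "q \<noteq> 0" for q
        using e that by blast
      define A where "A = 2 * (1 + lam) ^ l * (1 / \<epsilon>) ^ l * (3 * trap_radius p lam C) * zeta2 * (4 * exp 1) powr decay_rate p lam"
      have A: "0 < A" using lam eps M zeta2_pos by (simp add: A_def M_def)
      show ?thesis
      proof (rule exI[of _ A], intro conjI A allI impI)
        fix T X \<Theta> ktilde \<tau>
        assume sol: "pcsf_solution p m ?\<gamma> T X" and blow: "blows_up_at T X"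
          and fam: "normal_angle_family {0..} (normalized_flow p T X) \<Theta>" and init: "\<Theta> 0 = \<theta>0"
          and kt: "\<forall>\<tau>. ktilde \<tau> = angle_curvature (normalized_flow p T X \<tau>) (\<Theta> \<tau>)" and \<tau>: "0 \<le> (\<tau> :: real)"
        obtain D where "pcsf_flow p m T ?\<gamma> X D \<theta>0" using flow[OF sol] by blast
        then interpret pf: pcsf_flow p m T ?\<gamma> X D \<theta>0 .
        have cf: "curvature_flow p lam T pf.kk"
          by (rule pf.curvature_flowI[OF lam assms(2) nL sym ang_l])
        show "Cl_norm l {0..2 * pi / lam} (\<lambda>x. ktilde \<tau> x - period_mean lam (ktilde \<tau>)) \<le> A * exp (- decay_rate p lam * \<tau>)"
          unfolding A_def
          by (rule pf.normalized_decay[OF cf beta C eps small[unfolded \<psi> M_def] blow fam init kt[rule_format] \<tau>])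
      qed
    qed
    show "analytic_closed_curve (2 * pi * real m) (normalized_flow p T X \<tau>)"
      if sol: "pcsf_solution p m ?\<gamma> T X" and \<tau>: "0 < \<tau>" for T X \<tau>
    proof -
      obtain D where "pcsf_flow p m T ?\<gamma> X D \<theta>0" using flow[OF sol] by blast
      then interpret pf: pcsf_flow p m T ?\<gamma> X D \<theta>0 .
      have cf: "curvature_flow p lam T pf.kk"
        by (rule pf.curvature_flowI[OF lam assms(2) nL sym ang_l])
      have "\<And>q. q \<noteq> 0 \<Longrightarrow> (of_int q)\<^sup>2 *
         norm (fourier_coeff lam \<psi> q / of_real (period_mean lam \<psi>)) < trap_radius p lam C"
        using weight[OF sol, of 0] by (auto simp: M_def)
      from pf.normalized_analytic[OF cf beta C this[unfolded \<psi>] \<tau>] show ?thesis .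
    qed
  qed
qed

end
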